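(* Suppose $\boldsymbol\xi\sim P$ satisfies density-level regular variation. Let $(L_1,\dots,L_K)\in\mathcal H_1(L_1^\star,\dots,L_K^\star)$ be regular, let $\mathcal J\in\mathfrak J$ be a nonempty subset of $[K]$ under consideration, and suppose $\{\widetilde{\boldsymbol\xi}_u\}_{u>0}\in\mathcal T(P)$. Let $W:\mathbb R^K\to\mathsf Y$ be measurable with values in a metric space $\mathsf Y$, and set $W_u(\boldsymbol z)=W(\boldsymbol L_u(\boldsymbol z))$ and $W^\star(\boldsymbol z)=W(\boldsymbol L^\star(\boldsymbol z))$. Suppose that $W$ is continuous at $\boldsymbol L^\star(\boldsymbol z)$ for all $\boldsymbol z\in D_0$, where $D_0\subset\mathcal E$ is measurable and $\mathbb P(\boldsymbol Z^\star\in D_0)=1$. Then, as $u\to\infty$, $$W_u(\boldsymbol Z_u)\Rightarrow W^\star(\boldsymbol Z^\star),\qquad W_u(\widetilde{\boldsymbol Z}_u)\Rightarrow W^\star(\boldsymbol Z^\star).$$ In particular, these conclusions hold when $\widetilde{\boldsymbol\xi}_u=\boldsymbol\xi_u^{\rm gen}$.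
   Context: Setting. $\|\cdot\|$ is the Euclidean norm on $\mathbb R^d$; $\mathcal E\subset\mathbb R^d$ is a closed cone; $\Theta_{\mathcal E}=\{\boldsymbol z\in\mathcal E:\|\boldsymbol z\|=1\}$; $B_r=\{\boldsymbol z:\|\boldsymbol z\|\le r\}$; $d\boldsymbol\phi$ is surface measure on $\Theta_{\mathcal E}$, so $d\boldsymbol z=r^{d-1}\,dr\,d\boldsymbol\phi$ for $\boldsymbol z=r\boldsymbol\phi$. $\boldsymbol\xi\sim P$ is a random vector with density $f_{\boldsymbol\xi}$ supported on $\mathcal E$. $[K]=\{1,\dots,K\}$; $\Rightarrow$ is convergence in distribution. Density-level regular variation: $f_{\boldsymbol\xi}$ is continuous on $B_{r_0}^c\cap\mathcal E$ for some $r_0>0$, and there are $s>0$ and $\varphi^\star:\mathcal E\setminus\{\boldsymbol 0\}\to(0,\infty)$ with $t^{s+d}f_{\boldsymbol\xi}(t\boldsymbol z)\to\varphi^\star(\boldsymbol z)$ as $t\to\infty$, uniformly over compact subsets of $\mathcal E\setminus\{\boldsymbol 0\}$. $\boldsymbol M_0$-convergence: $\boldsymbol M_0$ is the class of nonnegative Borel measures on $\mathcal E\setminus\{\boldsymbol0\}$ that are finite on $\{\|\boldsymbol z\|>r\}$ for every $r>0$. $\mu_n\to\mu$ in $\boldsymbol M_0$ if $\mu_n(B)\to\mu(B)$ for every Borel $B$ with $\mu(\partial B)=0$ and $\boldsymbol0\notin\operatorname{cl}(B)$ (and similarly for a continuous parameter $u\to\infty$). Limiting tail measure: $d\nu^\star(r,\boldsymbol\phi)=r^{-(s+1)}\varphi^\star(\boldsymbol\phi)\,dr\,d\boldsymbol\phi$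 on $\mathcal E\setminus\{\boldsymbol0\}$ in polar coordinates; it is the $\boldsymbol M_0$-limit of $t^s\mathbb P(t^{-1}\boldsymbol\xi\in\cdot)$. A family of $\mathcal E$-valued random vectors $\{\boldsymbol\xi_u\}_{u>0}$ is in $\mathcal T(P)$ (tail preserving) if $u^s\mathbb P(u^{-1}\boldsymbol\xi_u\in\cdot)\to\nu^\star$ in $\boldsymbol M_0$ as $u\to\infty$. Loss systems: measurable functions $L_1,\dots,L_K:\mathcal E\to\mathbb R$ form an asymptotically homogeneous multi-loss system, written $(L_1,\dots,L_K)\in\mathcal H_1(L_1^\star,\dots,L_K^\star)$, if for each $j$, $L_j^\star:\mathcal E\to\mathbb R$ satisfies $\{L_j^\star>0\}\ne\varnothing$ and $t^{-1}L_j(t\boldsymbol z_t)\to L_j^\star(\boldsymbol z)$ whenever $t\to\infty$ and $\boldsymbol z_t\to\boldsymbol z$ in $\mathcal E$. $\mathcal S(u;\mathcal J)=\{\boldsymbol z\in\mathcal E:L_j(\boldsymbol z)\ge u\ \forall j\in\mathcal J\}$, $\mathcal S^\star(\mathcal J)=\{\boldsymbol z\in\mathcal E:L_j^\star(\boldsymbol z)\ge1\ \forall j\in\mathcal J\}$. $\mathfrak J$ is the collection of nonempty subsets of $[K]$ under consideration; the system is regular if $\mathcal S^\star(\mathcal J)$ has nonzero Lebesgue measure for every $\mathcal J\in\mathfrak J$. Notation for stress summaries: $\boldsymbol L_u(\boldsymbol z)=(u^{-1}L_1(u\boldsymbol z),\dots,u^{-1}L_K(u\boldsymbol z))$, $\boldsymbol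 L^\star(\boldsymbol z)=(L_1^\star(\boldsymbol z),\dots,L_K^\star(\boldsymbol z))$; $\boldsymbol Z_u\sim\mathsf{Law}(u^{-1}\boldsymbol\xi\mid\boldsymbol\xi\in\mathcal S(u;\mathcal J))$, $\widetilde{\boldsymbol Z}_u\sim\mathsf{Law}(u^{-1}\widetilde{\boldsymbol\xi}_u\mid\widetilde{\boldsymbol\xi}_u\in\mathcal S(u;\mathcal J))$, and $\boldsymbol Z^\star$ has law $\nu^\star(\cdot\cap\mathcal S^\star(\mathcal J))/\nu^\star(\mathcal S^\star(\mathcal J))$. The family $\boldsymbol\xi_u^{\rm gen}$: with $R=\|\boldsymbol\xi\|$, $\boldsymbol\Phi=\boldsymbol\xi/\|\boldsymbol\xi\|$, $f_{R,\boldsymbol\Phi}(r,\boldsymbol\phi)=r^{d-1}f_{\boldsymbol\xi}(r\boldsymbol\phi)$, $p_t=\mathbb P(R>t)$ and $\varphi^{(t)}(\boldsymbol\phi)=p_t^{-1}\int_t^\infty f_{R,\boldsymbol\Phi}(r,\boldsymbol\phi)\,dr$, the vector $\boldsymbol\xi_u^{\rm gen}$ is such that $(\|\boldsymbol\xi_u^{\rm gen}\|,\boldsymbol\xi_u^{\rm gen}/\|\boldsymbol\xi_u^{\rm gen}\|)$ has density (w.r.t. $dr\,d\boldsymbol\phi$) $f_{R,\boldsymbol\Phi}(r,\boldsymbol\phi)\mathbf 1(r<t)+p_t s t^s r^{-(s+1)}\varphi^{(t)}(\boldsymbol\phi)\mathbf 1(r>t)$ at $t=t(u)$, where $t(u)\to\infty$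 and $t(u)=o(u)$. *)

theory Defs
  imports "HOL-Probability.Probability" "HOL-Library.Landau_Symbols"
begin

text \<open>
  Measures on \<open>E - {0}\<close> are measures whose \<sigma>-algebra is that of
  \<^term>\<open>restrict_space borel (E - {0})\<close>. Functions on \<open>E\<close> are total functions whose values
  outside \<open>E\<close> play no role.
\<close>


text \<open>
  Surface measure on \<open>E \<inter> sphere 0 1\<close>, viewed as a Borel measure on the whole space.
  The mass of \<open>A\<close> is \<open>d\<close> times the volume of \<open>{r\<theta> | 0 < r \<le> 1, \<theta> \<in> A \<inter> E}\<close>; this is the
  normalisation for which \<open>dz = r^(d-1) dr d\<theta>\<close>.
\<close>

definition surface_measure :: "'a::euclidean_space set \<Rightarrow> 'a measure" where
  "surface_measure E =
     distr (density lborel (\<lambda>z. of_nat DIM('a) * indicator (E \<inter> (cball 0 1 - {0})) z))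
       borel (\<lambda>z. z /\<^sub>R norm z)"

text \<open>The reference measure \<open>dr d\<theta>\<close> on \<open>(0,\<infinity>) \<times> (E \<inter> sphere 0 1)\<close>.\<close>

definition polar_measure :: "'a::euclidean_space set \<Rightarrow> (real \<times> 'a) measure" where
  "polar_measure E = density lborel (indicator {0<..}) \<Otimes>\<^sub>M surface_measure E"

definition density_regular_variation ::
  "'a::euclidean_space set \<Rightarrow> ('a \<Rightarrow> real) \<Rightarrow> real \<Rightarrow> ('a \<Rightarrow> real) \<Rightarrow> bool" where
  "density_regular_variation E f s \<phi> \<longleftrightarrow>
     (\<exists>r0>0. continuous_on (E - cball 0 r0) f) \<and>
     s > 0 \<and>
     (\<forall>z\<in>E - {0}. \<phi> z > 0) \<and>
     (\<forall>C. compact C \<and> C \<subseteq> E - {0} \<longrightarrow>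
        uniform_limit C (\<lambda>t z. t powr (s + DIM('a)) * f (t *\<^sub>R z)) \<phi> at_top)"

definition M0 :: "'a::euclidean_space set \<Rightarrow> 'a measure set" where
  "M0 E = {\<mu>. sets \<mu> = sets (restrict_space borel (E - {0})) \<and>
              (\<forall>r>0. emeasure \<mu> {z \<in> E - {0}. r < norm z} < \<infinity>)}"

text \<open>Boundaries are taken in the space \<open>E - {0}\<close> that carries the measures.\<close>

definition M0_converges ::
  "'a::euclidean_space set \<Rightarrow> ('i \<Rightarrow> 'a measure) \<Rightarrow> 'a measure \<Rightarrow> 'i filter \<Rightarrow> bool" where
  "M0_converges E \<mu> \<nu> F \<longleftrightarrow>
     (\<forall>\<^sub>F u in F. \<mu> u \<in> M0 E) \<and> \<nu> \<in> M0 E \<and>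
     (\<forall>B \<in> sets (restrict_space borel (E - {0})).
        emeasure \<nu> (top_of_set (E - {0}) frontier_of B) = 0 \<and> 0 \<notin> closure B \<longrightarrow>
        ((\<lambda>u. emeasure (\<mu> u) B) \<longlongrightarrow> emeasure \<nu> B) F)"

text \<open>
  The indicator does not change the measure; it makes the density Borel measurable, as \<open>\<phi>\<close>
  is arbitrary outside \<open>E - {0}\<close>.
\<close>

definition tail_measure ::
  "'a::euclidean_space set \<Rightarrow> real \<Rightarrow> ('a \<Rightarrow> real) \<Rightarrow> 'a measure" where
  "tail_measure E s \<phi> =
     restrict_space
       (distr
         (density (polar_measure E)
           (\<lambda>(r, \<theta>). ennreal (r powr (- (s + 1)) * \<phi> \<theta>) * indicator (E \<inter> sphere 0 1) \<theta>))
         borel (\<lambda>(r, \<theta>). r *\<^sub>R \<theta>))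
       (E - {0})"

text \<open>\<open>E\<close>-valued random vectors; values outside \<open>E\<close> are tolerated on a null set.\<close>

definition cone_random_vector ::
  "'a::euclidean_space set \<Rightarrow> 'w measure \<Rightarrow> ('w \<Rightarrow> 'a) \<Rightarrow> bool" where
  "cone_random_vector E M X \<longleftrightarrow>
     prob_space M \<and> X \<in> borel_measurable M \<and> (AE \<omega> in M. X \<omega> \<in> E)"

text \<open>
  A family \<open>X u\<close>, each living on its own probability space \<open>M u\<close>. The reference law enters
  through its index \<open>s\<close> and its limit function \<open>\<phi>\<close>, which it determines.
\<close>

definition tail_preserving ::
  "'a::euclidean_space set \<Rightarrow> real \<Rightarrow> ('a \<Rightarrow> real) \<Rightarrow>
     (real \<Rightarrow> 'w measure) \<Rightarrow> (real \<Rightarrow> 'w \<Rightarrow> 'a) \<Rightarrow> bool" where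
  "tail_preserving E s \<phi> M X \<longleftrightarrow>
     (\<forall>u>0. cone_random_vector E (M u) (X u)) \<and>
     M0_converges E
       (\<lambda>u. scale_measure (ennreal (u powr s))
              (restrict_space (distr (M u) borel (\<lambda>\<omega>. X u \<omega> /\<^sub>R u)) (E - {0})))
       (tail_measure E s \<phi>) at_top"

definition asymptotically_homogeneous ::
  "'a::euclidean_space set \<Rightarrow> ('k \<Rightarrow> 'a \<Rightarrow> real) \<Rightarrow> ('k \<Rightarrow> 'a \<Rightarrow> real) \<Rightarrow> bool" where
  "asymptotically_homogeneous E L Ls \<longleftrightarrow>
     (\<forall>j. L j \<in> borel_measurable (restrict_space borel E) \<and>
          (\<exists>z\<in>E. Ls j z > 0) \<and>
          (\<forall>z\<in>E. \<forall>y. (\<forall>t. y t \<in> E) \<and> (y \<longlongrightarrow> z) at_top \<longrightarrow>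
             ((\<lambda>t::real. L j (t *\<^sub>R y t) / t) \<longlongrightarrow> Ls j z) at_top))"

definition stress_set ::
  "'a::euclidean_space set \<Rightarrow> ('k \<Rightarrow> 'a \<Rightarrow> real) \<Rightarrow> real \<Rightarrow> 'k set \<Rightarrow> 'a set" where
  "stress_set E L u J = {z \<in> E. \<forall>j\<in>J. L j z \<ge> u}"

definition limit_stress_set ::
  "'a::euclidean_space set \<Rightarrow> ('k \<Rightarrow> 'a \<Rightarrow> real) \<Rightarrow> 'k set \<Rightarrow> 'a set" where
  "limit_stress_set E Ls J = {z \<in> E. \<forall>j\<in>J. Ls j z \<ge> 1}"

definition regular_system ::
  "'a::euclidean_space set \<Rightarrow> ('k \<Rightarrow> 'a \<Rightarrow> real) \<Rightarrow> 'k set set \<Rightarrow> bool" where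
  "regular_system E Ls JJ \<longleftrightarrow> (\<forall>J\<in>JJ. emeasure lebesgue (limit_stress_set E Ls J) \<noteq> 0)"

definition scaled_loss :: "('k::finite \<Rightarrow> 'a::euclidean_space \<Rightarrow> real) \<Rightarrow> real \<Rightarrow> 'a \<Rightarrow> real ^ 'k" where
  "scaled_loss L u z = (\<chi> j. L j (u *\<^sub>R z) / u)"

definition limit_loss :: "('k::finite \<Rightarrow> 'a::euclidean_space \<Rightarrow> real) \<Rightarrow> 'a \<Rightarrow> real ^ 'k" where
  "limit_loss Ls z = (\<chi> j. Ls j z)"

text \<open>
  The law of \<open>X / u\<close> given \<open>X \<in> S\<close>, as a measure on \<open>E\<close>, for \<open>S \<subseteq> E\<close>. It is the zero
  measure when the conditioning event is null.
\<close>

definition conditional_scaled_law ::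
  "'a::euclidean_space set \<Rightarrow> 'w measure \<Rightarrow> ('w \<Rightarrow> 'a) \<Rightarrow> 'a set \<Rightarrow> real \<Rightarrow> 'a measure" where
  "conditional_scaled_law E M X S u =
     restrict_space
       (distr (uniform_measure M {\<omega> \<in> space M. X \<omega> \<in> S}) borel (\<lambda>\<omega>. X \<omega> /\<^sub>R u)) E"

definition limit_stress_law ::
  "'a::euclidean_space set \<Rightarrow> real \<Rightarrow> ('a \<Rightarrow> real) \<Rightarrow> ('k \<Rightarrow> 'a \<Rightarrow> real) \<Rightarrow> 'k set \<Rightarrow> 'a measure" where
  "limit_stress_law E s \<phi> Ls J = uniform_measure (tail_measure E s \<phi>) (limit_stress_set E Ls J)"

text \<open>
  Convergence in distribution, on the level of laws. The laws need only be probability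
  measures eventually, since conditional laws may be undefined for small parameters.
\<close>

definition converges_in_law ::
  "('i \<Rightarrow> 'y::metric_space measure) \<Rightarrow> 'y measure \<Rightarrow> 'i filter \<Rightarrow> bool" where
  "converges_in_law \<mu> \<nu> F \<longleftrightarrow>
     (\<forall>\<^sub>F u in F. prob_space (\<mu> u) \<and> sets (\<mu> u) = sets borel) \<and>
     prob_space \<nu> \<and> sets \<nu> = sets borel \<and>
     (\<forall>g::'y \<Rightarrow> real. continuous_on UNIV g \<and> bounded (range g) \<longrightarrow>
        ((\<lambda>u. integral\<^sup>L (\<mu> u) g) \<longlongrightarrow> integral\<^sup>L \<nu> g) F)"

definition polar_density :: "('a::euclidean_space \<Rightarrow> real) \<Rightarrow> real \<Rightarrow> 'a \<Rightarrow> real" where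
  "polar_density f r \<theta> = r ^ (DIM('a) - 1) * f (r *\<^sub>R \<theta>)"

definition exceedance_prob :: "'w measure \<Rightarrow> ('w \<Rightarrow> 'a::euclidean_space) \<Rightarrow> real \<Rightarrow> real" where
  "exceedance_prob M \<xi> t = measure M {\<omega> \<in> space M. norm (\<xi> \<omega>) > t}"

definition angular_density ::
  "'w measure \<Rightarrow> ('w \<Rightarrow> 'a::euclidean_space) \<Rightarrow> ('a \<Rightarrow> real) \<Rightarrow> real \<Rightarrow> 'a \<Rightarrow> ennreal" where
  "angular_density M \<xi> f t \<theta> =
     (\<integral>\<^sup>+r\<in>{t<..}. ennreal (polar_density f r \<theta>) \<partial>lborel) / ennreal (exceedance_prob M \<xi> t)"

definition gen_density ::
  "'w measure \<Rightarrow> ('w \<Rightarrow> 'a::euclidean_space) \<Rightarrow> ('a \<Rightarrow> real) \<Rightarrow> real \<Rightarrow> real \<Rightarrow> real \<times> 'a \<Rightarrow> ennreal" where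
  "gen_density M \<xi> f s t = (\<lambda>(r, \<theta>).
     ennreal (polar_density f r \<theta>) * indicator {..<t} r +
     ennreal (exceedance_prob M \<xi> t * s * t powr s * r powr (- (s + 1)))
       * angular_density M \<xi> f t \<theta> * indicator {t<..} r)"

text \<open>
  \<open>(N, X)\<close> is a family \<open>\<xi>_gen\<close> built from \<open>\<xi>\<close> (living on \<open>M\<close>, with density \<open>f\<close>) and the
  thresholds \<open>t u\<close>.
\<close>

definition gen_family ::
  "'a::euclidean_space set \<Rightarrow> 'v measure \<Rightarrow> ('v \<Rightarrow> 'a) \<Rightarrow> ('a \<Rightarrow> real) \<Rightarrow> real \<Rightarrow>
     (real \<Rightarrow> real) \<Rightarrow> (real \<Rightarrow> 'w measure) \<Rightarrow> (real \<Rightarrow> 'w \<Rightarrow> 'a) \<Rightarrow> bool" where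
  "gen_family E M \<xi> f s t N X \<longleftrightarrow>
     filterlim t at_top at_top \<and> t \<in> o[at_top](\<lambda>u. u) \<and>
     (\<forall>u>0. cone_random_vector E (N u) (X u) \<and>
        distributed (N u) (polar_measure E)
          (\<lambda>\<omega>. (norm (X u \<omega>), X u \<omega> /\<^sub>R norm (X u \<omega>)))
          (gen_density M \<xi> f s (t u)))"

end

theory Submission
  imports Defs
begin

text \<open>
  Regular variation of the density says that \<open>f \<le> c \<phi>\<close> and \<open>\<phi> \<le> c f\<close> far out in \<open>E\<close>, for every
  \<open>c > 1\<close>. Since \<open>\<nu>*\<close> has Lebesgue density \<open>\<phi>\<close> and scales like \<open>u^(-s)\<close>, both \<open>\<xi>\<close> and the
  generated family are tail preserving by sandwiching, which leaves only the case of a general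
  tail-preserving family.

  There, asymptotic homogeneity upgrades to continuous convergence: \<open>L_u(z_u) \<rightarrow> L*(z)\<close> whenever \<open>z_u \<rightarrow> z\<close>. Each
  level set \<open>{L*_j = 1}\<close> meets every ray at most once and is therefore a null set, so the integrands
  \<open>1(L_u \<ge> 1 on J) g(W(L_u))\<close> also converge continuously, almost everywhere. If \<open>h_n \<rightarrow> h\<close> continuously
  and \<open>\<mu>_n \<rightarrow> \<nu>\<close> on finite unions of balls (whose frontiers are null sets), then \<open>\<nu>{h > t} \<le> liminf \<mu>_n{h_n > t}\<close>, and integrating
  over \<open>t\<close> gives a Fatou inequality. Applied to \<open>C \<plusminus> h_n\<close> it yields convergence of the
  numerator and the denominator of the conditional expectations.
\<close>

section \<open>Polar coordinates\<close>

text \<open>Three obstacles rule out a plain continuous mapping argument: the map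
  \<open>W (scaled_loss L u z)\<close> moves with \<open>u\<close>, continuity of \<open>W\<close>
  is available only at almost every limit point, and the tail measure has infinite mass near the
  origin. The last is removed by a cutoff: \<open>Ls\<close> is homogeneous of degree 1, hence zero
  at the origin, so for large \<open>u\<close> every stress event lies in some region
  \<open>norm z > \<delta>\<close>, where all measures involved are finite. The first two are met
  together by letting the integrands converge along the product of the filter of \<open>u\<close>
  and that of points of \<open>E\<close> near \<open>z\<close>. Asymptotic homogeneity only tests
  single curves; a failure along the product filter is strung into one curve that violates it. A
  conditional expectation is a ratio, so the factor \<open>u powr s\<close>, without which numerator
  and denominator both tend to 0, can be inserted in both. Regularity of the system acts twice: it
  makes the limiting denominator positive, and it makes the tail measure nonzero, which keeps the
  exceedance probability in the denominator of the generated density from vanishing far out.\<close>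

lemma nn_integral_lborel_scaleR:
  fixes g :: "'a::euclidean_space \<Rightarrow> ennreal"
  assumes [measurable]: "g \<in> borel_measurable borel" and c: "c > 0"
  shows "(\<integral>\<^sup>+z. g z \<partial>lborel) = ennreal (c ^ DIM('a)) * (\<integral>\<^sup>+z. g (c *\<^sub>R z) \<partial>lborel)"
  by (subst lborel_affine[of c 0])
     (use c in \<open>simp_all add: nn_integral_density nn_integral_distr nn_integral_cmult ennreal_power\<close>)

lemma cone_scaleR:
  assumes "cone E" "z \<in> E" "(c::real) \<ge> 0"
  shows "c *\<^sub>R z \<in> E"
  using assms by (auto simp: cone_def)

lemma cone_scaleR_iff:
  assumes "cone E" "(c::real) > 0"
  shows "c *\<^sub>R z \<in> E \<longleftrightarrow> z \<in> E"
proof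
  assume "c *\<^sub>R z \<in> E"
  from cone_scaleR[OF assms(1) this, of "1/c"] show "z \<in> E" using assms(2) by simp
qed (use assms cone_scaleR[of E z c] in auto)

context
  fixes E :: "'a::euclidean_space set"
  assumes closed: "closed E" and cone: "cone E"
begin

lemma E_borel [measurable]: "E \<in> sets borel"
  using closed by simp

lemma sets_surface_measure [simp, measurable_cong]: "sets (surface_measure E) = sets borel"
  and space_surface_measure [simp]: "space (surface_measure E) = UNIV"
  by (simp_all add: surface_measure_def)

lemma emeasure_surface_measure:
  assumes [measurable]: "A \<in> sets borel"
  shows "emeasure (surface_measure E) A =
    of_nat DIM('a) * emeasure lborel {z \<in> E - {0}. norm z \<le> 1 \<and> z /\<^sub>R norm z \<in> A}"
proof -
  have "(\<lambda>z::'a. z /\<^sub>R norm z) \<in> borel_measurable borel" by measurable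
  from measurable_sets_borel[OF this assms]
  have [measurable]: "(\<lambda>z. z /\<^sub>R norm z) -` A \<in> sets borel" .
  have [measurable]: "E \<inter> (cball 0 1 - {0}) \<in> sets borel"
    by (intro sets.Int sets.Diff) auto
  have "emeasure (surface_measure E) A =
      (\<integral>\<^sup>+z. of_nat DIM('a) * indicator (E \<inter> (cball 0 1 - {0})) z
         * indicator ((\<lambda>z. z /\<^sub>R norm z) -` A) z \<partial>lborel)"
    unfolding surface_measure_def by (subst emeasure_distr) (auto intro!: emeasure_density)
  also have "\<dots> = (\<integral>\<^sup>+z. of_nat DIM('a) *
      indicator {z \<in> E - {0}. norm z \<le> 1 \<and> z /\<^sub>R norm z \<in> A} z \<partial>lborel)"
    by (intro nn_integral_cong) (auto simp: indicator_def)
  also have "\<dots> = of_nat DIM('a) * emeasure lborel {z \<in> E - {0}. norm z \<le> 1 \<and> z /\<^sub>R norm z \<in> A}"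
    by (subst nn_integral_cmult_indicator) auto
  finally show ?thesis .
qed

lemma finite_surface_measure: "finite_measure (surface_measure E)"
proof
  have "emeasure lborel {z \<in> E - {0}. norm z \<le> 1} \<le> emeasure lborel (cball (0::'a) 1)"
    by (intro emeasure_mono) auto
  also have "\<dots> < \<infinity>" by (rule emeasure_lborel_cball_finite)
  finally show "emeasure (surface_measure E) (space (surface_measure E)) \<noteq> \<infinity>"
    using emeasure_surface_measure[of UNIV] by (simp add: ennreal_mult_eq_top_iff)
qed

text \<open>The normalised points of \<open>E\<close> stay in \<open>E\<close> because
  \<open>E\<close> is a cone. The measure itself is carried by the whole space, so this
  concentration has to be recorded.\<close>

lemma AE_surface_measure: "AE \<theta> in surface_measure E. \<theta> \<in> E \<inter> sphere 0 1"
proof (rule AE_I')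
  have e: "{z \<in> E - {0}. norm z \<le> 1 \<and> z /\<^sub>R norm z \<in> - (E \<inter> sphere 0 1)} = {}"
    using cone by (auto simp: cone_scaleR field_simps)
  show "- (E \<inter> sphere 0 1) \<in> null_sets (surface_measure E)"
    using emeasure_surface_measure[of "- (E \<inter> sphere 0 1)"] unfolding e
    by (intro null_setsI) auto
qed auto

lemma sets_polar_measure [simp, measurable_cong]:
    "sets (polar_measure E) = sets (borel \<Otimes>\<^sub>M borel)"
  and space_polar_measure [simp]: "space (polar_measure E) = UNIV"
  unfolding polar_measure_def by (auto intro!: sets_pair_measure_cong simp: space_pair_measure)

section \<open>Lebesgue measure in polar coordinates\<close>

definition polar_coords :: "'a \<Rightarrow> real \<times> 'a" where
  "polar_coords z = (norm z, z /\<^sub>R norm z)"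

lemma measurable_polar_coords [measurable]: "polar_coords \<in> borel \<rightarrow>\<^sub>M borel \<Otimes>\<^sub>M borel"
  unfolding polar_coords_def[abs_def] by measurable

text \<open>A sector of the cone is mapped by the dilation with factor \<open>\<rho>\<close> onto
  the sector of radius \<open>\<rho>\<close> over the same directions.\<close>

lemma emeasure_radial_sector:
  assumes [measurable]: "B \<in> sets borel" and "\<rho> > 0"
  shows "emeasure lborel {z \<in> E - {0}. norm z \<le> \<rho> \<and> z /\<^sub>R norm z \<in> B} =
    ennreal (\<rho> ^ DIM('a)) * emeasure lborel {z \<in> E - {0}. norm z \<le> 1 \<and> z /\<^sub>R norm z \<in> B}"
proof -
  define S where "S r = {z \<in> E - {0}. norm z \<le> r \<and> z /\<^sub>R norm z \<in> B}" for r
  have [measurable]: "S r \<in> sets borel" for r unfolding S_def by measurable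
  have "emeasure lborel (S \<rho>) = (\<integral>\<^sup>+z. indicator (S \<rho>) z \<partial>lborel)" by simp
  also have "\<dots> = ennreal (\<rho> ^ DIM('a)) * (\<integral>\<^sup>+z. indicator (S \<rho>) (\<rho> *\<^sub>R z) \<partial>lborel)"
    by (rule nn_integral_lborel_scaleR) (use assms in auto)
  also have "(\<lambda>z. indicator (S \<rho>) (\<rho> *\<^sub>R z) :: ennreal) = indicator (S 1)"
    using \<open>\<rho> > 0\<close> cone_scaleR_iff[OF cone \<open>\<rho> > 0\<close>]
    by (auto simp: S_def indicator_def fun_eq_iff mult.commute[of _ \<rho>] mult.assoc[symmetric])
  finally show ?thesis by (simp add: S_def)
qed

definition radial_measure :: "real measure" where
  "radial_measure = density lborel (\<lambda>r. indicator {0<..} r * ennreal (r ^ (DIM('a) - 1)))"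

text \<open>The denominator \<open>DIM('a)\<close> is what the normalising factor in
  \<open>surface_measure\<close> cancels.\<close>

lemma emeasure_radial_measure:
  assumes "\<rho> \<ge> 0"
  shows "emeasure radial_measure {..\<rho>} = ennreal (\<rho> ^ DIM('a) / DIM('a))"
proof -
  have "emeasure radial_measure {..\<rho>} =
      (\<integral>\<^sup>+r. indicator {0<..} r * ennreal (r ^ (DIM('a) - 1)) * indicator {..\<rho>} r \<partial>lborel)"
    unfolding radial_measure_def by (subst emeasure_density) auto
  also have "\<dots> = (\<integral>\<^sup>+r. ennreal (r ^ (DIM('a) - 1)) * indicator {0..\<rho>} r \<partial>lborel)"
    by (intro nn_integral_cong_AE, rule AE_mp[OF AE_lborel_singleton[of 0]])
       (auto simp: indicator_def)
  also have "\<dots> = ennreal (\<rho> ^ DIM('a) / DIM('a) - 0 ^ DIM('a) / DIM('a))"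
    by (rule nn_integral_FTC_Icc) (use assms in \<open>auto intro!: derivative_eq_intros\<close>)
  finally show ?thesis by (simp add: power_0_left)
qed

lemma density_polar_measure:
  "density (polar_measure E) (\<lambda>(r, \<theta>). ennreal (r ^ (DIM('a) - 1))) =
   radial_measure \<Otimes>\<^sub>M surface_measure E"
proof -
  interpret finite_measure "surface_measure E" by (rule finite_surface_measure)
  \<comment> \<open>The dummy density 1 on the angular factor brings the product into the form that
    \<open>pair_measure_density\<close> expects.\<close>
  have "radial_measure \<Otimes>\<^sub>M density (surface_measure E) (\<lambda>_. 1) =
     density (density lborel (indicator {0<..}) \<Otimes>\<^sub>M surface_measure E)
       (\<lambda>(r, \<theta>). ennreal (r ^ (DIM('a) - 1)) * 1)"
    unfolding radial_measure_def
    by (subst pair_measure_density[symmetric])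
       (auto simp: density_density_eq density_1 sigma_finite_measure_axioms)
  then show ?thesis by (simp add: density_1 polar_measure_def)
qed

text \<open>A product measure is determined by rectangles \<open>A \<times> B\<close>. For fixed
  \<open>B\<close> both sides are measures in \<open>A\<close> that are finite and equal on every
  half-line \<open>{..\<rho>}\<close>, by the volume of a sector, and half-lines generate the Borel
  sets.\<close>

lemma radial_surface_measure_eq:
  "radial_measure \<Otimes>\<^sub>M surface_measure E =
   distr (density lborel (indicator (E - {0}))) (borel \<Otimes>\<^sub>M borel) polar_coords"
    (is "_ = ?P")
proof (rule pair_measure_eqI)
  interpret finite_measure "surface_measure E" by (rule finite_surface_measure)
  show "sigma_finite_measure (surface_measure E)" ..
  show "sigma_finite_measure radial_measure"
    unfolding radial_measure_def
    by (subst sigma_finite_measure.sigma_finite_iff_density_finite[OF lborel.sigma_finite_measure_axioms]) (auto simp: indicator_def)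
  show "sets (radial_measure \<Otimes>\<^sub>M surface_measure E) = sets ?P"
    by (auto intro!: sets_pair_measure_cong simp: radial_measure_def)
next
  interpret finite_measure "surface_measure E" by (rule finite_surface_measure)
  fix A :: "real set" and B :: "'a set"
  assume "A \<in> sets radial_measure" "B \<in> sets (surface_measure E)"
  then have [measurable]: "A \<in> sets borel" "B \<in> sets borel" by (auto simp: radial_measure_def)
  \<comment> \<open>\<open>Q\<close> and, below, \<open>R\<close> are the two sides of the rectangle
    identity as measures in the radial set, with \<open>B\<close> fixed.\<close>
  define Q where "Q = distr (density lborel (indicator
    {z \<in> E - {0}. z /\<^sub>R norm z \<in> B})) borel norm"
  have Q: "emeasure Q C = emeasure lborel {z \<in> E - {0}. norm z \<in> C \<and> z /\<^sub>R norm z \<in> B}"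
    if [measurable]: "C \<in> sets borel" for C :: "real set"
  proof -
    have [measurable]: "norm -` C \<in> sets (borel :: 'a measure)"
      by (rule measurable_sets_borel[OF borel_measurable_norm that])
    have "emeasure Q C = (\<integral>\<^sup>+z. indicator {z \<in> E - {0}. z /\<^sub>R norm z \<in> B} z * indicator (norm -` C) z \<partial>lborel)"
      unfolding Q_def
      by (subst emeasure_distr) (auto intro!: emeasure_density)
    also have "\<dots> = (\<integral>\<^sup>+z. indicator {z \<in> E - {0}. norm z \<in> C \<and> z /\<^sub>R norm z \<in> B} z \<partial>lborel)"
      by (intro nn_integral_cong) (auto simp: indicator_def)
    finally show ?thesis by simp
  qed
  define R where "R = density radial_measure (\<lambda>_. emeasure (surface_measure E) B)"
  have R: "emeasure R C = emeasure (surface_measure E) B * emeasure radial_measure C"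
    if "C \<in> sets borel" for C
    using that unfolding R_def
    by (subst emeasure_density) (auto simp: nn_integral_cmult_indicator radial_measure_def)
  have QR: "emeasure Q {..\<rho>} = emeasure R {..\<rho>}" for \<rho> :: real
  proof (cases "\<rho> > 0")
    case True
    define v where "v = emeasure lborel {z \<in> E - {0}. norm z \<le> 1 \<and> z /\<^sub>R norm z \<in> B}"
    have "emeasure R {..\<rho>} = ennreal (real DIM('a)) * v * ennreal (\<rho> ^ DIM('a) / DIM('a))"
      using True R[of "{..\<rho>}"]
      by (simp add: emeasure_radial_measure emeasure_surface_measure v_def ennreal_of_nat_eq_real_of_nat)
    also have "\<dots> = v * (ennreal (real DIM('a)) * ennreal (\<rho> ^ DIM('a) / DIM('a)))"
      by (simp only: mult_ac)
    also have "ennreal (real DIM('a)) * ennreal (\<rho> ^ DIM('a) / DIM('a)) = ennreal (\<rho> ^ DIM('a))"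
      using True by (subst ennreal_mult[symmetric]) auto
    also have "v * ennreal (\<rho> ^ DIM('a)) = emeasure Q {..\<rho>}"
      using emeasure_radial_sector[OF _ True, of B] Q[of "{..\<rho>}"] by (simp add: v_def mult.commute)
    finally show ?thesis ..
  next
    case False
    then have "emeasure radial_measure {..\<rho>} \<le> emeasure radial_measure {..0}"
      by (intro emeasure_mono) (auto simp: radial_measure_def)
    then have "emeasure radial_measure {..\<rho>} = 0"
      using emeasure_radial_measure[of 0] by (simp add: power_0_left)
    moreover have "{z \<in> E - {0}. norm z \<le> \<rho> \<and> z /\<^sub>R norm z \<in> B} = {}"
      using False by (auto simp: not_less) (metis norm_le_zero_iff order_trans)
    then have "emeasure Q {..\<rho>} = 0" using Q[of "{..\<rho>}"] by (simp only: atMost_iff) simp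
    ultimately show ?thesis using R[of "{..\<rho>}"] by simp
  qed
  have "R = Q"
  proof (rule measure_eqI_generator_eq[where E="range atMost" and A="\<lambda>n. {..real n}" and \<Omega>=UNIV])
    show "Int_stable (range atMost :: real set set)" by (auto simp: Int_stable_def)
    show "sets R = sigma_sets UNIV (range atMost)" "sets Q = sigma_sets UNIV (range atMost)"
      by (auto simp: R_def Q_def radial_measure_def borel_eq_atMost)
    show "(\<Union>i. {..real i}) = UNIV" using real_arch_simple by auto
    show "emeasure R {..real i} \<noteq> \<infinity>" for i
      using emeasure_real[of B] by (auto simp: R emeasure_radial_measure ennreal_mult_eq_top_iff)
  qed (auto simp: QR)
  then have "emeasure radial_measure A * emeasure (surface_measure E) B =
     emeasure lborel {z \<in> E - {0}. norm z \<in> A \<and> z /\<^sub>R norm z \<in> B}"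
    using Q[of A] R[of A] by (simp add: mult.commute)
  also have "\<dots> = (\<integral>\<^sup>+z. indicator {z \<in> E - {0}. norm z \<in> A \<and> z /\<^sub>R norm z \<in> B} z \<partial>lborel)"
    by simp
  also have "\<dots> = (\<integral>\<^sup>+z. indicator (E - {0}) z * indicator (polar_coords -` (A \<times> B)) z \<partial>lborel)"
    by (intro nn_integral_cong) (auto simp: indicator_def polar_coords_def)
  also have "\<dots> = emeasure ?P (A \<times> B)"
  proof -
    have "polar_coords -` (A \<times> B) \<in> sets borel"
      by (rule measurable_sets_borel[OF measurable_polar_coords]) auto
    then show ?thesis by (subst emeasure_distr) (auto intro!: emeasure_density[symmetric])
  qed
  finally show "emeasure radial_measure A * emeasure (surface_measure E) B = emeasure ?P (A \<times> B)" .
qed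

lemma nn_integral_polar:
  fixes g :: "'a \<Rightarrow> ennreal"
  assumes [measurable]: "g \<in> borel_measurable borel"
  shows "(\<integral>\<^sup>+z\<in>E - {0}. g z \<partial>lborel) =
    (\<integral>\<^sup>+(r, \<theta>). ennreal (r ^ (DIM('a) - 1)) * g (r *\<^sub>R \<theta>) \<partial>polar_measure E)"
proof -
  have "(\<integral>\<^sup>+(r, \<theta>). ennreal (r ^ (DIM('a) - 1)) * g (r *\<^sub>R \<theta>) \<partial>polar_measure E) =
     (\<integral>\<^sup>+(r, \<theta>). g (r *\<^sub>R \<theta>) \<partial>density (polar_measure E) (\<lambda>(r, \<theta>). ennreal (r ^ (DIM('a) - 1))))"
    by (subst nn_integral_density) (auto simp: split_beta')
  also have "\<dots> = (\<integral>\<^sup>+z. g (norm z *\<^sub>R (z /\<^sub>R norm z)) \<partial>density lborel (indicator (E - {0})))"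
    unfolding density_polar_measure radial_surface_measure_eq
    by (subst nn_integral_distr) (auto simp: split_beta' polar_coords_def)
  also have "\<dots> = (\<integral>\<^sup>+z\<in>E - {0}. g z \<partial>lborel)"
    by (subst nn_integral_density) (auto intro!: nn_integral_cong simp: indicator_def)
  finally show ?thesis ..
qed

end


section \<open>The limiting tail measure\<close>

lemma nn_integral_powr_tail:
  fixes a s :: real
  assumes "a > 0" "s > 0"
  shows "(\<integral>\<^sup>+r\<in>{a<..}. ennreal (r powr (- (s + 1))) \<partial>lborel) = ennreal (a powr (- s) / s)"
proof -
  have "(\<integral>\<^sup>+r\<in>{a<..}. ennreal (r powr (- (s + 1))) \<partial>lborel) =
      (\<integral>\<^sup>+r. ennreal (r powr (- (s + 1))) * indicator {a..} r \<partial>lborel)"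
    by (intro nn_integral_cong_AE, rule AE_mp[OF AE_lborel_singleton[of a]])
       (auto simp: indicator_def)
  also have "\<dots> = ennreal (0 - (- (a powr (- s) / s)))"
  proof (rule nn_integral_FTC_atLeast)
    show "((\<lambda>r. - (r powr (- s) / s)) \<longlongrightarrow> 0) at_top"
      using tendsto_minus[OF tendsto_divide[OF tendsto_neg_powr[of "-s" "\<lambda>x. x" at_top] tendsto_const[of s]]]
        assms by (simp add: filterlim_ident)
    fix r assume "a \<le> r"
    then show "((\<lambda>r. - (r powr (- s) / s)) has_real_derivative r powr (- (s + 1))) (at r)"
      using assms by (auto intro!: derivative_eq_intros arg_cong[where f="(powr) r"] simp: field_simps)
  qed auto
  finally show ?thesis by simp
qed

text \<open>Regular variation yields two-sided bounds up to a factor \<open>c\<close>, for every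
  \<open>c > 1\<close>; a finite limit is pinned down by such bounds. It may be zero, in which case
  the upper bound forces \<open>f x\<close> to vanish eventually.\<close>

lemma ennreal_tendsto_sandwich:
  fixes f :: "'i \<Rightarrow> ennreal"
  assumes "L < \<infinity>"
    and sandwich: "\<And>c::real. c > 1 \<Longrightarrow> \<forall>\<^sub>F x in F. f x \<le> ennreal c * L \<and> L \<le> ennreal c * f x"
  shows "(f \<longlongrightarrow> L) F"
proof (rule order_tendstoI)
  fix a assume "a < L"
  then obtain l where l: "L = ennreal l" "l > 0" using assms(1)
    by (cases L) (auto simp: ennreal_less_iff dest: le_less_trans[OF zero_le])
  obtain b where b: "a = ennreal b" "b \<ge> 0" using \<open>a < L\<close> by (cases a) auto
  have "b < l" using \<open>a < L\<close> l b by (simp add: ennreal_less_iff)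
  \<comment> \<open>The midpoint of 1 and \<open>l / b\<close>, so that \<open>c * b\<close> is the
    midpoint of \<open>b\<close> and \<open>l\<close>; for \<open>b = 0\<close> every
    \<open>c > 1\<close> works.\<close>
  define c where "c = (if b = 0 then 2 else (1 + l / b) / 2)"
  have c: "c > 1" "c * b < l"
    using \<open>b < l\<close> b l by (auto simp: c_def field_simps)
  show "\<forall>\<^sub>F x in F. a < f x"
    using sandwich[OF c(1)]
  proof eventually_elim
    case (elim x)
    show ?case
    proof (rule ccontr)
      assume "\<not> a < f x"
      then have "ennreal c * f x \<le> ennreal c * ennreal b" using b by (auto intro: mult_left_mono)
      also have "\<dots> < L" using c l b by (simp add: ennreal_mult[symmetric] ennreal_less_iff)
      finally show False using elim by auto
    qed
  qed
next
  fix a assume "L < a"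
  then obtain l where l: "L = ennreal l" "l \<ge> 0" by (cases L) auto
  obtain b where b: "ennreal b < a" "L < ennreal b" "b > 0"
  proof (cases a)
    case (real r)
    then show ?thesis using \<open>L < a\<close> l that[of "(l + r) / 2"] by (auto simp: ennreal_less_iff)
  next
    case top
    then show ?thesis using \<open>L < a\<close> l that[of "l + 1"] by (auto simp: ennreal_less_iff)
  qed
  have "l < b" using b l by (simp add: ennreal_less_iff)
  \<comment> \<open>The factor that carries \<open>l\<close> exactly to \<open>b\<close>, which
    still lies strictly below \<open>a\<close>.\<close>
  define c where "c = (if l = 0 then 2 else b / l)"
  have c: "c > 1" "c * l \<le> b"
    using \<open>l < b\<close> b l by (auto simp: c_def field_simps)
  show "\<forall>\<^sub>F x in F. f x < a"
    using sandwich[OF c(1)]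
  proof eventually_elim
    case (elim x)
    then have "f x \<le> ennreal c * ennreal l" using l by simp
    also have "\<dots> \<le> ennreal b" using c l by (simp add: ennreal_mult[symmetric] ennreal_leI)
    finally show ?case using b by simp
  qed
qed

text \<open>The properties of the limit function alone, without the density. The convergence theorem
  for general tail-preserving families is developed over this locale, since such a family sees the
  reference law only through its tail measure.\<close>

locale cone_tail =
  fixes E :: "'a::euclidean_space set" and s :: real and \<phi> :: "'a \<Rightarrow> real"
  assumes closed: "closed E" and cone: "cone E" and s_pos: "s > 0"
    and pos: "z \<in> E - {0} \<Longrightarrow> \<phi> z > 0"
    and cont: "continuous_on (E - {0}) \<phi>"
    and hom: "z \<in> E - {0} \<Longrightarrow> c > 0 \<Longrightarrow> \<phi> (c *\<^sub>R z) = c powr (- (s + DIM('a))) * \<phi> z"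
begin

lemma E_borel [measurable, simp]: "E \<in> sets borel" and E_minus_borel [measurable, simp]: "E - {0} \<in> sets borel"
  using closed by auto

lemmas sets_surface_measure [simp, measurable_cong] = sets_surface_measure[OF closed cone]
lemmas sets_polar_measure [simp, measurable_cong] = sets_polar_measure[OF closed cone]
lemmas scaleR_mem_iff = cone_scaleR_iff[OF cone]

text \<open>Extended by zero off \<open>E - {0}\<close>, where \<open>\<phi>\<close> is
  unconstrained; this gives Borel measurability on the whole space.\<close>

definition tail_density :: "'a \<Rightarrow> ennreal" where
  "tail_density z = ennreal (\<phi> z) * indicator (E - {0}) z"

lemma measurable_tail_density [measurable]: "tail_density \<in> borel_measurable borel"
proof -
  have "(\<lambda>z. indicator (E - {0}) z *\<^sub>R \<phi> z) \<in> borel_measurable borel"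
    by (rule borel_measurable_continuous_on_indicator[OF _ cont]) auto
  then have "(\<lambda>z. ennreal (indicator (E - {0}) z *\<^sub>R \<phi> z)) \<in> borel_measurable borel" by measurable
  also have "(\<lambda>z. ennreal (indicator (E - {0}) z *\<^sub>R \<phi> z)) = tail_density"
    by (auto simp: tail_density_def indicator_def fun_eq_iff)
  finally show ?thesis .
qed

definition angular_limit :: "'a \<Rightarrow> ennreal" where
  "angular_limit \<theta> = ennreal (\<phi> \<theta>) * indicator (E \<inter> sphere 0 1) \<theta>"

lemma measurable_angular_limit [measurable]: "angular_limit \<in> borel_measurable borel"
proof -
  have [measurable]: "sphere (0::'a) 1 \<in> sets borel" by (intro borel_closed) auto
  have "angular_limit = (\<lambda>\<theta>. tail_density \<theta> * indicator (E \<inter> sphere 0 1) \<theta>)"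
    by (auto simp: tail_density_def angular_limit_def indicator_def fun_eq_iff)
  then show ?thesis by (simp only:) measurable
qed

text \<open>\<open>polar_measure\<close> lives on all pairs. This allows polar integrands to be
  compared only at positive radii and at unit vectors of \<open>E\<close>, where homogeneity is
  available.\<close>

lemma AE_polar_measure: "AE (r, \<theta>) in polar_measure E. r > 0 \<and> \<theta> \<in> E \<inter> sphere 0 1"
proof -
  interpret sf: finite_measure "surface_measure E" by (rule finite_surface_measure[OF closed cone])
  have [measurable]: "sphere (0::'a) 1 \<in> sets borel" by (intro borel_closed) auto
  interpret pair_sigma_finite "density lborel (indicator {0::real<..})" "surface_measure E"
    by (intro pair_sigma_finite.intro sf.sigma_finite_measure_axioms)
       (subst sigma_finite_measure.sigma_finite_iff_density_finite[OF lborel.sigma_finite_measure_axioms],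
        auto simp: indicator_def)
  have "AE r in density lborel (indicator {0::real<..}). AE \<theta> in surface_measure E.
      r > 0 \<and> \<theta> \<in> E \<inter> sphere 0 1"
    by (subst AE_density) (use AE_surface_measure[OF closed cone] in \<open>auto simp: indicator_def\<close>)
  moreover have "Measurable.pred (borel \<Otimes>\<^sub>M borel) (\<lambda>p::real \<times> 'a. 0 < fst p \<and> snd p \<in> E \<and> norm (snd p) = 1)"
    by measurable
  ultimately show ?thesis
    unfolding polar_measure_def
    by (intro AE_pair_measure) (simp_all add: split_beta' pred_def space_pair_measure space_surface_measure[OF closed cone])
qed

lemma nn_integral_polar_measure:
  fixes g :: "real \<Rightarrow> 'a \<Rightarrow> ennreal"
  assumes [measurable]: "case_prod g \<in> borel_measurable (borel \<Otimes>\<^sub>M borel)"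
  shows "(\<integral>\<^sup>+(r, \<theta>). g r \<theta> \<partial>polar_measure E) =
    (\<integral>\<^sup>+\<theta>. (\<integral>\<^sup>+r\<in>{0<..}. g r \<theta> \<partial>lborel) \<partial>surface_measure E)"
proof -
  interpret sf: finite_measure "surface_measure E" by (rule finite_surface_measure[OF closed cone])
  interpret pair_sigma_finite "density lborel (indicator {0::real<..})" "surface_measure E"
    by (intro pair_sigma_finite.intro sf.sigma_finite_measure_axioms)
       (subst sigma_finite_measure.sigma_finite_iff_density_finite[OF lborel.sigma_finite_measure_axioms],
        auto simp: indicator_def)
  have "(\<integral>\<^sup>+(r, \<theta>). g r \<theta> \<partial>polar_measure E) =
      (\<integral>\<^sup>+\<theta>. (\<integral>\<^sup>+r. g r \<theta> \<partial>density lborel (indicator {0<..})) \<partial>surface_measure E)"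
    unfolding polar_measure_def by (subst nn_integral_snd[symmetric]) auto
  also have "\<dots> = (\<integral>\<^sup>+\<theta>. (\<integral>\<^sup>+r\<in>{0<..}. g r \<theta> \<partial>lborel) \<partial>surface_measure E)"
    by (intro nn_integral_cong, subst nn_integral_density) (auto simp: mult.commute)
  finally show ?thesis .
qed

lemma emeasure_tail_measure_polar:
  assumes [measurable]: "B \<in> sets borel" and B: "B \<subseteq> E - {0}"
  shows "emeasure (tail_measure E s \<phi>) B =
    (\<integral>\<^sup>+(r, \<theta>). ennreal (r powr (- (s + 1))) * angular_limit \<theta> * indicator B (r *\<^sub>R \<theta>) \<partial>polar_measure E)"
proof -
  have [measurable]: "sphere (0::'a) 1 \<in> sets borel" by (intro borel_closed) auto
  have [measurable]: "(\<lambda>(r, \<theta>). r *\<^sub>R \<theta>) \<in> borel \<Otimes>\<^sub>M borel \<rightarrow>\<^sub>M (borel :: 'a measure)"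
    by measurable
  have [measurable]: "(\<lambda>(r, \<theta>). ennreal (r powr (- (s + 1))) * angular_limit \<theta>)
      \<in> borel_measurable (borel \<Otimes>\<^sub>M borel)" by measurable
  have eq: "(\<lambda>(r, \<theta>). ennreal (r powr (- (s + 1)) * \<phi> \<theta>) * indicator (E \<inter> sphere 0 1) \<theta>) =
      (\<lambda>(r, \<theta>). ennreal (r powr (- (s + 1))) * angular_limit \<theta>)"
    by (auto simp: angular_limit_def fun_eq_iff ennreal_mult' mult.assoc)
  have "emeasure (tail_measure E s \<phi>) B = emeasure (distr (density (polar_measure E)
      (\<lambda>(r, \<theta>). ennreal (r powr (- (s + 1))) * angular_limit \<theta>)) borel (\<lambda>(r, \<theta>). r *\<^sub>R \<theta>)) B"
    unfolding tail_measure_def eq using B by (subst emeasure_restrict_space) auto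
  also have "\<dots> = (\<integral>\<^sup>+p. indicator B ((\<lambda>(r, \<theta>). r *\<^sub>R \<theta>) p) \<partial>density (polar_measure E)
      (\<lambda>(r, \<theta>). ennreal (r powr (- (s + 1))) * angular_limit \<theta>))"
    by (subst nn_integral_indicator[symmetric], simp, subst nn_integral_distr) auto
  also have "\<dots> = (\<integral>\<^sup>+(r, \<theta>). ennreal (r powr (- (s + 1))) * angular_limit \<theta> * indicator B (r *\<^sub>R \<theta>)
      \<partial>polar_measure E)"
    by (subst nn_integral_density) (auto simp: split_beta')
  finally show ?thesis .
qed

text \<open>By homogeneity, the Jacobian \<open>r ^ (DIM('a) - 1)\<close> times
  \<open>\<phi>\<close> at the point with polar coordinates \<open>(r, \<theta>)\<close> equals
  \<open>r powr (- (s + 1)) * \<phi> \<theta>\<close>, which is the polar density of the tail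
  measure.\<close>

lemma emeasure_tail_measure:
  assumes [measurable]: "B \<in> sets borel" and B: "B \<subseteq> E - {0}"
  shows "emeasure (tail_measure E s \<phi>) B = (\<integral>\<^sup>+z\<in>B. tail_density z \<partial>lborel)"
proof -
  have "(\<integral>\<^sup>+z\<in>B. tail_density z \<partial>lborel) = (\<integral>\<^sup>+z\<in>E - {0}. tail_density z * indicator B z \<partial>lborel)"
    using B by (intro nn_integral_cong) (auto simp: indicator_def)
  also have "\<dots> = (\<integral>\<^sup>+(r, \<theta>). ennreal (r ^ (DIM('a) - 1)) * (tail_density (r *\<^sub>R \<theta>) * indicator B (r *\<^sub>R \<theta>))
      \<partial>polar_measure E)"
    by (rule nn_integral_polar[OF closed cone]) measurable
  also have "\<dots> = (\<integral>\<^sup>+(r, \<theta>). ennreal (r powr (- (s + 1))) * angular_limit \<theta> * indicator B (r *\<^sub>R \<theta>)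
      \<partial>polar_measure E)"
  proof (intro nn_integral_cong_AE, use AE_polar_measure in eventually_elim, clarify)
    fix r :: real and \<theta> :: 'a assume *: "0 < r" "\<theta> \<in> E" "\<theta> \<in> sphere 0 1"
    then have "\<theta> \<in> E - {0}" by auto
    have "r powr (- (s + DIM('a))) * r ^ (DIM('a) - 1) = r powr (- (s + 1))"
      using * by (simp add: powr_realpow[symmetric] powr_add[symmetric] of_nat_diff)
    then have "ennreal (r ^ (DIM('a) - 1)) * tail_density (r *\<^sub>R \<theta>) = ennreal (r powr (- (s + 1))) * angular_limit \<theta>"
      using * \<open>\<theta> \<in> E - {0}\<close> pos[OF \<open>\<theta> \<in> E - {0}\<close>] hom[OF \<open>\<theta> \<in> E - {0}\<close> *(1)]
      by (auto simp: tail_density_def angular_limit_def scaleR_mem_iff ennreal_mult[symmetric] mult_ac)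
    then show "ennreal (r ^ (DIM('a) - 1)) * (tail_density (r *\<^sub>R \<theta>) * indicator B (r *\<^sub>R \<theta>)) =
        ennreal (r powr (- (s + 1))) * angular_limit \<theta> * indicator B (r *\<^sub>R \<theta>)"
      by (simp add: mult.assoc[symmetric])
  qed
  finally show ?thesis using emeasure_tail_measure_polar[OF assms] by simp
qed

lemma sets_tail_measure [simp, measurable_cong]:
    "sets (tail_measure E s \<phi>) = sets (restrict_space borel (E - {0}))"
  and space_tail_measure [simp]: "space (tail_measure E s \<phi>) = E - {0}"
  unfolding tail_measure_def by (rule sets_restrict_space_cong, simp) (simp add: space_restrict_space)

text \<open>\<open>\<phi>\<close> is continuous, hence bounded, on the compact set of unit vectors
  of \<open>E\<close>, and surface measure is finite.\<close>

lemma nn_integral_angular_limit: "(\<integral>\<^sup>+\<theta>. angular_limit \<theta> \<partial>surface_measure E) < \<infinity>"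
proof -
  interpret finite_measure "surface_measure E" by (rule finite_surface_measure[OF closed cone])
  have "compact (E \<inter> sphere 0 1)" using closed by (intro closed_Int_compact) auto
  moreover have "continuous_on (E \<inter> sphere 0 1) \<phi>"
    by (rule continuous_on_subset[OF cont]) auto
  ultimately have "bounded (\<phi> ` (E \<inter> sphere 0 1))"
    by (intro compact_imp_bounded compact_continuous_image)
  then obtain C where "\<forall>x\<in>\<phi> ` (E \<inter> sphere 0 1). norm x \<le> C"
    unfolding bounded_iff by blast
  then have C: "\<phi> \<theta> \<le> C" if "\<theta> \<in> E \<inter> sphere 0 1" for \<theta>
    using that abs_le_D1[of "\<phi> \<theta>" C] by auto
  have "(\<integral>\<^sup>+\<theta>. angular_limit \<theta> \<partial>surface_measure E) \<le> (\<integral>\<^sup>+\<theta>. ennreal C \<partial>surface_measure E)"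
    by (intro nn_integral_mono) (use C in \<open>auto simp: angular_limit_def indicator_def intro!: ennreal_leI\<close>)
  also have "\<dots> < \<infinity>"
    using emeasure_finite[of "space (surface_measure E)"]
    by (simp add: ennreal_mult_eq_top_iff less_top[symmetric])
  finally show ?thesis .
qed

text \<open>The factorisation into an angular constant and a power of \<open>\<delta>\<close> serves
  twice: it gives finite mass away from the origin, and it shows that one exterior is null exactly
  when all are.\<close>

lemma emeasure_tail_measure_exterior:
  assumes "\<delta> > 0"
  shows "emeasure (tail_measure E s \<phi>) {z \<in> E - {0}. norm z > \<delta>} =
    (\<integral>\<^sup>+\<theta>. angular_limit \<theta> \<partial>surface_measure E) * ennreal (\<delta> powr (- s) / s)"
proof -
  have "emeasure (tail_measure E s \<phi>) {z \<in> E - {0}. norm z > \<delta>} =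
    (\<integral>\<^sup>+(r, \<theta>). ennreal (r powr (- (s + 1))) * angular_limit \<theta>
       * indicator {z \<in> E - {0}. norm z > \<delta>} (r *\<^sub>R \<theta>) \<partial>polar_measure E)"
    by (rule emeasure_tail_measure_polar) auto
  also have "\<dots> =
    (\<integral>\<^sup>+(r, \<theta>). ennreal (r powr (- (s + 1))) * angular_limit \<theta> * indicator {\<delta><..} r \<partial>polar_measure E)"
    by (intro nn_integral_cong_AE, use AE_polar_measure in eventually_elim)
      (auto simp: angular_limit_def indicator_def scaleR_mem_iff)
  also have "\<dots> = (\<integral>\<^sup>+\<theta>. (\<integral>\<^sup>+r\<in>{0<..}. ennreal (r powr (- (s + 1))) * angular_limit \<theta>
      * indicator {\<delta><..} r \<partial>lborel) \<partial>surface_measure E)"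
    by (rule nn_integral_polar_measure) measurable
  also have "\<dots> = (\<integral>\<^sup>+\<theta>. (\<integral>\<^sup>+r. angular_limit \<theta> *
      (ennreal (r powr (- (s + 1))) * indicator {\<delta><..} r) \<partial>lborel) \<partial>surface_measure E)"
    using assms(1) by (intro nn_integral_cong) (auto simp: indicator_def mult_ac)
  also have "\<dots> = (\<integral>\<^sup>+\<theta>. angular_limit \<theta> * ennreal (\<delta> powr (- s) / s) \<partial>surface_measure E)"
    using nn_integral_powr_tail[OF assms(1) s_pos]
    by (intro nn_integral_cong) (subst nn_integral_cmult, auto)
  also have "\<dots> = (\<integral>\<^sup>+\<theta>. angular_limit \<theta> \<partial>surface_measure E) * ennreal (\<delta> powr (- s) / s)"
    by (rule nn_integral_multc) simp
  finally show ?thesis .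
qed

lemma emeasure_tail_measure_finite:
  assumes "\<delta> > 0" and "B \<subseteq> E - {0}" "\<And>z. z \<in> B \<Longrightarrow> norm z > \<delta>"
  shows "emeasure (tail_measure E s \<phi>) B < \<infinity>"
proof -
  have "{z \<in> E - {0}. norm z > \<delta>} \<in> sets (restrict_space borel (E - {0}))"
    by (auto simp: sets_restrict_space_iff)
  then have "emeasure (tail_measure E s \<phi>) B \<le> emeasure (tail_measure E s \<phi>) {z \<in> E - {0}. norm z > \<delta>}"
    using assms by (intro emeasure_mono) auto
  also have "\<dots> < \<infinity>"
    using nn_integral_angular_limit
    by (simp only: emeasure_tail_measure_exterior[OF assms(1)]) (simp add: ennreal_mult_less_top)
  finally show ?thesis .
qed

lemma tail_measure_in_M0: "tail_measure E s \<phi> \<in> M0 E"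
proof -
  have "emeasure (tail_measure E s \<phi>) {z \<in> E - {0}. r < norm z} < \<infinity>" if "r > 0" for r
    by (rule emeasure_tail_measure_finite[OF that]) auto
  then show ?thesis by (simp add: M0_def)
qed

text \<open>Dilation by \<open>u\<close> multiplies Lebesgue measure by \<open>u ^ DIM('a)\<close>
  and \<open>\<phi>\<close> by \<open>u powr (- (s + DIM('a)))\<close>; what remains is the factor
  \<open>u powr (- s)\<close>.\<close>

lemma emeasure_tail_measure_scale:
  assumes [measurable]: "B \<in> sets borel" and B: "B \<subseteq> E - {0}" and u: "u > 0"
  shows "emeasure (tail_measure E s \<phi>) B =
    ennreal (u powr s) * emeasure (tail_measure E s \<phi>) {z. z /\<^sub>R u \<in> B}"
proof -
  have [measurable]: "{z. z /\<^sub>R u \<in> B} \<in> sets borel" by measurable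
  have sub: "{z. z /\<^sub>R u \<in> B} \<subseteq> E - {0}"
    using B u scaleR_mem_iff[of "inverse u"] by auto
  have ind: "indicator {z. z /\<^sub>R u \<in> B} (u *\<^sub>R z) = (indicator B z :: ennreal)" for z
    using u by (auto simp: indicator_def)
  have "ennreal (u powr s) * emeasure (tail_measure E s \<phi>) {z. z /\<^sub>R u \<in> B} =
      ennreal (u powr s) * (\<integral>\<^sup>+z. tail_density z * indicator {z. z /\<^sub>R u \<in> B} z \<partial>lborel)"
    by (subst emeasure_tail_measure) (use sub in auto)
  also have "\<dots> = ennreal (u powr s) * (ennreal (u ^ DIM('a)) *
      (\<integral>\<^sup>+z. tail_density (u *\<^sub>R z) * indicator {z. z /\<^sub>R u \<in> B} (u *\<^sub>R z) \<partial>lborel))"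
    by (subst nn_integral_lborel_scaleR[OF _ u]) auto
  also have "\<dots> = (\<integral>\<^sup>+z. ennreal (u powr (s + DIM('a))) * (tail_density (u *\<^sub>R z) * indicator B z) \<partial>lborel)"
    using u by (subst nn_integral_cmult)
      (auto simp: mult.assoc[symmetric] ennreal_mult[symmetric] powr_add powr_realpow ind)
  also have "\<dots> = (\<integral>\<^sup>+z\<in>B. tail_density z \<partial>lborel)"
  proof (intro nn_integral_cong)
    fix z
    show "ennreal (u powr (s + DIM('a))) * (tail_density (u *\<^sub>R z) * indicator B z) = tail_density z * indicator B z"
    proof (cases "z \<in> B")
      case True
      then have z: "z \<in> E - {0}" using B by auto
      have "u powr (s + DIM('a)) * (u powr (- (s + DIM('a))) * \<phi> z) = \<phi> z"
        using u by (simp add: mult.assoc[symmetric] powr_add[symmetric])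
      then show ?thesis
        using True z u pos[OF z] scaleR_mem_iff[OF u, of z]
        by (auto simp: tail_density_def hom ennreal_mult[symmetric])
    qed simp
  qed
  finally show ?thesis by (subst emeasure_tail_measure) (use B in auto)
qed

end


section \<open>Regularly varying densities and tail-preserving families\<close>

lemma sets_scaled_law:
  "sets (scale_measure c (restrict_space (distr N borel Y) S)) = sets (restrict_space borel S)"
  by (simp, rule sets_restrict_space_cong) simp

lemma emeasure_scaled_law:
  assumes [measurable]: "X \<in> borel_measurable N" "S \<in> sets borel" "B \<in> sets borel" and "B \<subseteq> S"
  shows "emeasure (scale_measure c (restrict_space (distr N borel (\<lambda>\<omega>. X \<omega> /\<^sub>R u)) S)) B =
    c * emeasure N {\<omega> \<in> space N. X \<omega> /\<^sub>R u \<in> (B :: 'a::euclidean_space set)}"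
proof -
  have "(\<lambda>\<omega>. X \<omega> /\<^sub>R u) -` B \<inter> space N = {\<omega> \<in> space N. X \<omega> /\<^sub>R u \<in> B}" by auto
  then show ?thesis
    using assms(4) by (simp add: emeasure_restrict_space emeasure_distr)
qed

context cone_tail
begin

text \<open>Scaling of the tail measure absorbs the factor \<open>u powr s\<close>, so it is enough
  to compare the two measures on the dilated set itself. Its points have norm above
  \<open>\<delta> * u\<close>, hence only the far-out behaviour of \<open>X u\<close>
  matters.\<close>

lemma tail_preservingI:
  assumes X: "\<And>u. u > 0 \<Longrightarrow> cone_random_vector E (N u) (X u)"
    and sandwich: "\<And>B \<delta> c. \<delta> > 0 \<Longrightarrow> B \<in> sets borel \<Longrightarrow> B \<subseteq> E - {0} \<Longrightarrow> \<forall>z\<in>B. norm z > \<delta> \<Longrightarrow>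
       c > (1::real) \<Longrightarrow> \<forall>\<^sub>F u in at_top.
         emeasure (N u) {\<omega> \<in> space (N u). X u \<omega> /\<^sub>R u \<in> B}
           \<le> ennreal c * emeasure (tail_measure E s \<phi>) {z. z /\<^sub>R u \<in> B} \<and>
         emeasure (tail_measure E s \<phi>) {z. z /\<^sub>R u \<in> B}
           \<le> ennreal c * emeasure (N u) {\<omega> \<in> space (N u). X u \<omega> /\<^sub>R u \<in> B}"
  shows "tail_preserving E s \<phi> N X"
  unfolding tail_preserving_def M0_converges_def
proof (intro conjI allI impI ballI tail_measure_in_M0 X)
  have law: "emeasure (scale_measure (ennreal (u powr s))
      (restrict_space (distr (N u) borel (\<lambda>\<omega>. X u \<omega> /\<^sub>R u)) (E - {0}))) B =
      ennreal (u powr s) * emeasure (N u) {\<omega> \<in> space (N u). X u \<omega> /\<^sub>R u \<in> B}"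
    if "u > 0" "B \<in> sets borel" "B \<subseteq> E - {0}" for u B
    by (rule emeasure_scaled_law) (use X[OF that(1)] that in \<open>auto simp: cone_random_vector_def\<close>)
  show "\<forall>\<^sub>F u in at_top. scale_measure (ennreal (u powr s))
      (restrict_space (distr (N u) borel (\<lambda>\<omega>. X u \<omega> /\<^sub>R u)) (E - {0})) \<in> M0 E"
    using eventually_gt_at_top[of 0]
  proof eventually_elim
    case (elim u)
    interpret prob_space "N u" using X[OF elim] by (simp add: cone_random_vector_def)
    have "emeasure (scale_measure (ennreal (u powr s))
      (restrict_space (distr (N u) borel (\<lambda>\<omega>. X u \<omega> /\<^sub>R u)) (E - {0}))) {z \<in> E - {0}. r < norm z} < \<infinity>" for r
      using emeasure_finite by (subst law) (auto simp: elim ennreal_mult_eq_top_iff less_top[symmetric])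
    then show ?case by (simp add: M0_def sets_scaled_law del: space_scale_measure sets_scale_measure)
  qed
  fix B assume "B \<in> sets (restrict_space borel (E - {0}))"
    and B': "emeasure (tail_measure E s \<phi>) (top_of_set (E - {0}) frontier_of B) = 0 \<and> 0 \<notin> closure B"
  then have B: "B \<in> sets borel" "B \<subseteq> E - {0}" by (auto simp: sets_restrict_space_iff)
  obtain e where e: "e > 0" "\<And>y. y \<in> B \<Longrightarrow> dist y 0 \<ge> e"
    using B' by (force simp: closure_approachable not_less)
  \<comment> \<open>Halving turns the lower bound \<open>e\<close> on the norms in \<open>B\<close>
    into a strict one.\<close>
  define \<delta> where "\<delta> = e / 2"
  have \<delta>: "\<delta> > 0" "\<forall>z\<in>B. norm z > \<delta>" using e by (force simp: \<delta>_def)+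
  show "((\<lambda>u. emeasure (scale_measure (ennreal (u powr s))
      (restrict_space (distr (N u) borel (\<lambda>\<omega>. X u \<omega> /\<^sub>R u)) (E - {0}))) B)
      \<longlongrightarrow> emeasure (tail_measure E s \<phi>) B) at_top"
  proof (rule ennreal_tendsto_sandwich)
    show "emeasure (tail_measure E s \<phi>) B < \<infinity>"
      by (rule emeasure_tail_measure_finite[OF \<delta>(1) B(2)]) (use \<delta>(2) in auto)
    fix c :: real assume "c > 1"
    from sandwich[OF \<delta>(1) B \<delta>(2) this] eventually_gt_at_top[of 0]
    show "\<forall>\<^sub>F u in at_top. emeasure (scale_measure (ennreal (u powr s))
       (restrict_space (distr (N u) borel (\<lambda>\<omega>. X u \<omega> /\<^sub>R u)) (E - {0}))) B
         \<le> ennreal c * emeasure (tail_measure E s \<phi>) B \<and>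
      emeasure (tail_measure E s \<phi>) B \<le> ennreal c * emeasure (scale_measure (ennreal (u powr s))
       (restrict_space (distr (N u) borel (\<lambda>\<omega>. X u \<omega> /\<^sub>R u)) (E - {0}))) B"
    proof eventually_elim
      case (elim u)
      then show ?case
        unfolding law[OF \<open>u > 0\<close> B] emeasure_tail_measure_scale[OF B \<open>u > 0\<close>]
        by (auto simp: mult.left_commute[of "ennreal c"] intro!: mult_left_mono)
    qed
  qed
qed

end

text \<open>Regular variation is kept in multiplicative form because a factor \<open>c\<close>
  passes unchanged through every integral, whatever the size of the set.\<close>

locale regular_tail = cone_tail +
  fixes f :: "'a \<Rightarrow> real"
  assumes f_nonneg: "f z \<ge> 0" and f_outside: "z \<notin> E \<Longrightarrow> f z = 0"
    and f_comparable: "c > 1 \<Longrightarrow> \<exists>R>0. \<forall>y\<in>E. norm y \<ge> R \<longrightarrow> f y \<le> c * \<phi> y \<and> \<phi> y \<le> c * f y"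

text \<open>Homogeneity comes from taking the limit along \<open>t\<close> and along
  \<open>t * c\<close>. On unit vectors \<open>\<phi>\<close> is a uniform limit of continuous
  functions; homogeneity carries continuity to the rest of \<open>E - {0}\<close>. As
  \<open>\<phi>\<close> is bounded below by a positive constant on the compact set of unit vectors,
  the uniform additive error there becomes a relative one, and it then holds at every far-out point
  along its ray.\<close>

lemma regular_tailI:
  assumes closed: "closed E" and cone: "cone E"
    and f: "\<And>z. f z \<ge> 0" "\<And>z. z \<notin> E \<Longrightarrow> f z = 0"
    and rv: "density_regular_variation E f s \<phi>"
  shows "regular_tail E s \<phi> f"
proof -
  define D where "D = s + DIM('a)"
  obtain r0 where r0: "r0 > 0" "continuous_on (E - cball 0 r0) f" and s: "s > 0"
    and pos: "\<And>z. z \<in> E - {0} \<Longrightarrow> \<phi> z > 0"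
    and unif: "\<And>C. compact C \<Longrightarrow> C \<subseteq> E - {0} \<Longrightarrow>
        uniform_limit C (\<lambda>t z. t powr D * f (t *\<^sub>R z)) \<phi> at_top"
    using rv unfolding density_regular_variation_def D_def by auto
  have lim: "((\<lambda>t. t powr D * f (t *\<^sub>R z)) \<longlongrightarrow> \<phi> z) at_top" if "z \<in> E - {0}" for z
    using tendsto_uniform_limitI[OF unif[of "{z}"], of z] that by auto
  have hom: "\<phi> (c *\<^sub>R z) = c powr (- D) * \<phi> z" if z: "z \<in> E - {0}" and c: "c > 0" for z c
  proof (rule tendsto_unique)
    show "((\<lambda>t. t powr D * f (t *\<^sub>R c *\<^sub>R z)) \<longlongrightarrow> \<phi> (c *\<^sub>R z)) at_top"
      by (rule lim) (use z c cone_scaleR_iff[OF cone c] in auto)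
    have "((\<lambda>t. (t * c) powr D * f ((t * c) *\<^sub>R z)) \<longlongrightarrow> \<phi> z) at_top"
      by (rule filterlim_compose[OF lim[OF z] filterlim_at_top_mult_tendsto_pos[OF tendsto_const c filterlim_ident]])
    then have "((\<lambda>t. c powr (- D) * ((t * c) powr D * f ((t * c) *\<^sub>R z))) \<longlongrightarrow> c powr (- D) * \<phi> z) at_top"
      by (intro tendsto_intros)
    then show "((\<lambda>t. t powr D * f (t *\<^sub>R c *\<^sub>R z)) \<longlongrightarrow> c powr (- D) * \<phi> z) at_top"
    proof (rule Lim_transform_eventually)
      show "\<forall>\<^sub>F t in at_top. c powr (- D) * ((t * c) powr D * f ((t * c) *\<^sub>R z)) = t powr D * f (t *\<^sub>R c *\<^sub>R z)"
        using eventually_gt_at_top[of 0]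
        by eventually_elim (use c in \<open>auto simp: powr_mult powr_minus field_simps\<close>)
    qed
  qed simp
  define C where "C = E \<inter> sphere 0 1"
  have C: "compact C" "C \<subseteq> E - {0}"
    using closed unfolding C_def by (auto intro: closed_Int_compact)
  have contC: "continuous_on C \<phi>"
  proof (rule uniform_limit_theorem[OF _ unif[OF C]])
    show "\<forall>\<^sub>F t in at_top. continuous_on C (\<lambda>z. t powr D * f (t *\<^sub>R z))"
      \<comment> \<open>Beyond \<open>r0\<close> the dilate of the unit vectors lies where
        \<open>f\<close> is assumed continuous.\<close>
      using eventually_gt_at_top[of r0]
    proof eventually_elim
      case (elim t)
      have "continuous_on C (\<lambda>z. f (t *\<^sub>R z))"
        by (rule continuous_on_compose2[OF r0(2)])
           (use elim r0(1) cone_scaleR_iff[OF cone, of t] in \<open>auto simp: C_def intro!: continuous_intros\<close>)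
      then show ?case by (intro continuous_intros)
    qed
  qed simp
  have polar: "\<phi> z = norm z powr (- D) * \<phi> (z /\<^sub>R norm z)" "z /\<^sub>R norm z \<in> C" if "z \<in> E - {0}" for z
    using that hom[of "z /\<^sub>R norm z" "norm z"] cone_scaleR_iff[OF cone, of "inverse (norm z)" z]
    by (auto simp: C_def)
  have "continuous_on (E - {0}) (\<lambda>z. norm z powr (- D) * \<phi> (z /\<^sub>R norm z))"
    by (intro continuous_intros continuous_on_compose2[OF contC]) (use polar in auto)
  then have cont: "continuous_on (E - {0}) \<phi>"
    by (rule continuous_on_eq) (use polar in auto)
  show ?thesis
  proof
    show "continuous_on (E - {0}) \<phi>" by fact
    fix c :: real assume c: "c > 1"
    obtain m where m: "m > 0" "\<And>\<theta>. \<theta> \<in> C \<Longrightarrow> m \<le> \<phi> \<theta>"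
    proof (cases "C = {}")
      case False
      obtain x where "x \<in> C" "\<forall>y\<in>C. \<phi> x \<le> \<phi> y"
        using continuous_attains_inf[OF C(1) False contC] by auto
      then show ?thesis using that[of "\<phi> x"] pos[of x] C(2) by auto
    qed (use that[of 1] in auto)
    \<comment> \<open>The bound \<open>\<phi> \<theta> \<le> c * F\<close> is the more demanding
      one: it allows an error of at most \<open>(c - 1) / c\<close> times
      \<open>\<phi> \<theta>\<close>, which \<open>m\<close> bounds from below.\<close>
    define \<eta> where "\<eta> = (c - 1) / c * m"
    have "\<eta> > 0" using c m by (simp add: \<eta>_def)
    from uniform_limitD[OF unif[OF C] this]
    obtain R where R: "\<And>t \<theta>. t \<ge> R \<Longrightarrow> \<theta> \<in> C \<Longrightarrow> dist (t powr D * f (t *\<^sub>R \<theta>)) (\<phi> \<theta>) < \<eta>"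
      unfolding eventually_at_top_linorder by auto
    show "\<exists>R>0. \<forall>y\<in>E. norm y \<ge> R \<longrightarrow> f y \<le> c * \<phi> y \<and> \<phi> y \<le> c * f y"
    \<comment> \<open>The 1 keeps the radius positive and \<open>y\<close> away from the origin, so
      that \<open>y\<close> has a direction.\<close>
    proof (intro exI[of _ "max R 1"] conjI ballI impI)
      fix y assume y: "y \<in> E" "max R 1 \<le> norm y"
      then have y': "y \<in> E - {0}" by auto
      define \<theta> where "\<theta> = y /\<^sub>R norm y"
      define F where "F = norm y powr D * f y"
      have \<theta>: "\<theta> \<in> C" using polar(2)[OF y'] by (simp add: \<theta>_def)
      have F: "\<bar>F - \<phi> \<theta>\<bar> < \<eta>"
        using R[of "norm y" \<theta>] y y' \<theta> by (auto simp: F_def \<theta>_def dist_real_def)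
      have "\<eta> \<le> (c - 1) / c * \<phi> \<theta>" unfolding \<eta>_def using c m(2)[OF \<theta>] by (intro mult_left_mono) auto
      then have "c * \<eta> \<le> (c - 1) * \<phi> \<theta>" using c by (simp add: field_simps)
      moreover have "\<eta> \<le> c * \<eta>" using c \<open>\<eta> > 0\<close> by simp
      moreover have "c * (\<phi> \<theta> - F) \<le> c * \<eta>" using F c by (intro mult_left_mono) auto
      ultimately have *: "F \<le> c * \<phi> \<theta>" "\<phi> \<theta> \<le> c * F"
        using F by (auto simp: algebra_simps)
      have fy: "f y = norm y powr (- D) * F" and "\<phi> y = norm y powr (- D) * \<phi> \<theta>"
        using y' polar(1)[OF y'] by (auto simp: F_def \<theta>_def powr_minus field_simps)
      then show "f y \<le> c * \<phi> y" "\<phi> y \<le> c * f y"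
        using mult_left_mono[OF *(1), of "norm y powr (- D)"] mult_left_mono[OF *(2), of "norm y powr (- D)"]
        by (simp_all add: mult.left_commute)
    qed simp
  qed (use closed cone f s pos hom D_def in auto)
qed

context regular_tail
begin

lemma density_law_comparable:
  assumes law: "distributed M lborel \<xi> (\<lambda>z. ennreal (f z))"
    and c: "c > 1" and R: "\<And>y. y \<in> E \<Longrightarrow> norm y \<ge> R \<Longrightarrow> f y \<le> c * \<phi> y \<and> \<phi> y \<le> c * f y"
    and [measurable]: "U \<in> sets borel" and U: "U \<subseteq> E - {0}" "\<And>z. z \<in> U \<Longrightarrow> norm z \<ge> R"
  shows "emeasure M {\<omega> \<in> space M. \<xi> \<omega> \<in> U} \<le> ennreal c * emeasure (tail_measure E s \<phi>) U"
    and "emeasure (tail_measure E s \<phi>) U \<le> ennreal c * emeasure M {\<omega> \<in> space M. \<xi> \<omega> \<in> U}"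
proof -
  have [measurable]: "(\<lambda>z. ennreal (f z)) \<in> borel_measurable borel"
    using law by (auto simp: distributed_def)
  have P: "emeasure M {\<omega> \<in> space M. \<xi> \<omega> \<in> U} = (\<integral>\<^sup>+z\<in>U. ennreal (f z) \<partial>lborel)"
    using distributed_emeasure[OF law, of U] by (simp add: vimage_def Int_def conj_commute)
  have \<nu>: "emeasure (tail_measure E s \<phi>) U = (\<integral>\<^sup>+z\<in>U. tail_density z \<partial>lborel)"
    by (rule emeasure_tail_measure) (use U in auto)
  have "ennreal (f z) \<le> ennreal c * tail_density z" if "z \<in> U" for z
  proof -
    have z: "z \<in> E - {0}" using that U(1) by auto
    then show ?thesis using R[of z] U(2)[OF that] z c pos[of z]
    by (auto simp: tail_density_def ennreal_mult[symmetric] intro!: ennreal_leI)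
  qed
  then have "(\<integral>\<^sup>+z\<in>U. ennreal (f z) \<partial>lborel) \<le> (\<integral>\<^sup>+z. ennreal c * (tail_density z * indicator U z) \<partial>lborel)"
    by (intro nn_integral_mono) (auto simp: indicator_def)
  then show "emeasure M {\<omega> \<in> space M. \<xi> \<omega> \<in> U} \<le> ennreal c * emeasure (tail_measure E s \<phi>) U"
    unfolding P \<nu> by (simp add: nn_integral_cmult)
  have "tail_density z \<le> ennreal c * ennreal (f z)" if "z \<in> U" for z
  proof -
    have z: "z \<in> E - {0}" using that U(1) by auto
    then show ?thesis using R[of z] U(2)[OF that] z c f_nonneg[of z]
    by (auto simp: tail_density_def ennreal_mult[symmetric] intro!: ennreal_leI)
  qed
  then have "(\<integral>\<^sup>+z\<in>U. tail_density z \<partial>lborel) \<le> (\<integral>\<^sup>+z. ennreal c * (ennreal (f z) * indicator U z) \<partial>lborel)"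
    by (intro nn_integral_mono) (auto simp: indicator_def)
  then show "emeasure (tail_measure E s \<phi>) U \<le> ennreal c * emeasure M {\<omega> \<in> space M. \<xi> \<omega> \<in> U}"
    unfolding P \<nu> by (simp add: nn_integral_cmult)
qed

text \<open>\<open>R\<close> is a fixed radius when this is applied to \<open>\<xi>\<close>, and the
  moving threshold \<open>t u\<close> when it is applied to the generated family.\<close>

lemma preimage_scaleR:
  assumes B: "B \<in> sets borel" "B \<subseteq> E - {0}" "\<forall>z\<in>B. norm z > \<delta>" and u: "u > 0" and "R \<le> \<delta> * u"
  shows "{z. z /\<^sub>R u \<in> B} \<in> sets borel" "{z. z /\<^sub>R u \<in> B} \<subseteq> E - {0}"
    and "z /\<^sub>R u \<in> B \<Longrightarrow> norm z > R"
proof -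
  have [measurable]: "B \<in> sets borel" by fact
  show "{z. z /\<^sub>R u \<in> B} \<in> sets borel" by measurable
  show "{z. z /\<^sub>R u \<in> B} \<subseteq> E - {0}"
    using B u scaleR_mem_iff[of "inverse u"] by auto
  assume "z /\<^sub>R u \<in> B"
  then have "norm (z /\<^sub>R u) > \<delta>" using B(3) by auto
  then show "norm z > R" using u assms(5) by (simp add: field_simps)
qed

lemma tail_preserving_density:
  assumes "prob_space M" and law: "distributed M lborel \<xi> (\<lambda>z. ennreal (f z))"
  shows "tail_preserving E s \<phi> (\<lambda>_. M) (\<lambda>_. \<xi>)"
proof (rule tail_preservingI)
  have [measurable]: "\<xi> \<in> borel_measurable M"
    using law by (auto simp: distributed_def)
  have "emeasure M (\<xi> -` (- E) \<inter> space M) = (\<integral>\<^sup>+z\<in>- E. ennreal (f z) \<partial>lborel)"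
    by (rule distributed_emeasure[OF law]) simp
  also have "\<dots> = (\<integral>\<^sup>+z. 0 \<partial>(lborel :: 'a measure))"
    by (intro nn_integral_cong) (auto simp: indicator_def f_outside)
  finally have "\<xi> -` (- E) \<inter> space M \<in> null_sets M" by (intro null_setsI) auto
  then have "AE \<omega> in M. \<xi> \<omega> \<in> E" by (rule AE_I') auto
  then show "cone_random_vector E M \<xi>"
    using assms(1) by (simp add: cone_random_vector_def)
  fix B and \<delta> c :: real
  assume \<delta>: "\<delta> > 0" "\<forall>z\<in>B. norm z > \<delta>" and B: "B \<in> sets borel" "B \<subseteq> E - {0}" and c: "c > 1"
  obtain R where R: "R > 0" "\<And>y. y \<in> E \<Longrightarrow> norm y \<ge> R \<Longrightarrow> f y \<le> c * \<phi> y \<and> \<phi> y \<le> c * f y"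
    using f_comparable[OF c] by auto
  show "\<forall>\<^sub>F u in at_top.
         emeasure M {\<omega> \<in> space M. \<xi> \<omega> /\<^sub>R u \<in> B}
           \<le> ennreal c * emeasure (tail_measure E s \<phi>) {z. z /\<^sub>R u \<in> B} \<and>
         emeasure (tail_measure E s \<phi>) {z. z /\<^sub>R u \<in> B}
           \<le> ennreal c * emeasure M {\<omega> \<in> space M. \<xi> \<omega> /\<^sub>R u \<in> B}"
    using eventually_gt_at_top[of "R / \<delta>"]
  proof eventually_elim
    case (elim u)
    have u: "u > 0" using elim R(1) \<delta>(1) by (auto intro: less_trans[rotated])
    have "R \<le> \<delta> * u" using elim \<delta>(1) by (simp add: field_simps)
    note U = preimage_scaleR[OF B \<delta>(2) u this]
    show ?case
      using density_law_comparable[OF law c R(2) U(1,2)] U(3) by force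
  qed
qed

section \<open>The generated family\<close>

lemma tail_measure_exterior_nonzero:
  assumes "emeasure (tail_measure E s \<phi>) (E - {0}) \<noteq> 0" and "\<delta> > 0"
  shows "emeasure (tail_measure E s \<phi>) {z \<in> E - {0}. norm z > \<delta>} \<noteq> 0"
proof
  assume "emeasure (tail_measure E s \<phi>) {z \<in> E - {0}. norm z > \<delta>} = 0"
  then have "(\<integral>\<^sup>+\<theta>. angular_limit \<theta> \<partial>surface_measure E) = 0"
    using \<open>\<delta> > 0\<close> s_pos by (simp only: emeasure_tail_measure_exterior) auto
  \<comment> \<open>A vanishing angular constant makes every exterior null, and countably many
    exteriors exhaust \<open>E - {0}\<close>.\<close>
  then have "emeasure (tail_measure E s \<phi>) {z \<in> E - {0}. norm z > 1 / Suc n} = 0" for n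
    using emeasure_tail_measure_exterior[of "1 / Suc n"] by simp
  then have "emeasure (tail_measure E s \<phi>) (\<Union>n. {z \<in> E - {0}. norm z > 1 / Suc n}) = 0"
    by (intro emeasure_UN_eq_0) (auto simp: sets_restrict_space_iff)
  also have "(\<Union>n. {z \<in> E - {0}. norm z > 1 / Suc n}) = E - {0}"
    using reals_Archimedean[of "norm _"] by (auto simp: inverse_eq_divide) 
  finally show False using assms by simp
qed

text \<open>The generated density divides by this probability. Comparability with any one constant,
  here 2, transfers the positive mass of an exterior from the tail measure to the law of
  \<open>\<xi>\<close>.\<close>

lemma exceedance_prob_pos:
  assumes "prob_space M" and law: "distributed M lborel \<xi> (\<lambda>z. ennreal (f z))"
    and nonzero: "emeasure (tail_measure E s \<phi>) (E - {0}) \<noteq> 0"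
  shows "\<forall>\<^sub>F t in at_top. exceedance_prob M \<xi> t > 0"
proof -
  interpret prob_space M by fact
  have [measurable]: "\<xi> \<in> borel_measurable M"
    using law by (auto simp: distributed_def)
  obtain R where R: "R > 0" "\<And>y. y \<in> E \<Longrightarrow> norm y \<ge> R \<Longrightarrow> f y \<le> 2 * \<phi> y \<and> \<phi> y \<le> 2 * f y"
    using f_comparable[of 2] by auto
  show ?thesis using eventually_ge_at_top[of R]
  proof eventually_elim
    case (elim t)
    define U where "U = {z \<in> E - {0}. norm z > t}"
    have U: "U \<in> sets borel" "U \<subseteq> E - {0}" "\<And>z. z \<in> U \<Longrightarrow> norm z \<ge> R"
      using elim by (auto simp: U_def)
    have "0 \<noteq> emeasure (tail_measure E s \<phi>) U"
      unfolding U_def by (rule tail_measure_exterior_nonzero[OF nonzero, symmetric]) (use elim R(1) in auto)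
    moreover have "emeasure (tail_measure E s \<phi>) U \<le> ennreal 2 * emeasure M {\<omega> \<in> space M. \<xi> \<omega> \<in> U}"
      by (rule density_law_comparable(2)[OF law _ R(2) U]) auto
    moreover have "emeasure M {\<omega> \<in> space M. \<xi> \<omega> \<in> U} \<le> emeasure M {\<omega> \<in> space M. norm (\<xi> \<omega>) > t}"
      by (intro emeasure_mono) (auto simp: U_def)
    ultimately have "emeasure M {\<omega> \<in> space M. norm (\<xi> \<omega>) > t} \<noteq> 0" by auto
    then show ?case by (simp add: exceedance_prob_def emeasure_eq_measure zero_less_measure_iff)
  qed
qed

text \<open>Comparability is integrated along the ray through \<open>\<theta>\<close>, starting at
  \<open>t\<close>. The integral of \<open>r powr (- (s + 1))\<close> from \<open>t\<close> on is
  \<open>t powr (- s) / s\<close>, so the prefactor \<open>s * t powr s\<close> is exactly the one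
  that recovers \<open>\<phi> \<theta>\<close> up to the factor \<open>c\<close>.\<close>

lemma angular_tail_comparable:
  assumes c: "c > 1" and R: "\<And>y. y \<in> E \<Longrightarrow> norm y \<ge> R \<Longrightarrow> f y \<le> c * \<phi> y \<and> \<phi> y \<le> c * f y"
    and t: "t > 0" "t \<ge> R" and \<theta>: "\<theta> \<in> E \<inter> sphere 0 1"
    and [measurable]: "(\<lambda>z. ennreal (f z)) \<in> borel_measurable borel"
  defines "I \<equiv> (\<integral>\<^sup>+r\<in>{t<..}. ennreal (polar_density f r \<theta>) \<partial>lborel)"
  shows "ennreal (s * t powr s) * I \<le> ennreal c * ennreal (\<phi> \<theta>)"
    and "ennreal (\<phi> \<theta>) \<le> ennreal c * (ennreal (s * t powr s) * I)"
proof -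
  have \<theta>0: "\<theta> \<in> E - {0}" using \<theta> by auto
  have *: "polar_density f r \<theta> \<le> c * \<phi> \<theta> * r powr (- (s + 1))"
     "\<phi> \<theta> * r powr (- (s + 1)) \<le> c * polar_density f r \<theta>" if "r > t" for r
  proof -
    have r: "r > 0" using that t by simp
    have y: "r *\<^sub>R \<theta> \<in> E" "norm (r *\<^sub>R \<theta>) \<ge> R"
      using that t r \<theta> scaleR_mem_iff[OF r] by auto
    have "r powr (- (s + DIM('a))) * r ^ (DIM('a) - 1) = r powr (- (s + 1))"
      using r by (simp add: powr_realpow[symmetric] powr_add[symmetric] of_nat_diff)
    then have e: "r ^ (DIM('a) - 1) * \<phi> (r *\<^sub>R \<theta>) = \<phi> \<theta> * r powr (- (s + 1))"
      unfolding hom[OF \<theta>0 r] by (metis mult.assoc mult.commute)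
    have "polar_density f r \<theta> \<le> r ^ (DIM('a) - 1) * (c * \<phi> (r *\<^sub>R \<theta>))"
      unfolding polar_density_def using R[OF y] r by (intro mult_left_mono) auto
    also have "\<dots> = c * \<phi> \<theta> * r powr (- (s + 1))"
      by (simp only: mult.left_commute[of _ c] e mult.assoc)
    finally show "polar_density f r \<theta> \<le> c * \<phi> \<theta> * r powr (- (s + 1))" .
    have "\<phi> \<theta> * r powr (- (s + 1)) \<le> r ^ (DIM('a) - 1) * (c * f (r *\<^sub>R \<theta>))"
      unfolding e[symmetric] using R[OF y] r by (intro mult_left_mono) auto
    then show "\<phi> \<theta> * r powr (- (s + 1)) \<le> c * polar_density f r \<theta>"
      by (simp only: polar_density_def mult.left_commute[of _ c])
  qed
  have K: "ennreal (s * t powr s) * ennreal (t powr (- s) / s) = 1"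
    using t s_pos by (simp add: ennreal_mult[symmetric] powr_minus)
  have tail: "(\<integral>\<^sup>+r. ennreal a * (ennreal (r powr (- (s + 1))) * indicator {t<..} r) \<partial>lborel) =
      ennreal a * ennreal (t powr (- s) / s)" for a
    using nn_integral_powr_tail[OF t(1) s_pos] by (subst nn_integral_cmult) auto
  have "I \<le> (\<integral>\<^sup>+r. ennreal (c * \<phi> \<theta>) * (ennreal (r powr (- (s + 1))) * indicator {t<..} r) \<partial>lborel)"
    unfolding I_def using c pos[OF \<theta>0] *(1)
    by (intro nn_integral_mono) (auto simp: indicator_def ennreal_mult[symmetric] intro!: ennreal_leI)
  then have "ennreal (s * t powr s) * I \<le> ennreal (s * t powr s) * (ennreal (c * \<phi> \<theta>) * ennreal (t powr (- s) / s))"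
    unfolding tail by (rule mult_left_mono) simp
  also have "\<dots> = ennreal (c * \<phi> \<theta>) * (ennreal (s * t powr s) * ennreal (t powr (- s) / s))"
    by (simp only: mult_ac)
  also have "\<dots> = ennreal c * ennreal (\<phi> \<theta>)"
    using c pos[OF \<theta>0] by (simp only: K) (simp add: ennreal_mult)
  finally show "ennreal (s * t powr s) * I \<le> ennreal c * ennreal (\<phi> \<theta>)" .
  \<comment> \<open>Measurability is given for \<open>ennreal (f z)\<close>, so the density along
    the ray is written as a product containing it.\<close>
  have pm: "(\<lambda>r. ennreal (polar_density f r \<theta>) * indicator {t<..} r) =
      (\<lambda>r. ennreal (r ^ (DIM('a) - 1)) * ennreal (f (r *\<^sub>R \<theta>)) * indicator {t<..} r)"
    using t f_nonneg by (auto simp: polar_density_def ennreal_mult indicator_def)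
  have "ennreal (\<phi> \<theta>) * ennreal (t powr (- s) / s) \<le>
      (\<integral>\<^sup>+r. ennreal c * (ennreal (polar_density f r \<theta>) * indicator {t<..} r) \<partial>lborel)"
    unfolding tail[symmetric] using c pos[OF \<theta>0] *(2)
    by (intro nn_integral_mono) (auto simp: indicator_def ennreal_mult'[symmetric] intro!: ennreal_leI)
  also have "\<dots> = ennreal c * I"
    unfolding I_def by (subst nn_integral_cmult) (auto simp: pm)
  finally have "ennreal (s * t powr s) * (ennreal (\<phi> \<theta>) * ennreal (t powr (- s) / s)) \<le> ennreal (s * t powr s) * (ennreal c * I)"
    by (rule mult_left_mono) simp
  moreover have "ennreal (s * t powr s) * (ennreal (\<phi> \<theta>) * ennreal (t powr (- s) / s)) = ennreal (\<phi> \<theta>)"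
    using K by (metis mult.left_commute mult.right_neutral)
  ultimately show "ennreal (\<phi> \<theta>) \<le> ennreal c * (ennreal (s * t powr s) * I)"
    by (simp add: mult.left_commute)
qed

text \<open>On the dilate of \<open>B\<close> the radius exceeds \<open>\<delta> * u\<close>, which
  is at least \<open>t u\<close> because \<open>t\<close> is of smaller order than \<open>u\<close>.
  Hence only the power-law branch of the density is seen. There the exceedance probability cancels,
  and what is left differs from the polar density of the tail measure only through
  \<open>angular_tail_comparable\<close>, which applies because \<open>t u\<close> tends to
  infinity.\<close>

lemma tail_preserving_gen_family:
  assumes "prob_space M" and law: "distributed M lborel \<xi> (\<lambda>z. ennreal (f z))"
    and nonzero: "emeasure (tail_measure E s \<phi>) (E - {0}) \<noteq> 0"
    and gen: "gen_family E M \<xi> f s t N X"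
  shows "tail_preserving E s \<phi> N X"
proof (rule tail_preservingI)
  have [measurable]: "(\<lambda>z. ennreal (f z)) \<in> borel_measurable borel"
    using law by (auto simp: distributed_def)
  have t: "filterlim t at_top at_top" "t \<in> o(\<lambda>u. u)"
    and N: "\<And>u. u > 0 \<Longrightarrow> distributed (N u) (polar_measure E)
          (\<lambda>\<omega>. (norm (X u \<omega>), X u \<omega> /\<^sub>R norm (X u \<omega>))) (gen_density M \<xi> f s (t u))"
    using gen by (auto simp: gen_family_def)
  show X: "cone_random_vector E (N u) (X u)" if "u > 0" for u
    using gen that by (auto simp: gen_family_def)
  fix B and \<delta> c :: real
  assume \<delta>: "\<delta> > 0" "\<forall>z\<in>B. norm z > \<delta>" and B: "B \<in> sets borel" "B \<subseteq> E - {0}" and c: "c > 1"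
  obtain R where R: "R > 0" "\<And>y. y \<in> E \<Longrightarrow> norm y \<ge> R \<Longrightarrow> f y \<le> c * \<phi> y \<and> \<phi> y \<le> c * f y"
    using f_comparable[OF c] by auto
  have "\<forall>\<^sub>F u in at_top. exceedance_prob M \<xi> (t u) > 0"
    by (rule eventually_compose_filterlim[OF exceedance_prob_pos[OF assms(1) law nonzero] t(1)])
  moreover have "\<forall>\<^sub>F u in at_top. t u \<ge> R"
    using t(1) by (simp add: filterlim_at_top)
  moreover have "\<forall>\<^sub>F u in at_top. norm (t u) \<le> \<delta> * norm u"
    using landau_o.smallD[OF t(2) \<delta>(1)] .
  ultimately show "\<forall>\<^sub>F u in at_top.
         emeasure (N u) {\<omega> \<in> space (N u). X u \<omega> /\<^sub>R u \<in> B}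
           \<le> ennreal c * emeasure (tail_measure E s \<phi>) {z. z /\<^sub>R u \<in> B} \<and>
         emeasure (tail_measure E s \<phi>) {z. z /\<^sub>R u \<in> B}
           \<le> ennreal c * emeasure (N u) {\<omega> \<in> space (N u). X u \<omega> /\<^sub>R u \<in> B}"
    using eventually_gt_at_top[of 0]
  proof eventually_elim
    case (elim u)
    then have u: "u > 0" and tu: "t u \<ge> R" "t u > 0" "t u \<le> \<delta> * u" and p: "exceedance_prob M \<xi> (t u) > 0"
      using R(1) by auto
    define U where "U = {z. z /\<^sub>R u \<in> B}"
    note U = preimage_scaleR[OF B \<delta>(2) u tu(3), folded U_def]
    have [measurable]: "U \<in> sets borel" by fact
    define G where "G = gen_density M \<xi> f s (t u)"
    have [measurable]: "G \<in> borel_measurable (borel \<Otimes>\<^sub>M borel)"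
      using N[OF u] by (auto simp: distributed_def G_def)
    have [measurable]: "X u \<in> borel_measurable (N u)" using X[OF u] by (simp add: cone_random_vector_def)
    have P: "emeasure (N u) {\<omega> \<in> space (N u). X u \<omega> /\<^sub>R u \<in> B} =
        (\<integral>\<^sup>+(r, \<theta>). G (r, \<theta>) * indicator U (r *\<^sub>R \<theta>) \<partial>polar_measure E)"
    proof -
      have [measurable]: "{(r, \<theta>). r *\<^sub>R \<theta> \<in> U} \<in> sets (borel \<Otimes>\<^sub>M (borel :: 'a measure))"
      proof -
        have "(\<lambda>p::real \<times> 'a. fst p *\<^sub>R snd p) -` U \<inter> space (borel \<Otimes>\<^sub>M borel) \<in> sets (borel \<Otimes>\<^sub>M borel)"
          by measurable
        then show ?thesis by (simp add: space_pair_measure vimage_def split_beta')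
      qed
      \<comment> \<open>This includes \<open>x = 0\<close>, so the two events below agree exactly
        and no null set has to be discarded.\<close>
      have eq: "norm x *\<^sub>R (x /\<^sub>R norm x) = x" for x :: 'a by (cases "x = 0") auto
      have "(\<lambda>\<omega>. (norm (X u \<omega>), X u \<omega> /\<^sub>R norm (X u \<omega>))) -` {(r, \<theta>). r *\<^sub>R \<theta> \<in> U} \<inter> space (N u) =
        {\<omega> \<in> space (N u). X u \<omega> /\<^sub>R u \<in> B}"
        using eq by (auto simp: U_def simp del: scaleR_scaleR)
      then have "emeasure (N u) {\<omega> \<in> space (N u). X u \<omega> /\<^sub>R u \<in> B} =
          (\<integral>\<^sup>+p. G p * indicator {(r, \<theta>). r *\<^sub>R \<theta> \<in> U} p \<partial>polar_measure E)"
        using distributed_emeasure[OF N[OF u], of "{(r, \<theta>). r *\<^sub>R \<theta> \<in> U}"] by (simp add: G_def)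
      then show ?thesis by (simp add: split_beta' indicator_def)
    qed
    have \<nu>: "emeasure (tail_measure E s \<phi>) U = (\<integral>\<^sup>+(r, \<theta>). ennreal (r powr (- (s + 1))) * angular_limit \<theta>
        * indicator U (r *\<^sub>R \<theta>) \<partial>polar_measure E)"
      by (rule emeasure_tail_measure_polar[OF U(1,2)])
    have G: "G (r, \<theta>) \<le> ennreal c * (ennreal (r powr (- (s + 1))) * angular_limit \<theta>) \<and>
        ennreal (r powr (- (s + 1))) * angular_limit \<theta> \<le> ennreal c * G (r, \<theta>)"
      if r: "r > 0" and \<theta>: "\<theta> \<in> E \<inter> sphere 0 1" and inU: "r *\<^sub>R \<theta> \<in> U" for r \<theta>
    proof -
      define I where "I = (\<integral>\<^sup>+r\<in>{t u<..}. ennreal (polar_density f r \<theta>) \<partial>lborel)"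
      define q where "q = exceedance_prob M \<xi> (t u)"
      define w where "w = ennreal (r powr (- (s + 1)))"
      have "r > t u"
        using U(3)[of "r *\<^sub>R \<theta>"] inU r \<theta> by (simp add: U_def)
      then have "G (r, \<theta>) = ennreal (q * (s * t u powr s) * r powr (- (s + 1))) * (I / ennreal q)"
        by (simp add: G_def gen_density_def angular_density_def I_def q_def mult.assoc)
      also have "\<dots> = w * (ennreal (s * t u powr s) * (ennreal q * I / ennreal q))"
        using p s_pos by (simp add: q_def ennreal_mult w_def mult_ac ennreal_times_divide)
      \<comment> \<open>The cancellation in \<open>ennreal\<close> requires \<open>q\<close> to be
        nonzero, which is why positivity of the exceedance probability was arranged
        beforehand.\<close>
      also have "ennreal q * I / ennreal q = I"
        using p by (simp add: q_def mult.commute[of _ I] mult_divide_eq_ennreal)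
      finally have Gr: "G (r, \<theta>) = w * (ennreal (s * t u powr s) * I)" .
      have ang: "angular_limit \<theta> = ennreal (\<phi> \<theta>)" using \<theta> by (simp add: angular_limit_def)
      note cmp = angular_tail_comparable[OF c R(2) tu(2,1) \<theta>, folded I_def]
      have "G (r, \<theta>) \<le> w * (ennreal c * ennreal (\<phi> \<theta>))"
        unfolding Gr by (rule mult_left_mono[OF cmp(1)]) auto
      moreover have "w * ennreal (\<phi> \<theta>) \<le> w * (ennreal c * (ennreal (s * t u powr s) * I))"
        by (rule mult_left_mono[OF cmp(2)]) auto
      ultimately show ?thesis
        unfolding ang w_def[symmetric] by (simp add: Gr mult.left_commute)
    qed
    have "emeasure (N u) {\<omega> \<in> space (N u). X u \<omega> /\<^sub>R u \<in> B} \<le>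
      (\<integral>\<^sup>+(r, \<theta>). ennreal c * (ennreal (r powr (- (s + 1))) * angular_limit \<theta> * indicator U (r *\<^sub>R \<theta>)) \<partial>polar_measure E)"
      unfolding P by (intro nn_integral_mono_AE, use AE_polar_measure in eventually_elim)
        (use G in \<open>auto simp: indicator_def\<close>)
    also have "\<dots> = ennreal c * emeasure (tail_measure E s \<phi>) U"
      unfolding \<nu> by (subst nn_integral_cmult[symmetric]) (auto simp: split_beta')
    finally have 1: "emeasure (N u) {\<omega> \<in> space (N u). X u \<omega> /\<^sub>R u \<in> B} \<le> ennreal c * emeasure (tail_measure E s \<phi>) U" .
    have "emeasure (tail_measure E s \<phi>) U \<le>
      (\<integral>\<^sup>+(r, \<theta>). ennreal c * (G (r, \<theta>) * indicator U (r *\<^sub>R \<theta>)) \<partial>polar_measure E)"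
      unfolding \<nu> by (intro nn_integral_mono_AE, use AE_polar_measure in eventually_elim)
        (use G in \<open>auto simp: indicator_def\<close>)
    also have "\<dots> = ennreal c * emeasure (N u) {\<omega> \<in> space (N u). X u \<omega> /\<^sub>R u \<in> B}"
      unfolding P by (subst nn_integral_cmult[symmetric]) (auto simp: split_beta')
    finally show ?case using 1 by (simp add: U_def)
  qed
qed

end


section \<open>A Fatou lemma for continuously converging integrands\<close>

text \<open>Tonelli applied to the region below the graph of \<open>h\<close>. Negative values are
  cut off by \<open>ennreal\<close> on the left and by the restriction to \<open>{0..}\<close> on
  the right. The second claim prepares Fatou's lemma in the variable \<open>t\<close>.\<close>

lemma nn_integral_layer_cake:
  assumes "sigma_finite_measure M" and [measurable]: "h \<in> borel_measurable M"
  shows "(\<integral>\<^sup>+x. ennreal (h x) \<partial>M) =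
    (\<integral>\<^sup>+t\<in>{0::real..}. emeasure M {x \<in> space M. t < h x} \<partial>lborel)"
    and "(\<lambda>t. emeasure M {x \<in> space M. t < h x}) \<in> borel_measurable borel"
proof -
  interpret pair_sigma_finite M lborel
    by (intro pair_sigma_finite.intro assms(1) lborel.sigma_finite_measure_axioms)
  have set: "{p \<in> space (lborel \<Otimes>\<^sub>M M). fst p < h (snd p)} \<in> sets (lborel \<Otimes>\<^sub>M M)"
    by measurable
  have "(\<lambda>t. emeasure M (Pair t -` {p \<in> space (lborel \<Otimes>\<^sub>M M). fst p < h (snd p)}))
      \<in> borel_measurable lborel"
    by (rule M1.measurable_emeasure_Pair[OF set])
  then show "(\<lambda>t. emeasure M {x \<in> space M. t < h x}) \<in> borel_measurable borel"
    by (simp add: space_pair_measure vimage_def)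
  have "ennreal (h x) = (\<integral>\<^sup>+t\<in>{0..}. indicator {..<h x} t \<partial>lborel)" for x
  proof -
    have "(\<integral>\<^sup>+t\<in>{0..}. indicator {..<h x} t \<partial>lborel) = (\<integral>\<^sup>+t. indicator {0..<h x} t \<partial>lborel)"
      by (intro nn_integral_cong) (auto simp: indicator_def)
    then show ?thesis
      by (cases "0 \<le> h x") (auto simp: ennreal_neg)
  qed
  then have "(\<integral>\<^sup>+x. ennreal (h x) \<partial>M) =
      (\<integral>\<^sup>+x. (\<integral>\<^sup>+t\<in>{0..}. indicator {..<h x} t \<partial>lborel) \<partial>M)" by simp
  also have "\<dots> = (\<integral>\<^sup>+t. (\<integral>\<^sup>+x. indicator {..<h x} t * indicator {0..} t \<partial>M) \<partial>lborel)"
    by (rule Fubini'[symmetric]) (simp add: indicator_def split_beta' of_bool_def if_distrib cong: if_cong)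
  also have "\<dots> = (\<integral>\<^sup>+t\<in>{0..}. emeasure M {x \<in> space M. t < h x} \<partial>lborel)"
  proof (intro nn_integral_cong)
    fix t :: real
    have "(\<integral>\<^sup>+x. indicator {..<h x} t * indicator {0..} t \<partial>M) =
        (\<integral>\<^sup>+x. indicator {x \<in> space M. t < h x} x * indicator {0..} t \<partial>M)"
      by (intro nn_integral_cong) (auto simp: indicator_def)
    also have "\<dots> = emeasure M {x \<in> space M. t < h x} * indicator {0..} t"
      by (subst nn_integral_multc) auto
    finally show "(\<integral>\<^sup>+x. indicator {..<h x} t * indicator {0..} t \<partial>M) =
        emeasure M {x \<in> space M. t < h x} * indicator {0..} t" .
  qed
  finally show "(\<integral>\<^sup>+x. ennreal (h x) \<partial>M) =
    (\<integral>\<^sup>+t\<in>{0::real..}. emeasure M {x \<in> space M. t < h x} \<partial>lborel)" .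
qed

definition balls :: "'a::metric_space set set" where
  "balls = {ball x r | x r. True}"

text \<open>Integrands are controlled only at points of \<open>E\<close>, hence
  \<open>AE_\<mu>\<close>. The assumption \<open>mass\<close> does not follow from
  \<open>balls\<close>: finite unions of balls are bounded, so mass could escape to infinity. It is
  what converts bounds for \<open>C + k\<close> into bounds for \<open>k\<close>.\<close>

locale ball_convergence =
  fixes E :: "'a::euclidean_space set" and \<mu> :: "nat \<Rightarrow> 'a measure" and \<nu> :: "'a measure"
  assumes E[measurable]: "E \<in> sets borel"
    and sets_\<mu> [simp, measurable_cong]: "sets (\<mu> n) = sets borel"
    and sets_\<nu> [simp, measurable_cong]: "sets \<nu> = sets borel"
    and finite_\<mu>: "finite_measure (\<mu> n)" and finite_\<nu>: "finite_measure \<nu>"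
    and AE_\<mu>: "AE z in \<mu> n. z \<in> E"
    and balls: "finite \<F> \<Longrightarrow> \<F> \<subseteq> balls \<Longrightarrow>
      (\<lambda>n. emeasure (\<mu> n) (\<Union>\<F>)) \<longlonglongrightarrow> emeasure \<nu> (\<Union>\<F>)"
    and mass: "(\<lambda>n. emeasure (\<mu> n) UNIV) \<longlonglongrightarrow> emeasure \<nu> UNIV"
begin

lemma space_eq [simp]: "space (\<mu> n) = UNIV" "space \<nu> = UNIV"
  using sets_eq_imp_space_eq[OF sets_\<mu>] sets_eq_imp_space_eq[OF sets_\<nu>] by auto

text \<open>Lindelof reduces the union to a countable one, its finite subunions exhaust it from
  below, and each of them has convergent mass dominated by that of the full union.\<close>

lemma emeasure_Union_balls_le_liminf:
  assumes "\<F> \<subseteq> balls"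
  shows "emeasure \<nu> (\<Union>\<F>) \<le> liminf (\<lambda>n. emeasure (\<mu> n) (\<Union>\<F>))"
proof -
  have op: "open S" if "S \<in> \<F>" for S using that assms by (auto simp: balls_def)
  then obtain \<G> where \<G>: "\<G> \<subseteq> \<F>" "countable \<G>" "\<Union>\<G> = \<Union>\<F>"
    using Lindelof[of \<F>] by metis
  show ?thesis
  proof (cases "\<G> = {}")
    case True
    then have "\<Union>\<F> = {}" using \<G>(3) by (metis Union_empty)
    then show ?thesis by (simp only: emeasure_empty zero_le)
  next
    case False
    define B where "B k = from_nat_into \<G> ` {..k}" for k :: nat
    have B: "finite (B k)" "B k \<subseteq> \<G>" for k
      using from_nat_into[OF False] by (auto simp: B_def)
    have "(\<Union>k. \<Union>(B k)) = \<Union>(range (from_nat_into \<G>))" by (auto simp: B_def)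
    also have "\<dots> = \<Union>\<F>" using \<G> False by (simp add: range_from_nat_into)
    finally have un: "(\<Union>k. \<Union>(B k)) = \<Union>\<F>" .
    have opB: "open (\<Union>(B k))" for k using B(2)[of k] \<G>(1) op by (intro open_Union) auto
    have "emeasure \<nu> (\<Union>\<F>) = (SUP k. emeasure \<nu> (\<Union>(B k)))"
      unfolding un[symmetric]
      by (rule SUP_emeasure_incseq[symmetric]) (use opB in \<open>fastforce simp: B_def incseq_def\<close>)+
    also have "\<dots> \<le> liminf (\<lambda>n. emeasure (\<mu> n) (\<Union>\<F>))"
    proof (rule SUP_least)
      fix k
      have "emeasure \<nu> (\<Union>(B k)) = liminf (\<lambda>n. emeasure (\<mu> n) (\<Union>(B k)))"
        using lim_imp_Liminf[OF _ balls[OF B(1)[of k]]] B(2) \<G>(1) assms by (metis subset_trans trivial_limit_sequentially)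
      also have "\<dots> \<le> liminf (\<lambda>n. emeasure (\<mu> n) (\<Union>\<F>))"
        by (intro Liminf_mono always_eventually allI emeasure_mono) (use un op in \<open>auto intro!: borel_open open_Union\<close>)
      finally show "emeasure \<nu> (\<Union>(B k)) \<le> liminf (\<lambda>n. emeasure (\<mu> n) (\<Union>\<F>))" .
    qed
    finally show ?thesis .
  qed
qed

text \<open>At a point with \<open>t < h' z\<close>, continuous convergence yields one ball around
  \<open>z\<close> and one index \<open>N\<close> such that \<open>h n\<close> exceeds
  \<open>t\<close> on the part of the ball in \<open>E\<close> for all \<open>n \<ge> N\<close>. So
  the superlevel set of \<open>h'\<close> is covered, up to a null set, by an increasing union of
  open sets, the \<open>N\<close>-th of which lies in the superlevel set of \<open>h n\<close> for
  \<open>n \<ge> N\<close>, again up to a null set.\<close>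

lemma emeasure_superlevel_le_liminf:
  fixes h :: "nat \<Rightarrow> 'a \<Rightarrow> real" and h' :: "'a \<Rightarrow> real"
  assumes [measurable]: "\<And>n. h n \<in> borel_measurable borel" "h' \<in> borel_measurable borel"
    and conv: "AE z in \<nu>. ((\<lambda>(n, y). h n y) \<longlongrightarrow> h' z) (sequentially \<times>\<^sub>F inf (nhds z) (principal E))"
  shows "emeasure \<nu> {z. t < h' z} \<le> liminf (\<lambda>n. emeasure (\<mu> n) {z. t < h n z})"
proof -
  define \<F> where "\<F> N = {ball x r | x r. \<forall>n\<ge>N. \<forall>y\<in>ball x r \<inter> E. t < h n y}" for N :: nat
  have \<F>: "\<F> N \<subseteq> balls" for N by (auto simp: \<F>_def balls_def)
  have op: "open (\<Union>(\<F> N))" for N by (auto simp: \<F>_def)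
  have inc: "incseq (\<lambda>N. \<Union>(\<F> N))"
    unfolding incseq_def
  proof (intro allI impI Union_mono subsetI)
    fix m n S assume "m \<le> n" "S \<in> \<F> m"
    then obtain x r where "S = ball x r" "\<forall>k\<ge>m. \<forall>y\<in>ball x r \<inter> E. t < h k y"
      by (auto simp: \<F>_def)
    with \<open>m \<le> n\<close> show "S \<in> \<F> n"
      unfolding \<F>_def by (intro CollectI exI[of _ x] exI[of _ r]) auto
  qed
  have "emeasure \<nu> {z. t < h' z} \<le> emeasure \<nu> (\<Union>N. \<Union>(\<F> N))"
  proof (rule emeasure_mono_AE)
    show "(\<Union>N. \<Union>(\<F> N)) \<in> sets \<nu>" using op by (auto intro!: borel_open)
    show "AE z in \<nu>. z \<in> {z. t < h' z} \<longrightarrow> z \<in> (\<Union>N. \<Union>(\<F> N))"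
      using conv
    proof eventually_elim
      case (elim z)
      show ?case
      proof
        assume "z \<in> {z. t < h' z}"
        then have "\<forall>\<^sub>F p in sequentially \<times>\<^sub>F inf (nhds z) (principal E). t < (case p of (n, y) \<Rightarrow> h n y)"
          using order_tendstoD(1)[OF elim] by simp
        then obtain Pf Pg where P: "eventually Pf sequentially" "eventually Pg (inf (nhds z) (principal E))"
          "\<And>n y. Pf n \<Longrightarrow> Pg y \<Longrightarrow> t < h n y"
          unfolding eventually_prod_filter by auto
        obtain N where N: "\<And>n. n \<ge> N \<Longrightarrow> Pf n" using P(1) by (auto simp: eventually_sequentially)
        obtain d where d: "d > 0" "\<And>y. dist y z < d \<Longrightarrow> y \<in> E \<Longrightarrow> Pg y"
          using P(2) by (auto simp: eventually_inf_principal eventually_nhds_metric)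
        have "ball z d \<in> \<F> N"
          using N d P(3) unfolding \<F>_def
          by (intro CollectI exI[of _ z] exI[of _ d]) (auto simp: dist_commute)
        then show "z \<in> (\<Union>N. \<Union>(\<F> N))" using d(1) centre_in_ball by blast
      qed
    qed
  qed
  also have "\<dots> = (SUP N. emeasure \<nu> (\<Union>(\<F> N)))"
    by (rule SUP_emeasure_incseq[symmetric, OF _ inc]) (use op in \<open>auto intro!: borel_open\<close>)
  also have "\<dots> \<le> liminf (\<lambda>n. emeasure (\<mu> n) {z. t < h n z})"
  proof (rule SUP_least)
    fix N
    have "emeasure \<nu> (\<Union>(\<F> N)) \<le> liminf (\<lambda>n. emeasure (\<mu> n) (\<Union>(\<F> N)))"
      by (rule emeasure_Union_balls_le_liminf[OF \<F>])
    also have "\<dots> \<le> liminf (\<lambda>n. emeasure (\<mu> n) {z. t < h n z})"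
    proof (rule Liminf_mono)
      show "\<forall>\<^sub>F n in sequentially. emeasure (\<mu> n) (\<Union>(\<F> N)) \<le> emeasure (\<mu> n) {z. t < h n z}"
        using eventually_ge_at_top[of N]
      proof eventually_elim
        case (elim n)
        show ?case
        proof (rule emeasure_mono_AE)
          show "AE z in \<mu> n. z \<in> \<Union>(\<F> N) \<longrightarrow> z \<in> {z. t < h n z}"
            using AE_\<mu>[of n] by eventually_elim (use elim in \<open>auto simp: \<F>_def\<close>)
          have "{z \<in> space borel. t < h n z} \<in> sets borel" by measurable
          then show "{z. t < h n z} \<in> sets (\<mu> n)" by simp
        qed
      qed
    qed
    finally show "emeasure \<nu> (\<Union>(\<F> N)) \<le> liminf (\<lambda>n. emeasure (\<mu> n) {z. t < h n z})" .
  qed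
  finally show ?thesis .
qed

lemma nn_integral_le_liminf:
  fixes h :: "nat \<Rightarrow> 'a \<Rightarrow> real" and h' :: "'a \<Rightarrow> real"
  assumes [measurable]: "\<And>n. h n \<in> borel_measurable borel" "h' \<in> borel_measurable borel"
    and conv: "AE z in \<nu>. ((\<lambda>(n, y). h n y) \<longlongrightarrow> h' z) (sequentially \<times>\<^sub>F inf (nhds z) (principal E))"
  shows "(\<integral>\<^sup>+z. ennreal (h' z) \<partial>\<nu>) \<le> liminf (\<lambda>n. \<integral>\<^sup>+z. ennreal (h n z) \<partial>\<mu> n)"
proof -
  have sf: "sigma_finite_measure (\<mu> n)" "sigma_finite_measure \<nu>" for n
    using finite_\<mu>[of n] finite_\<nu> by (auto simp: finite_measure_def)
  have h: "h n \<in> borel_measurable (\<mu> n)" "h' \<in> borel_measurable \<nu>" for n by measurable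
  have [measurable]: "(\<lambda>t. emeasure (\<mu> n) {z. t < h n z}) \<in> borel_measurable borel" for n
    using nn_integral_layer_cake(2)[OF sf(1) h(1)[of n]] by simp
  have "(\<integral>\<^sup>+z. ennreal (h' z) \<partial>\<nu>) = (\<integral>\<^sup>+t\<in>{0::real..}. emeasure \<nu> {z. t < h' z} \<partial>lborel)"
    using nn_integral_layer_cake(1)[OF sf(2) h(2)] by simp
  also have "\<dots> \<le> (\<integral>\<^sup>+t. liminf (\<lambda>n. emeasure (\<mu> n) {z. t < h n z} * indicator {0..} t) \<partial>lborel)"
    using emeasure_superlevel_le_liminf[OF assms]
    by (intro nn_integral_mono) (auto simp: indicator_def)
  also have "\<dots> \<le> liminf (\<lambda>n. \<integral>\<^sup>+t\<in>{0::real..}. emeasure (\<mu> n) {z. t < h n z} \<partial>lborel)"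
    by (rule nn_integral_liminf) measurable
  also have "\<dots> = liminf (\<lambda>n. \<integral>\<^sup>+z. ennreal (h n z) \<partial>\<mu> n)"
    using nn_integral_layer_cake(1)[OF sf(1) h(1)] by simp
  finally show ?thesis .
qed

lemma measure_mass: "(\<lambda>n. measure (\<mu> n) UNIV) \<longlonglongrightarrow> measure \<nu> UNIV"
proof -
  interpret finite_measure \<nu> by (rule finite_\<nu>)
  have "(\<lambda>n. enn2real (emeasure (\<mu> n) UNIV)) \<longlonglongrightarrow> measure \<nu> UNIV"
    by (rule tendsto_enn2real) (use mass emeasure_eq_measure[of UNIV] in auto)
  then show ?thesis by (simp add: measure_def)
qed

text \<open>Adding \<open>C\<close> makes the integrands nonnegative, so the Fatou inequality
  applies; the added terms \<open>C\<close> times the total mass converge and can be subtracted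
  again.\<close>

lemma eventually_integral_gt:
  fixes k :: "nat \<Rightarrow> 'a \<Rightarrow> real" and k' :: "'a \<Rightarrow> real"
  assumes [measurable]: "\<And>n. k n \<in> borel_measurable borel" "k' \<in> borel_measurable borel"
    and bnd: "\<And>n z. \<bar>k n z\<bar> \<le> C" "\<And>z. \<bar>k' z\<bar> \<le> C"
    and conv: "AE z in \<nu>. ((\<lambda>(n, y). k n y) \<longlongrightarrow> k' z) (sequentially \<times>\<^sub>F inf (nhds z) (principal E))"
    and a: "a < (\<integral>z. k' z \<partial>\<nu>)"
  shows "\<forall>\<^sub>F n in sequentially. a < (\<integral>z. k n z \<partial>\<mu> n)"
proof -
  have C: "C \<ge> 0" using order_trans[OF abs_ge_zero bnd(2)] .
  have int: "(\<integral>\<^sup>+z. ennreal (C + g z) \<partial>\<mu>) = ennreal (C * measure \<mu> UNIV + (\<integral>z. g z \<partial>\<mu>)) \<and>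
      C * measure \<mu> UNIV + (\<integral>z. g z \<partial>\<mu>) \<ge> 0"
    if "finite_measure \<mu>" "sets \<mu> = sets borel" "g \<in> borel_measurable borel" "\<And>z. \<bar>g z\<bar> \<le> C"
    for \<mu> :: "'a measure" and g
  proof -
    interpret finite_measure \<mu> by fact
    have sp: "space \<mu> = UNIV" using sets_eq_imp_space_eq[OF that(2)] by simp
    have [measurable]: "g \<in> borel_measurable \<mu>" using that(2,3) by simp
    have g: "integrable \<mu> g" by (rule integrable_const_bound[of _ C]) (use that(4) in auto)
    have nn: "C + g z \<ge> 0" for z using that(4)[of z] by auto
    have eq: "(\<integral>z. C + g z \<partial>\<mu>) = C * measure \<mu> UNIV + (\<integral>z. g z \<partial>\<mu>)"
      using g by (simp add: sp)
    have "(\<integral>\<^sup>+z. ennreal (C + g z) \<partial>\<mu>) = ennreal (\<integral>z. C + g z \<partial>\<mu>)"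
      by (rule nn_integral_eq_integral) (use g nn in auto)
    moreover have "(\<integral>z. C + g z \<partial>\<mu>) \<ge> 0" by (rule integral_nonneg_AE) (use nn in auto)
    ultimately show ?thesis unfolding eq by simp
  qed
  have k': "(\<integral>\<^sup>+z. ennreal (C + k' z) \<partial>\<nu>) = ennreal (C * measure \<nu> UNIV + (\<integral>z. k' z \<partial>\<nu>)) \<and>
      C * measure \<nu> UNIV + (\<integral>z. k' z \<partial>\<nu>) \<ge> 0"
    by (rule int) (use finite_\<nu> bnd in auto)
  have k: "(\<integral>\<^sup>+z. ennreal (C + k n z) \<partial>\<mu> n) = ennreal (C * measure (\<mu> n) UNIV + (\<integral>z. k n z \<partial>\<mu> n)) \<and>
      C * measure (\<mu> n) UNIV + (\<integral>z. k n z \<partial>\<mu> n) \<ge> 0" for n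
    by (rule int) (use finite_\<mu> bnd in auto)
  \<comment> \<open>Half of the gap is spent on the Fatou inequality and half on the convergence of
    the total masses.\<close>
  define d where "d = ((\<integral>z. k' z \<partial>\<nu>) - a) / 2"
  have d: "d > 0" using a by (simp add: d_def)
  have shifted: "\<forall>\<^sub>F n in sequentially. C * measure \<nu> UNIV + (\<integral>z. k' z \<partial>\<nu>) - d <
      C * measure (\<mu> n) UNIV + (\<integral>z. k n z \<partial>\<mu> n)"
  \<comment> \<open>A negative bound would be truncated by \<open>ennreal\<close>, but then
    nonnegativity of the shifted integrals is already enough.\<close>
  proof (cases "C * measure \<nu> UNIV + (\<integral>z. k' z \<partial>\<nu>) - d < 0")
    case True
    then show ?thesis using k by (intro always_eventually allI) (meson less_le_trans)
  next
    case False
    have "AE z in \<nu>. ((\<lambda>(n, y). C + k n y) \<longlongrightarrow> C + k' z) (sequentially \<times>\<^sub>F inf (nhds z) (principal E))"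
      using conv by eventually_elim (auto simp: split_beta' intro!: tendsto_intros)
    then have "(\<integral>\<^sup>+z. ennreal (C + k' z) \<partial>\<nu>) \<le> liminf (\<lambda>n. \<integral>\<^sup>+z. ennreal (C + k n z) \<partial>\<mu> n)"
      by (intro nn_integral_le_liminf) auto
    moreover have "ennreal (C * measure \<nu> UNIV + (\<integral>z. k' z \<partial>\<nu>) - d) < (\<integral>\<^sup>+z. ennreal (C + k' z) \<partial>\<nu>)"
      using k' d False by (auto simp: ennreal_less_iff)
    ultimately have "ennreal (C * measure \<nu> UNIV + (\<integral>z. k' z \<partial>\<nu>) - d) < liminf (\<lambda>n. \<integral>\<^sup>+z. ennreal (C + k n z) \<partial>\<mu> n)"
      by simp
    from less_LiminfD[OF this] show ?thesis
      by eventually_elim (use k False in \<open>auto simp: ennreal_less_iff\<close>)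
  qed
  have "(\<lambda>n. C * measure (\<mu> n) UNIV) \<longlonglongrightarrow> C * measure \<nu> UNIV"
    by (intro tendsto_intros measure_mass)
  then have "\<forall>\<^sub>F n in sequentially. C * measure (\<mu> n) UNIV < C * measure \<nu> UNIV + d"
    by (rule order_tendstoD) (use d in auto)
  with shifted show ?thesis
    by eventually_elim (auto simp: d_def field_simps)
qed

lemma integral_tendsto:
  fixes k :: "nat \<Rightarrow> 'a \<Rightarrow> real" and k' :: "'a \<Rightarrow> real"
  assumes [measurable]: "\<And>n. k n \<in> borel_measurable borel" "k' \<in> borel_measurable borel"
    and bnd: "\<And>n z. \<bar>k n z\<bar> \<le> C" "\<And>z. \<bar>k' z\<bar> \<le> C"
    and conv: "AE z in \<nu>. ((\<lambda>(n, y). k n y) \<longlongrightarrow> k' z) (sequentially \<times>\<^sub>F inf (nhds z) (principal E))"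
  shows "(\<lambda>n. \<integral>z. k n z \<partial>\<mu> n) \<longlonglongrightarrow> (\<integral>z. k' z \<partial>\<nu>)"
proof (rule order_tendstoI)
  fix a assume "a < (\<integral>z. k' z \<partial>\<nu>)"
  then show "\<forall>\<^sub>F n in sequentially. a < (\<integral>z. k n z \<partial>\<mu> n)"
    by (rule eventually_integral_gt[OF assms])
next
  fix a assume "(\<integral>z. k' z \<partial>\<nu>) < a"
  moreover have "AE z in \<nu>. ((\<lambda>(n, y). - k n y) \<longlongrightarrow> - k' z) (sequentially \<times>\<^sub>F inf (nhds z) (principal E))"
    using conv by eventually_elim (auto simp: split_beta' intro!: tendsto_intros)
  ultimately have "\<forall>\<^sub>F n in sequentially. - a < (\<integral>z. - k n z \<partial>\<mu> n)"
    using bnd by (intro eventually_integral_gt[of _ "\<lambda>z. - k' z" C]) auto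
  then show "\<forall>\<^sub>F n in sequentially. (\<integral>z. k n z \<partial>\<mu> n) < a" by simp
qed

end


section \<open>Continuous convergence and conditional laws\<close>

text \<open>If convergence along the product filter failed, there would be arbitrarily late
  parameters and points of \<open>E\<close> arbitrarily near \<open>z\<close> with
  \<open>F t y\<close> outside a fixed neighbourhood of \<open>l\<close>. A sequence of these is
  threaded by one curve that tends to \<open>z\<close>, contradicting \<open>along\<close>.\<close>

lemma continuous_convergenceI:
  fixes F :: "real \<Rightarrow> 'a::metric_space \<Rightarrow> 'b::topological_space"
  assumes "z \<in> E"
    and along: "\<And>y. (\<And>t. y t \<in> E) \<Longrightarrow> (y \<longlongrightarrow> z) at_top \<Longrightarrow> ((\<lambda>t. F t (y t)) \<longlongrightarrow> l) at_top"
  shows "((\<lambda>(t, y). F t y) \<longlongrightarrow> l) (at_top \<times>\<^sub>F inf (nhds z) (principal E))"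
proof (rule topological_tendstoI, rule ccontr)
  fix S assume S: "open S" "l \<in> S"
    and neg: "\<not> (\<forall>\<^sub>F p in at_top \<times>\<^sub>F inf (nhds z) (principal E). (case p of (t, y) \<Rightarrow> F t y) \<in> S)"
  have bad: "\<exists>p. fst p \<ge> a \<and> dist (snd p) z < e \<and> snd p \<in> E \<and> F (fst p) (snd p) \<notin> S"
    if "e > 0" for a e
  proof (rule ccontr)
    assume "\<not> ?thesis"
    then have "\<And>t y. t \<ge> a \<Longrightarrow> dist y z < e \<and> y \<in> E \<Longrightarrow> F t y \<in> S" by force
    moreover have "\<forall>\<^sub>F t in at_top. t \<ge> a" by (rule eventually_ge_at_top)
    moreover have "\<forall>\<^sub>F y in inf (nhds z) (principal E). dist y z < e \<and> y \<in> E"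
      using that by (auto simp: eventually_inf_principal eventually_nhds_metric)
    ultimately have "\<forall>\<^sub>F p in at_top \<times>\<^sub>F inf (nhds z) (principal E). (case p of (t, y) \<Rightarrow> F t y) \<in> S"
      unfolding eventually_prod_filter by fastforce
    then show False using neg by simp
  qed
  define P where "P n p \<longleftrightarrow> fst p \<ge> real n \<and> dist (snd p) z < inverse (Suc n) \<and> snd p \<in> E \<and>
    F (fst p) (snd p) \<notin> S" for n p
  have "\<exists>w. \<forall>n. P n (w n) \<and> fst (w n) < fst (w (Suc n))"
  proof (rule dependent_nat_choice)
    show "\<exists>p. P 0 p" using bad[of 1 0] by (simp add: P_def)
    fix p n
    show "\<exists>q. P (Suc n) q \<and> fst p < fst q"
      \<comment> \<open>The bound \<open>fst p + 1\<close> makes the chosen parameters strictly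
        increasing; each is then used once, so a curve can pass through all the chosen
        points.\<close>
      using bad[of "inverse (Suc (Suc n))" "max (Suc n) (fst p + 1)"] by (force simp: P_def)
  qed
  then obtain w where w: "\<And>n. P n (w n)" "\<And>n. fst (w n) < fst (w (Suc n))" by auto
  define u where "u n = fst (w n)" for n
  have mono: "strict_mono u" using w(2) by (simp add: strict_mono_Suc_iff u_def)
  \<comment> \<open>At the chosen parameters the curve visits the bad points; at all others it rests
    at \<open>z\<close>, which keeps it in \<open>E\<close> and leaves its limit unchanged.\<close>
  define y where "y t = (if t \<in> range u then snd (w (inv u t)) else z)" for t
  have yu: "y (u n) = snd (w n)" for n
    by (simp add: y_def inv_f_f strict_mono_imp_inj_on[OF mono])
  have yE: "y t \<in> E" for t using w(1) \<open>z \<in> E\<close> by (auto simp: y_def P_def)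
  have "(y \<longlongrightarrow> z) at_top"
  proof (rule tendstoI)
    fix e :: real assume "e > 0"
    then obtain N where N: "inverse (Suc N) < e" using reals_Archimedean by auto
    show "\<forall>\<^sub>F t in at_top. dist (y t) z < e" using eventually_ge_at_top[of "u N"]
    proof eventually_elim
      case (elim t)
      show ?case
      proof (cases "t \<in> range u")
        case True
        then obtain n where n: "t = u n" by auto
        then have "n \<ge> N" using elim strict_mono_less_eq[OF mono] by simp
        then have le: "inverse (real (Suc n)) \<le> inverse (real (Suc N))" by (intro le_imp_inverse_le) auto
        have "dist (snd (w n)) z < inverse (real (Suc n))" using w(1)[of n] by (simp only: P_def)
        then have "dist (snd (w n)) z < e" using le N by (rule order.strict_trans2[THEN order.strict_trans])
        then show ?thesis using yu[of n] n by (simp only:)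
      qed (use \<open>e > 0\<close> in \<open>auto simp: y_def\<close>)
    qed
  qed
  from along[OF yE this] S have "\<forall>\<^sub>F t in at_top. F t (y t) \<in> S" by (rule topological_tendstoD)
  moreover have "filterlim u at_top sequentially"
    by (rule filterlim_at_top_mono[OF filterlim_real_sequentially])
       (use w(1) in \<open>auto simp: u_def P_def\<close>)
  ultimately have "\<forall>\<^sub>F n in sequentially. F (u n) (y (u n)) \<in> S"
    by (rule eventually_compose_filterlim)
  from eventually_happens'[OF sequentially_bot this] obtain n where "F (u n) (y (u n)) \<in> S" ..
  then show False using w(1)[of n] by (simp add: yu) (simp add: P_def u_def)
qed

text \<open>One estimate of \<open>dist (F t y) (l z)\<close> holds for all large \<open>t\<close>
  and all \<open>y\<close> near \<open>z\<close>. Fixing \<open>y\<close> and letting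
  \<open>t\<close> tend to infinity replaces \<open>F t y\<close> by \<open>l y\<close>.\<close>

lemma continuous_convergence_imp_continuous_on:
  fixes F :: "real \<Rightarrow> 'a::metric_space \<Rightarrow> 'b::metric_space"
  assumes conv: "\<And>z. z \<in> E \<Longrightarrow> ((\<lambda>(t, y). F t y) \<longlongrightarrow> l z) (at_top \<times>\<^sub>F inf (nhds z) (principal E))"
  shows "continuous_on E l"
  unfolding continuous_on_def
proof (intro ballI tendstoI)
  fix z and e :: real assume z: "z \<in> E" and e: "e > 0"
  have "\<forall>\<^sub>F p in at_top \<times>\<^sub>F inf (nhds z) (principal E). dist (case p of (t, y) \<Rightarrow> F t y) (l z) < e / 2"
    using tendstoD[OF conv[OF z], of "e / 2"] e by simp
  then obtain Pf Pg where P: "eventually Pf at_top" "eventually Pg (inf (nhds z) (principal E))"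
    "\<And>t y. Pf t \<Longrightarrow> Pg y \<Longrightarrow> dist (F t y) (l z) < e / 2"
    unfolding eventually_prod_filter by auto
  have near: "dist (l y) (l z) \<le> e / 2" if y: "y \<in> E" "Pg y" for y
  proof -
    have "filterlim (\<lambda>t. (t, y)) (at_top \<times>\<^sub>F inf (nhds y) (principal E)) at_top"
    proof (rule filterlim_Pair[OF filterlim_ident])
      show "filterlim (\<lambda>t. y) (inf (nhds y) (principal E)) at_top"
        using y(1) by (auto simp: filterlim_inf filterlim_principal)
    qed
    from filterlim_compose[OF conv[OF y(1)] this]
    have "((\<lambda>t. F t y) \<longlongrightarrow> l y) at_top" by simp
    then have "((\<lambda>t. dist (F t y) (l z)) \<longlongrightarrow> dist (l y) (l z)) at_top"
      by (intro tendsto_intros)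
    then show ?thesis
    proof (rule tendsto_upperbound)
      show "\<forall>\<^sub>F t in at_top. dist (F t y) (l z) \<le> e / 2"
        using P(1) by eventually_elim (use P(3)[OF _ y(2)] in fastforce)
    qed simp
  qed
  show "\<forall>\<^sub>F y in at z within E. dist (l y) (l z) < e"
  proof -
    have "at z within E \<le> inf (nhds z) (principal E)"
      unfolding at_within_def by (rule inf_mono) auto
    then have "eventually Pg (at z within E)" using P(2) by (rule filter_leD)
    moreover have "\<forall>\<^sub>F y in at z within E. y \<in> E" by (simp add: eventually_at_filter)
    ultimately show ?thesis by eventually_elim (use near e in fastforce)
  qed
qed

lemma measurable_vec_lambda:
  fixes f :: "'a \<Rightarrow> 'k::finite \<Rightarrow> real"
  assumes "\<And>j. (\<lambda>x. f x j) \<in> borel_measurable M"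
  shows "(\<lambda>x. \<chi> j. f x j) \<in> borel_measurable M"
proof (rule borel_measurable_euclidean_space[THEN iffD2], rule ballI)
  fix b :: "real ^ 'k" assume "b \<in> Basis"
  then obtain j where "b = axis j 1" unfolding Basis_vec_def by force
  then have "(\<lambda>x. (\<chi> j. f x j) \<bullet> b) = (\<lambda>x. f x j)" by (simp add: inner_axis)
  then show "(\<lambda>x. (\<chi> j. f x j) \<bullet> b) \<in> borel_measurable M" using assms by simp
qed

section \<open>Conditional laws and null frontiers\<close>

lemma integral_uniform_measure:
  fixes h :: "'a \<Rightarrow> real"
  assumes [measurable]: "A \<in> sets M" "h \<in> borel_measurable M"
    and fin: "emeasure M A \<noteq> 0" "emeasure M A \<noteq> \<infinity>"
  shows "(\<integral>x. h x \<partial>uniform_measure M A) = (\<integral>x. indicator A x * h x \<partial>M) / measure M A"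
proof -
  have pos: "measure M A > 0"
    using fin by (simp add: measure_def enn2real_positive_iff less_top zero_less_iff_neq_zero)
  have "uniform_measure M A = density M (\<lambda>x. ennreal (indicator A x / measure M A))"
    unfolding uniform_measure_def
  proof (rule density_cong)
    show "AE x in M. indicator A x / emeasure M A = ennreal (indicator A x / measure M A)"
      using divide_ennreal[of 1 "measure M A"] fin(2) pos
      by (simp add: emeasure_eq_ennreal_measure indicator_def)
  qed auto
  then have "(\<integral>x. h x \<partial>uniform_measure M A) = (\<integral>x. (indicator A x / measure M A) *\<^sub>R h x \<partial>M)"
    by (simp only:) (rule integral_density, use pos in auto)
  also have "\<dots> = (\<integral>x. (indicator A x * h x) / measure M A \<partial>M)" by (simp add: field_simps)
  finally show ?thesis by simp
qed

text \<open>The ratio form involves the unconditional law of the scaled vector only, so numerator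
  and denominator can both be multiplied by \<open>u powr s\<close> and treated by the same limit
  theorem.\<close>

lemma conditional_scaled_law:
  fixes X :: "'w \<Rightarrow> 'a::euclidean_space" and h :: "'a \<Rightarrow> real"
  assumes "prob_space M" and [measurable]: "X \<in> borel_measurable M" "S \<in> sets borel" "E \<in> sets borel"
    and S: "S \<subseteq> E" and cone: "cone E" and u: "u > 0"
    and pos: "measure M {\<omega> \<in> space M. X \<omega> \<in> S} > 0"
    and h: "h \<in> borel_measurable (restrict_space borel E)"
  shows "prob_space (conditional_scaled_law E M X S u)"
    and "(\<integral>z. h z \<partial>conditional_scaled_law E M X S u) =
      (\<integral>z. indicator {z. u *\<^sub>R z \<in> S} z * h z \<partial>distr M borel (\<lambda>\<omega>. X \<omega> /\<^sub>R u))
        / measure (distr M borel (\<lambda>\<omega>. X \<omega> /\<^sub>R u)) {z. u *\<^sub>R z \<in> S}"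
proof -
  interpret prob_space M by fact
  define A where "A = {\<omega> \<in> space M. X \<omega> \<in> S}"
  define Q where "Q = uniform_measure M A"
  have [measurable]: "A \<in> sets M" unfolding A_def by measurable
  have A: "emeasure M A \<noteq> 0" "emeasure M A \<noteq> \<infinity>" using pos by (auto simp: emeasure_eq_measure A_def)
  interpret Q: prob_space Q unfolding Q_def by (rule prob_space_uniform_measure[OF A])
  have [measurable]: "X \<in> borel_measurable Q" by (simp add: Q_def)
  \<comment> \<open>\<open>h\<close> is measurable only on \<open>E\<close>; the indicator extends
    it to the whole space, and it disappears later because the conditioning set lies in
    \<open>E\<close>.\<close>
  have hE: "(\<lambda>z. indicator E z *\<^sub>R h z) \<in> borel_measurable borel"
    using h by (subst (asm) borel_measurable_restrict_space_iff) auto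
  interpret D: prob_space "distr Q borel (\<lambda>\<omega>. X \<omega> /\<^sub>R u)" by (rule Q.prob_space_distr) measurable
  have "AE \<omega> in Q. X \<omega> /\<^sub>R u \<in> E"
    unfolding Q_def
  proof (rule AE_uniform_measureI)
    show "AE \<omega> in M. \<omega> \<in> A \<longrightarrow> X \<omega> /\<^sub>R u \<in> E"
      using S u cone_scaleR_iff[OF cone, of "inverse u"] by (auto simp: A_def)
  qed simp
  then have "AE z in distr Q borel (\<lambda>\<omega>. X \<omega> /\<^sub>R u). z \<in> E"
    by (subst AE_distr_iff) auto
  then show "prob_space (conditional_scaled_law E M X S u)"
    unfolding conditional_scaled_law_def A_def[symmetric] Q_def[symmetric]
    by (intro prob_space_restrict_space D.emeasure_eq_1_AE) simp_all
  have pre: "{\<omega> \<in> space M. X \<omega> /\<^sub>R u \<in> {z. u *\<^sub>R z \<in> S}} = A" using u by (auto simp: A_def)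
  have [measurable]: "{z. u *\<^sub>R z \<in> S} \<in> sets borel" by measurable
  have sub: "u *\<^sub>R z \<in> S \<Longrightarrow> z \<in> E" for z
    using S u cone_scaleR_iff[OF cone u] by auto
  have "(\<integral>z. h z \<partial>conditional_scaled_law E M X S u) =
      (\<integral>z. indicator E z *\<^sub>R h z \<partial>distr Q borel (\<lambda>\<omega>. X \<omega> /\<^sub>R u))"
    unfolding conditional_scaled_law_def A_def[symmetric] Q_def[symmetric]
    by (rule integral_restrict_space) simp
  also have "\<dots> = (\<integral>\<omega>. indicator E (X \<omega> /\<^sub>R u) *\<^sub>R h (X \<omega> /\<^sub>R u) \<partial>Q)"
    by (rule integral_distr[OF _ hE]) measurable
  also have "\<dots> = (\<integral>\<omega>. indicator A \<omega> * (indicator E (X \<omega> /\<^sub>R u) *\<^sub>R h (X \<omega> /\<^sub>R u)) \<partial>M) / measure M A"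
    unfolding Q_def
    using A measurable_compose[of "\<lambda>\<omega>. X \<omega> /\<^sub>R u" M, OF _ hE]
    by (intro integral_uniform_measure) simp_all
  also have "(\<integral>\<omega>. indicator A \<omega> * (indicator E (X \<omega> /\<^sub>R u) *\<^sub>R h (X \<omega> /\<^sub>R u)) \<partial>M) =
      (\<integral>\<omega>. indicator {z. u *\<^sub>R z \<in> S} (X \<omega> /\<^sub>R u) * (indicator E (X \<omega> /\<^sub>R u) *\<^sub>R h (X \<omega> /\<^sub>R u)) \<partial>M)"
    using u by (intro Bochner_Integration.integral_cong) (auto simp: A_def indicator_def)
  also have "\<dots> = (\<integral>z. indicator {z. u *\<^sub>R z \<in> S} z * (indicator E z *\<^sub>R h z) \<partial>distr M borel (\<lambda>\<omega>. X \<omega> /\<^sub>R u))"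
  proof (rule integral_distr[symmetric])
    show "(\<lambda>z. indicator {z. u *\<^sub>R z \<in> S} z * (indicator E z *\<^sub>R h z)) \<in> borel_measurable borel"
      by (intro borel_measurable_times hE borel_measurable_indicator) simp
  qed measurable
  also have "\<dots> = (\<integral>z. indicator {z. u *\<^sub>R z \<in> S} z * h z \<partial>distr M borel (\<lambda>\<omega>. X \<omega> /\<^sub>R u))"
    using sub by (intro Bochner_Integration.integral_cong) (auto simp: indicator_def)
  also have "measure M A = measure (distr M borel (\<lambda>\<omega>. X \<omega> /\<^sub>R u)) {z. u *\<^sub>R z \<in> S}"
    by (subst measure_distr) (auto simp: pre[symmetric] vimage_def Int_def conj_commute)
  finally show "(\<integral>z. h z \<partial>conditional_scaled_law E M X S u) =
      (\<integral>z. indicator {z. u *\<^sub>R z \<in> S} z * h z \<partial>distr M borel (\<lambda>\<omega>. X \<omega> /\<^sub>R u))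
        / measure (distr M borel (\<lambda>\<omega>. X \<omega> /\<^sub>R u)) {z. u *\<^sub>R z \<in> S}" .
qed

text \<open>Convergence in \<open>M0\<close> takes frontiers inside \<open>E - {0}\<close>; this
  bounds them by frontiers in the whole space, where balls are known to have null frontier.\<close>

lemma frontier_of_subset_frontier:
  "top_of_set S frontier_of (S \<inter> T) \<subseteq> frontier T"
proof
  fix x assume x: "x \<in> top_of_set S frontier_of (S \<inter> T)"
  then have cl: "x \<in> S" "x \<in> closure T"
    using closure_mono[of "S \<inter> (S \<inter> T)" T]
    by (auto simp: frontier_of_def closure_of_subtopology)
  have "x \<notin> interior T"
  proof
    assume "x \<in> interior T"
    then have "S \<inter> interior T \<subseteq> top_of_set S interior_of (S \<inter> T)"
      by (intro interior_of_maximal) (use interior_subset in \<open>auto simp: openin_open\<close>)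
    then show False using x cl(1) \<open>x \<in> interior T\<close> by (auto simp: frontier_of_def)
  qed
  then show "x \<in> frontier T" using cl by (simp add: frontier_def)
qed

lemma negligible_frontier_balls:
  fixes \<F> :: "'a::euclidean_space set set"
  assumes "finite \<F>" "\<F> \<subseteq> balls"
  shows "negligible (frontier (\<Union>\<F>))"
  using assms
proof (induction rule: finite_induct)
  case (insert B \<F>)
  have "negligible (frontier B)"
    using insert.prems by (intro negligible_convex_frontier) (auto simp: balls_def)
  then have "negligible (frontier B \<union> frontier (\<Union>\<F>))" using insert by (intro negligible_Un) auto
  then show ?case
    using negligible_subset[OF _ frontier_Un_subset[of B "\<Union>\<F>"]] by simp
qed simp

context cone_tail
begin

lemma emeasure_tail_measure_negligible:
  assumes "negligible B"
  shows "emeasure (tail_measure E s \<phi>) B = 0"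
proof (cases "B \<in> sets (tail_measure E s \<phi>)")
  case True
  then have B: "B \<in> sets borel" "B \<subseteq> E - {0}" by (auto simp: sets_restrict_space_iff)
  then have "B \<in> null_sets lborel"
    using assms by (simp add: negligible_iff_null_sets null_sets_completion_iff)
  then show ?thesis unfolding emeasure_tail_measure[OF B] by (rule nn_integral_null_set)
\<comment> \<open>For sets outside the sigma-algebra \<open>emeasure\<close> is 0 by default, so
  measurability of frontiers need not be checked.\<close>
qed (rule emeasure_notin_sets)

text \<open>Passing to a measure on the whole space puts the limit on the same footing as the laws
  of random vectors.\<close>

lemma tail_measure_eq_density:
  "tail_measure E s \<phi> = restrict_space (density lborel tail_density) (E - {0})"
proof (rule measure_eqI)
  show "sets (tail_measure E s \<phi>) = sets (restrict_space (density lborel tail_density) (E - {0}))"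
    by simp (rule sets_restrict_space_cong, simp)
  fix B assume "B \<in> sets (tail_measure E s \<phi>)"
  then have B: "B \<in> sets borel" "B \<subseteq> E - {0}" by (auto simp: sets_restrict_space_iff)
  then show "emeasure (tail_measure E s \<phi>) B =
      emeasure (restrict_space (density lborel tail_density) (E - {0})) B"
    unfolding emeasure_tail_measure[OF B]
    by (subst emeasure_restrict_space) (auto simp: emeasure_density)
qed

end


section \<open>Stress summaries\<close>

locale stress_system = cone_tail E s \<phi> for E :: "'a::euclidean_space set" and s and \<phi> +
  fixes L Ls :: "'k::finite \<Rightarrow> 'a \<Rightarrow> real" and J :: "'k set"
  assumes loss: "asymptotically_homogeneous E L Ls"
    and J: "J \<noteq> {}" and regular: "emeasure lebesgue (limit_stress_set E Ls J) \<noteq> 0"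
begin

abbreviation near :: "'a \<Rightarrow> 'a filter" where
  "near z \<equiv> inf (nhds z) (principal E)"

lemma loss_along:
  assumes "z \<in> E" "\<And>t. y t \<in> E" "(y \<longlongrightarrow> z) at_top"
  shows "((\<lambda>t. L j (t *\<^sub>R y t) / t) \<longlongrightarrow> Ls j z) at_top"
  using loss assms unfolding asymptotically_homogeneous_def by blast

lemma loss_converges:
  assumes "z \<in> E"
  shows "((\<lambda>(u, y). L j (u *\<^sub>R y) / u) \<longlongrightarrow> Ls j z) (at_top \<times>\<^sub>F near z)"
  by (rule continuous_convergenceI[OF assms]) (rule loss_along[OF assms])

lemma loss_ray: "z \<in> E \<Longrightarrow> ((\<lambda>t. L j (t *\<^sub>R z) / t) \<longlongrightarrow> Ls j z) at_top"
  by (rule loss_along) auto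

lemma Ls_continuous: "continuous_on E (Ls j)"
  by (rule continuous_convergence_imp_continuous_on[OF loss_converges])

lemma Ls_homogeneous:
  assumes z: "z \<in> E" and c: "c > 0"
  shows "Ls j (c *\<^sub>R z) = c * Ls j z"
proof (rule tendsto_unique)
  show "((\<lambda>t. L j (t *\<^sub>R c *\<^sub>R z) / t) \<longlongrightarrow> Ls j (c *\<^sub>R z)) at_top"
    by (rule loss_ray) (use z c scaleR_mem_iff in auto)
  have "((\<lambda>t. L j ((t * c) *\<^sub>R z) / (t * c)) \<longlongrightarrow> Ls j z) at_top"
    by (rule filterlim_compose[OF loss_ray[OF z] filterlim_at_top_mult_tendsto_pos[OF tendsto_const c filterlim_ident]])
  from tendsto_mult[OF tendsto_const[of c] this]
  show "((\<lambda>t. L j (t *\<^sub>R c *\<^sub>R z) / t) \<longlongrightarrow> c * Ls j z) at_top" using c by simp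
qed simp

lemma zero_mem: "0 \<in> E"
  using loss cone_scaleR[OF cone, of _ 0] unfolding asymptotically_homogeneous_def by auto

lemma Ls_zero: "Ls j 0 = 0"
  using Ls_homogeneous[OF zero_mem, of 2 j] by simp

lemma negligible_level: "negligible {z \<in> E. Ls j z = 1}"
proof (rule starlike_negligible[where a = 0])
  show "closed {z \<in> E. Ls j z = 1}"
    by (rule continuous_closed_preimage_constant[OF Ls_continuous closed])
  fix c :: real and x :: 'a
  assume "0 + c *\<^sub>R x \<in> {z \<in> E. Ls j z = 1}" and "0 \<le> c" and "0 + x \<in> {z \<in> E. Ls j z = 1}"
  then show "c = 1"
    \<comment> \<open>The factor 0 is excluded because \<open>Ls j\<close> vanishes at the origin;
      otherwise homogeneity gives \<open>c = 1\<close> directly.\<close>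
    using Ls_homogeneous[of x c j] by (cases "c = 0") (auto simp: Ls_zero)
qed

section \<open>Measurability, location and mass of the stress sets\<close>

abbreviation limit_set :: "'a set" where
  "limit_set \<equiv> limit_stress_set E Ls J"

definition scaled_set :: "real \<Rightarrow> 'a set" where
  "scaled_set u = {z. u *\<^sub>R z \<in> stress_set E L u J}"

lemma mem_scaled_set:
  assumes "u > 0"
  shows "z \<in> scaled_set u \<longleftrightarrow> z \<in> E \<and> (\<forall>j\<in>J. L j (u *\<^sub>R z) / u \<ge> 1)"
  using assms by (simp add: scaled_set_def stress_set_def scaleR_mem_iff)

lemma measurable_L [measurable]: "L j \<in> borel_measurable (restrict_space borel E)"
  using loss by (simp add: asymptotically_homogeneous_def)

lemma stress_set_borel [measurable]: "stress_set E L u J \<in> sets borel"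
proof -
  have "{z \<in> space (restrict_space borel E). \<forall>j\<in>J. u \<le> L j z} \<in> sets (restrict_space borel E)"
    by measurable
  then show ?thesis by (simp add: stress_set_def sets_restrict_space_iff space_restrict_space)
qed

lemma scaled_set_borel [measurable]: "scaled_set u \<in> sets borel"
  unfolding scaled_set_def by measurable

lemma limit_set_borel [measurable]: "limit_set \<in> sets borel"
proof -
  have "limit_set = (\<Inter>j\<in>J. {z \<in> E. 1 \<le> Ls j z})"
    using J by (auto simp: limit_stress_set_def)
  moreover have "closed {z \<in> E. 1 \<le> Ls j z}" for j
    by (rule continuous_on_closed_Collect_le[OF continuous_on_const Ls_continuous closed])
  ultimately show ?thesis by (simp add: closed_INT)
qed

lemma measurable_scaled_loss:
  assumes "u > 0"
  shows "scaled_loss L u \<in> borel_measurable (restrict_space borel E)"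
proof -
  have "(\<lambda>z. u *\<^sub>R z) \<in> restrict_space borel E \<rightarrow>\<^sub>M restrict_space borel E"
    by (intro measurable_restrict_space2 measurable_restrict_space1)
       (use assms scaleR_mem_iff in \<open>auto simp: space_restrict_space\<close>)
  from measurable_compose[OF this measurable_L]
  show ?thesis unfolding scaled_loss_def by (intro measurable_vec_lambda borel_measurable_divide) auto
qed

lemma measurable_limit_loss: "limit_loss Ls \<in> borel_measurable (restrict_space borel E)"
  unfolding limit_loss_def
  by (intro measurable_vec_lambda borel_measurable_continuous_on_restrict Ls_continuous)

text \<open>\<open>Ls j\<close> vanishes at the origin, so by continuous convergence the scaled loss
  stays below 1 near the origin for all large \<open>u\<close>. This confines the whole problem to a
  region where the tail measure is finite.\<close>

lemma stress_sets_bounded_away: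
  obtains \<delta> U where "\<delta> > 0" "U > 0" "\<And>u z. u \<ge> U \<Longrightarrow> z \<in> scaled_set u \<Longrightarrow> norm z > \<delta>"
    "\<And>z. z \<in> limit_set \<Longrightarrow> norm z > \<delta>"
proof -
  obtain j where j: "j \<in> J" using J by auto
  \<comment> \<open>The value \<open>1 / 2\<close> leaves room below 1: for the limit set the strict
    bound becomes non-strict when \<open>u\<close> tends to infinity.\<close>
  have "\<forall>\<^sub>F p in at_top \<times>\<^sub>F near 0. (case p of (u, y) \<Rightarrow> L j (u *\<^sub>R y) / u) < 1 / 2"
    by (rule order_tendstoD(2)[OF loss_converges[OF zero_mem]]) (simp add: Ls_zero)
  then obtain Pf Pg where P: "eventually Pf at_top" "eventually Pg (near 0)"
    "\<And>u y. Pf u \<Longrightarrow> Pg y \<Longrightarrow> L j (u *\<^sub>R y) / u < 1 / 2"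
    unfolding eventually_prod_filter by auto
  obtain U where U: "\<And>u. u \<ge> U \<Longrightarrow> Pf u" using P(1) by (auto simp: eventually_at_top_linorder)
  obtain d where d: "d > 0" "\<And>y. norm y < d \<Longrightarrow> y \<in> E \<Longrightarrow> Pg y"
    using P(2) by (auto simp: eventually_inf_principal eventually_nhds_metric dist_norm)
  have small: "L j (u *\<^sub>R y) / u < 1 / 2" if "u \<ge> U" "norm y \<le> d / 2" "y \<in> E" for u y
    using P(3)[OF U d(2)] that d(1) by auto
  show ?thesis
  proof (rule that)
    show "d / 2 > 0" "max U 1 > 0" using d by auto
    show "norm z > d / 2" if "max U 1 \<le> u" "z \<in> scaled_set u" for u z
      using that small[of u z] j mem_scaled_set[of u z] by (force simp: not_le[symmetric])
    show "norm z > d / 2" if z: "z \<in> limit_set" for z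
    proof (rule ccontr)
      assume n: "\<not> norm z > d / 2"
      have zE: "z \<in> E" using z by (simp add: limit_stress_set_def)
      have "Ls j z \<le> 1 / 2"
      proof (rule tendsto_upperbound[OF loss_ray[OF zE]])
        show "\<forall>\<^sub>F u in at_top. L j (u *\<^sub>R z) / u \<le> 1 / 2"
          using eventually_ge_at_top[of U] by eventually_elim (use small n zE in force)
      qed simp
      then show False using z j by (force simp: limit_stress_set_def)
    qed
  qed
qed

lemma limit_set_subset: "limit_set \<subseteq> E - {0}"
proof -
  obtain \<delta> where "\<delta> > 0" "\<And>z. z \<in> limit_set \<Longrightarrow> norm z > \<delta>"
    using stress_sets_bounded_away by metis
  then show ?thesis by (fastforce simp: limit_stress_set_def)
qed

text \<open>Finiteness holds because the set is bounded away from the origin. Since the density of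
  the tail measure is positive on it, nonzero Lebesgue measure carries over to the tail
  measure.\<close>

lemma emeasure_limit_set:
  "emeasure (tail_measure E s \<phi>) limit_set \<noteq> 0" "emeasure (tail_measure E s \<phi>) limit_set < \<infinity>"
proof -
  obtain \<delta> where "\<delta> > 0" "\<And>z. z \<in> limit_set \<Longrightarrow> norm z > \<delta>"
    using stress_sets_bounded_away by metis
  then show "emeasure (tail_measure E s \<phi>) limit_set < \<infinity>"
    using limit_set_subset by (intro emeasure_tail_measure_finite) auto
  show "emeasure (tail_measure E s \<phi>) limit_set \<noteq> 0"
  proof
    assume "emeasure (tail_measure E s \<phi>) limit_set = 0"
    then have "(\<integral>\<^sup>+z\<in>limit_set. tail_density z \<partial>lborel) = 0"
      using emeasure_tail_measure[OF limit_set_borel limit_set_subset] by simp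
    then have "AE z in lborel. tail_density z * indicator limit_set z = 0"
      by (subst (asm) nn_integral_0_iff_AE) auto
    moreover have "tail_density z > 0" if "z \<in> limit_set" for z
      using that limit_set_subset pos[of z] by (auto simp: tail_density_def subset_eq)
    ultimately have "AE z in lborel. z \<notin> limit_set"
      by (elim eventually_mono) (force simp: indicator_def split: if_splits)
    then have "emeasure lborel limit_set = 0"
      by (subst (asm) AE_iff_measurable[of limit_set]) auto
    then show False using regular by simp
  qed
qed

text \<open>The nondegeneracy that \<open>tail_preserving_gen_family\<close> asks for.\<close>

lemma tail_measure_nonzero: "emeasure (tail_measure E s \<phi>) (E - {0}) \<noteq> 0"
  using emeasure_limit_set(1) emeasure_mono[OF limit_set_subset, of "tail_measure E s \<phi>"]
  by (auto simp: sets_restrict_space_iff)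

end

section \<open>Convergence of the summaries\<close>

locale summary_system = stress_system E s \<phi> L Ls J
    for E :: "'a::euclidean_space set" and s and \<phi> and L Ls :: "'k::finite \<Rightarrow> 'a \<Rightarrow> real" and J +
  fixes W :: "real ^ 'k \<Rightarrow> 'y::metric_space" and D :: "'a set"
  assumes W: "W \<in> borel_measurable borel" and D: "D \<in> sets borel"
    and AE_D: "AE z in limit_stress_law E s \<phi> Ls J. z \<in> D"
    and W_cont: "z \<in> D \<Longrightarrow> isCont W (limit_loss Ls z)"
begin

text \<open>The discarded points are those where the limit indicator can jump and those of the limit
  set where \<open>W\<close> is not known to be continuous. Off the limit set the integrand
  vanishes, so \<open>D\<close> matters only inside it.\<close>

lemma AE_good:
  "AE z in density lborel tail_density. (\<forall>j\<in>J. Ls j z \<noteq> 1) \<and> (z \<in> limit_set \<longrightarrow> z \<in> D)"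
proof -
  have "{z \<in> E. Ls j z = 1} \<in> null_sets lborel" for j
  proof -
    have "{z \<in> E. Ls j z = 1} \<in> sets borel"
      by (intro borel_closed continuous_closed_preimage_constant[OF Ls_continuous closed])
    then show ?thesis
      using negligible_level[of j] by (simp add: negligible_iff_null_sets null_sets_completion_iff)
  qed
  then have "AE z in lborel. z \<notin> {z \<in> E. Ls j z = 1}" for j by (rule AE_not_in)
  then have "AE z in lborel. \<forall>j\<in>J. z \<notin> {z \<in> E. Ls j z = 1}" by (intro AE_finite_allI) auto
  then have 1: "AE z in density lborel tail_density. \<forall>j\<in>J. Ls j z \<noteq> 1"
    by (subst AE_density) (auto simp: tail_density_def indicator_def elim!: eventually_mono)
  have "AE z in tail_measure E s \<phi>. z \<in> limit_set \<longrightarrow> z \<in> D"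
    using AE_D unfolding limit_stress_law_def
    by (subst (asm) AE_uniform_measure) (use emeasure_limit_set in auto)
  then have "AE z in density lborel tail_density. z \<in> E - {0} \<longrightarrow> z \<in> limit_set \<longrightarrow> z \<in> D"
    unfolding tail_measure_eq_density by (subst (asm) AE_restrict_space_iff) auto
  then have 2: "AE z in density lborel tail_density. z \<in> limit_set \<longrightarrow> z \<in> D"
    by eventually_elim (use limit_set_subset in auto)
  show ?thesis using 1 2 by eventually_elim auto
qed

text \<open>Away from the level sets the indicator is eventually constant near \<open>z\<close>.
  Inside the limit set all inequalities are strict and continuity of \<open>W\<close> takes over;
  outside, one of them fails strictly, so the product is eventually 0 whatever \<open>W\<close>
  does.\<close>

lemma summary_converges:
  fixes g :: "'y \<Rightarrow> real"
  assumes g: "continuous_on UNIV g" and zE: "z \<in> E"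
    and good: "\<forall>j\<in>J. Ls j z \<noteq> 1" "z \<in> limit_set \<longrightarrow> z \<in> D"
  shows "((\<lambda>(u, y). indicator (scaled_set u) y * g (W (scaled_loss L u y))) \<longlongrightarrow>
    indicator limit_set z * g (W (limit_loss Ls z))) (at_top \<times>\<^sub>F near z)"
proof -
  have lim: "((\<lambda>p. L j (fst p *\<^sub>R snd p) / fst p) \<longlongrightarrow> Ls j z) (at_top \<times>\<^sub>F near z)" for j
    using loss_converges[OF zE] by (simp add: split_beta')
  have pos: "\<forall>\<^sub>F p in at_top \<times>\<^sub>F near z. fst p > (0::real)"
    by (rule eventually_compose_filterlim[OF eventually_gt_at_top filterlim_fst])
  have inE: "\<forall>\<^sub>F p in (at_top :: real filter) \<times>\<^sub>F near z. snd p \<in> E"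
    by (rule eventually_compose_filterlim[OF _ filterlim_snd]) (simp add: eventually_inf_principal)
  show ?thesis
  proof (cases "z \<in> limit_set")
    case True
    have "\<forall>\<^sub>F p in at_top \<times>\<^sub>F near z. \<forall>j\<in>J. 1 < L j (fst p *\<^sub>R snd p) / fst p"
    proof (rule eventually_ball_finite)
      show "\<forall>j\<in>J. \<forall>\<^sub>F p in at_top \<times>\<^sub>F near z. 1 < L j (fst p *\<^sub>R snd p) / fst p"
      proof
        fix j assume "j \<in> J"
        then have "1 < Ls j z" using True good(1) by (force simp: limit_stress_set_def)
        then show "\<forall>\<^sub>F p in at_top \<times>\<^sub>F near z. 1 < L j (fst p *\<^sub>R snd p) / fst p"
          by (rule order_tendstoD(1)[OF lim])
      qed
    qed simp
    then have ev: "\<forall>\<^sub>F p in at_top \<times>\<^sub>F near z. g (W (scaled_loss L (fst p) (snd p))) =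
        indicator (scaled_set (fst p)) (snd p) * g (W (scaled_loss L (fst p) (snd p)))"
      using pos inE by eventually_elim (auto simp: mem_scaled_set less_imp_le)
    have "((\<lambda>p. scaled_loss L (fst p) (snd p)) \<longlongrightarrow> limit_loss Ls z) (at_top \<times>\<^sub>F near z)"
      unfolding scaled_loss_def limit_loss_def by (intro tendsto_vec_lambda lim)
    then have "((\<lambda>p. W (scaled_loss L (fst p) (snd p))) \<longlongrightarrow> W (limit_loss Ls z)) (at_top \<times>\<^sub>F near z)"
      using W_cont True good(2) by (intro isCont_tendsto_compose[of _ W]) auto
    then have "((\<lambda>p. g (W (scaled_loss L (fst p) (snd p)))) \<longlongrightarrow> g (W (limit_loss Ls z))) (at_top \<times>\<^sub>F near z)"
      using g by (intro isCont_tendsto_compose[of _ g]) (auto simp: continuous_on_eq_continuous_at)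
    from Lim_transform_eventually[OF this ev] show ?thesis using True by (simp add: split_beta')
  next
    case False
    then obtain j where "j \<in> J" "Ls j z < 1" using zE by (auto simp: limit_stress_set_def not_le)
    have "\<forall>\<^sub>F p in at_top \<times>\<^sub>F near z. L j (fst p *\<^sub>R snd p) / fst p < 1"
      by (rule order_tendstoD(2)[OF lim]) fact
    then have "\<forall>\<^sub>F p in at_top \<times>\<^sub>F near z.
        indicator (scaled_set (fst p)) (snd p) * g (W (scaled_loss L (fst p) (snd p))) = 0"
      using pos by eventually_elim (use \<open>j \<in> J\<close> in \<open>force simp: mem_scaled_set indicator_def\<close>)
    then show ?thesis using False by (simp add: split_beta' tendsto_eventually)
  qed
qed

text \<open>Cutting all measures down to \<open>K\<close> makes them finite without changing the
  integrals for large \<open>u\<close>, since the integrands vanish off the stress sets. The cut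
  measures satisfy \<open>ball_convergence\<close> along every sequence of parameters.\<close>

lemma scaled_integral_tendsto:
  fixes N :: "real \<Rightarrow> 'w measure" and g :: "'y \<Rightarrow> real"
  assumes tp: "tail_preserving E s \<phi> N X"
    and g: "continuous_on UNIV g" "bounded (range g)"
  shows "((\<lambda>u. u powr s * (\<integral>z. indicator (scaled_set u) z * g (W (scaled_loss L u z))
        \<partial>distr (N u) borel (\<lambda>\<omega>. X u \<omega> /\<^sub>R u))) \<longlongrightarrow>
     (\<integral>z. indicator limit_set z * g (W (limit_loss Ls z)) \<partial>density lborel tail_density)) at_top"
proof -
  obtain \<delta> U where \<delta>: "\<delta> > 0" "U > 0" "\<And>u z. u \<ge> U \<Longrightarrow> z \<in> scaled_set u \<Longrightarrow> norm z > \<delta>"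
    "\<And>z. z \<in> limit_set \<Longrightarrow> norm z > \<delta>"
    using stress_sets_bounded_away by metis
  obtain C where C: "\<And>y. \<bar>g y\<bar> \<le> C" using g(2) by (auto simp: bounded_iff)
  have C0: "C \<ge> 0" using order_trans[OF abs_ge_zero C] .
  define K where "K = {z \<in> E. norm z > \<delta>}"
  have K: "K \<subseteq> E - {0}" "K \<in> sets borel" using \<delta>(1) by (auto simp: K_def)
  have [measurable]: "K \<in> sets borel" by fact
  have X: "cone_random_vector E (N u) (X u)" if "u > 0" for u
    using tp that by (simp add: tail_preserving_def)
  define P where "P u = distr (N u) borel (\<lambda>\<omega>. X u \<omega> /\<^sub>R u)" for u
  have [measurable_cong, simp]: "sets (P u) = sets borel" for u by (simp add: P_def)
  define \<mu> where "\<mu> u = density (P u) (\<lambda>z. ennreal (u powr s * indicator K z))" for u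
  define \<nu> where "\<nu> = density (density lborel tail_density) (\<lambda>z. ennreal (indicator K z))"
  have [measurable_cong, simp]: "sets (\<mu> u) = sets borel" "sets \<nu> = sets borel" for u
    by (simp_all add: \<mu>_def \<nu>_def)
  define scaled where "scaled u = scale_measure (ennreal (u powr s))
              (restrict_space (distr (N u) borel (\<lambda>\<omega>. X u \<omega> /\<^sub>R u)) (E - {0}))" for u
  have conv: "((\<lambda>u. emeasure (scaled u) B) \<longlongrightarrow> emeasure (tail_measure E s \<phi>) B) at_top"
    if "B \<in> sets (restrict_space borel (E - {0}))" "0 \<notin> closure B"
      "emeasure (tail_measure E s \<phi>) (top_of_set (E - {0}) frontier_of B) = 0" for B
    using tp that unfolding tail_preserving_def M0_converges_def scaled_def by blast
  have em_\<mu>: "emeasure (\<mu> u) B = emeasure (scaled u) (B \<inter> K)"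
    if u: "u > 0" and [measurable]: "B \<in> sets borel" for u B
  proof -
    have [measurable]: "X u \<in> borel_measurable (N u)" using X[OF u] by (simp add: cone_random_vector_def)
    have "emeasure (\<mu> u) B = (\<integral>\<^sup>+z. ennreal (u powr s) * indicator (B \<inter> K) z \<partial>P u)"
      unfolding \<mu>_def by (subst emeasure_density) (auto intro!: nn_integral_cong simp: indicator_def)
    also have "\<dots> = ennreal (u powr s) * emeasure (P u) (B \<inter> K)"
      by (rule nn_integral_cmult_indicator) simp
    also have "emeasure (P u) (B \<inter> K) = emeasure (N u) {\<omega> \<in> space (N u). X u \<omega> /\<^sub>R u \<in> B \<inter> K}"
      unfolding P_def by (subst emeasure_distr) (auto intro!: arg_cong2[where f=emeasure])
    also have "ennreal (u powr s) * \<dots> = emeasure (scaled u) (B \<inter> K)"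
      unfolding scaled_def by (rule emeasure_scaled_law[symmetric]) (use K in auto)
    finally show ?thesis .
  qed
  have em_\<nu>: "emeasure \<nu> B = emeasure (tail_measure E s \<phi>) (B \<inter> K)"
    if [measurable]: "B \<in> sets borel" for B
  proof -
    have "emeasure \<nu> B = (\<integral>\<^sup>+z\<in>B \<inter> K. tail_density z \<partial>lborel)"
      unfolding \<nu>_def by (subst emeasure_density)
        (auto simp: nn_integral_density intro!: nn_integral_cong simp: indicator_def)
    then show ?thesis by (subst emeasure_tail_measure) (use K in auto)
  qed
  have ball_conv: "((\<lambda>u. emeasure (\<mu> u) B) \<longlongrightarrow> emeasure \<nu> B) at_top"
    if B: "open B" "negligible (frontier B)" for B
  proof -
    have [measurable]: "B \<in> sets borel" using B(1) by simp
    \<comment> \<open>Up to the ambient set \<open>E - {0}\<close>, the cutoff set is the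
      intersection of \<open>B\<close> with the complement of a ball, both with null
      frontier.\<close>
    define T where "T = B \<inter> - cball 0 \<delta>"
    have BK: "B \<inter> K = (E - {0}) \<inter> T" using \<delta>(1) by (auto simp: T_def K_def)
    have "negligible (frontier (- cball (0::'a) \<delta>))"
      unfolding frontier_complement by (rule negligible_convex_frontier) simp
    then have "negligible (frontier T)"
      unfolding T_def using negligible_subset[OF _ frontier_Int_subset] B(2) by (metis negligible_Un)
    then have "negligible (top_of_set (E - {0}) frontier_of (B \<inter> K))"
      unfolding BK by (rule negligible_subset[OF _ frontier_of_subset_frontier])
    then have "emeasure (tail_measure E s \<phi>) (top_of_set (E - {0}) frontier_of (B \<inter> K)) = 0"
      by (rule emeasure_tail_measure_negligible)
    moreover have "0 \<notin> closure (B \<inter> K)"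
      using \<delta>(1) by (auto simp: closure_approachable K_def intro!: exI[of _ \<delta>])
    ultimately have "((\<lambda>u. emeasure (scaled u) (B \<inter> K)) \<longlongrightarrow> emeasure (tail_measure E s \<phi>) (B \<inter> K)) at_top"
      using K by (intro conv) (auto simp: sets_restrict_space_iff)
    then have "((\<lambda>u. emeasure (scaled u) (B \<inter> K)) \<longlongrightarrow> emeasure \<nu> B) at_top"
      by (simp add: em_\<nu>)
    then show ?thesis
      by (rule Lim_transform_eventually) (use eventually_gt_at_top[of 0] in eventually_elim, simp add: em_\<mu>)
  qed
  define k where "k u z = indicator (scaled_set u) z * g (W (scaled_loss L u z))" for u z
  define k' where "k' z = indicator limit_set z * g (W (limit_loss Ls z))" for z
  have gW: "(\<lambda>x. g (W x)) \<in> borel_measurable borel"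
    using W borel_measurable_continuous_onI[OF g(1)] by (rule measurable_compose)
  have k_meas: "k u \<in> borel_measurable borel" if "u > 0" for u
  proof -
    have "(\<lambda>z. g (W (scaled_loss L u z))) \<in> borel_measurable (restrict_space borel E)"
      by (rule measurable_compose[OF measurable_scaled_loss[OF that] gW])
    then have [measurable]: "(\<lambda>z. indicator E z *\<^sub>R g (W (scaled_loss L u z))) \<in> borel_measurable borel"
      by (subst (asm) borel_measurable_restrict_space_iff) auto
    have "k u = (\<lambda>z. indicator (scaled_set u) z * (indicator E z *\<^sub>R g (W (scaled_loss L u z))))"
      using mem_scaled_set[OF that] by (auto simp: k_def indicator_def fun_eq_iff)
    then show ?thesis by (simp only:) measurable
  qed
  have k'_meas: "k' \<in> borel_measurable borel"
  proof -
    have "(\<lambda>z. g (W (limit_loss Ls z))) \<in> borel_measurable (restrict_space borel E)"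
      by (rule measurable_compose[OF measurable_limit_loss gW])
    then have [measurable]: "(\<lambda>z. indicator E z *\<^sub>R g (W (limit_loss Ls z))) \<in> borel_measurable borel"
      by (subst (asm) borel_measurable_restrict_space_iff) auto
    have "k' = (\<lambda>z. indicator limit_set z * (indicator E z *\<^sub>R g (W (limit_loss Ls z))))"
      using limit_set_subset by (auto simp: k'_def indicator_def fun_eq_iff)
    then show ?thesis by (simp only:) measurable
  qed
  \<comment> \<open>\<open>ball_convergence\<close> is required for every index, whereas the family
    is only controlled for \<open>u > 0\<close>; the \<open>max\<close> removes the bad parameters
    and does not affect the limit. Sequences are used because the Fatou lemma is sequential.\<close>
  have "((\<lambda>u. \<integral>z. k (max 1 u) z \<partial>\<mu> (max 1 u)) \<longlongrightarrow> (\<integral>z. k' z \<partial>\<nu>)) at_top"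
  proof (rule tendsto_at_topI_sequentially)
    fix Y :: "nat \<Rightarrow> real" assume "filterlim Y at_top sequentially"
    define V where "V n = max 1 (Y n)" for n
    have V: "filterlim V at_top sequentially"
      by (rule filterlim_at_top_mono[OF \<open>filterlim Y at_top sequentially\<close>]) (simp add: V_def)
    have Vpos: "V n > 0" for n by (simp add: V_def)
    interpret ball_convergence E "\<lambda>n. \<mu> (V n)" \<nu>
    proof (rule ball_convergence.intro)
      fix n
      have [measurable]: "X (V n) \<in> borel_measurable (N (V n))"
        using X[OF Vpos] by (simp add: cone_random_vector_def)
      interpret N: prob_space "N (V n)" using X[OF Vpos[of n]] by (simp add: cone_random_vector_def)
      interpret P: prob_space "P (V n)" unfolding P_def by (rule N.prob_space_distr) measurable
      have "space (P (V n)) = UNIV" by (simp add: P_def)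
      then have "emeasure (\<mu> (V n)) (space (\<mu> (V n))) =
          (\<integral>\<^sup>+z. ennreal (V n powr s * indicator K z) \<partial>P (V n))"
        unfolding \<mu>_def by (simp add: emeasure_density)
      also have "\<dots> \<le> (\<integral>\<^sup>+z. ennreal (V n powr s) \<partial>P (V n))"
        by (intro nn_integral_mono ennreal_leI) (auto simp: indicator_def)
      also have "\<dots> < \<infinity>" by (simp add: P.emeasure_space_1)
      finally show "finite_measure (\<mu> (V n))" by (intro finite_measureI) simp
      show "AE z in \<mu> (V n). z \<in> E"
        unfolding \<mu>_def by (subst AE_density) (auto simp: K_def indicator_def)
      show "E \<in> sets borel" by simp
    next
      have "emeasure (tail_measure E s \<phi>) K < \<infinity>"
        by (rule emeasure_tail_measure_finite[OF \<delta>(1) K(1)]) (simp add: K_def)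
      moreover have "space \<nu> = UNIV" by (simp add: \<nu>_def)
      ultimately show "finite_measure \<nu>" using em_\<nu>[of UNIV] by (intro finite_measureI) simp
    next
      fix \<F> :: "'a set set" assume F: "finite \<F>" "\<F> \<subseteq> balls"
      show "(\<lambda>n. emeasure (\<mu> (V n)) (\<Union>\<F>)) \<longlonglongrightarrow> emeasure \<nu> (\<Union>\<F>)"
        by (rule filterlim_compose[OF ball_conv V])
           (use F negligible_frontier_balls[OF F] in \<open>auto simp: balls_def\<close>)
    next
      show "(\<lambda>n. emeasure (\<mu> (V n)) UNIV) \<longlonglongrightarrow> emeasure \<nu> UNIV"
        by (rule filterlim_compose[OF ball_conv V]) auto
    qed simp_all
    have "(\<lambda>n. \<integral>z. k (V n) z \<partial>\<mu> (V n)) \<longlonglongrightarrow> (\<integral>z. k' z \<partial>\<nu>)"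
    proof (rule integral_tendsto)
      show "\<bar>k (V n) z\<bar> \<le> C" "\<bar>k' z\<bar> \<le> C" for n z
        using C C0 by (auto simp: k_def k'_def indicator_def)
      have "AE z in \<nu>. z \<in> E \<and> (\<forall>j\<in>J. Ls j z \<noteq> 1) \<and> (z \<in> limit_set \<longrightarrow> z \<in> D)"
        unfolding \<nu>_def
        by (subst AE_density, simp, use AE_good in eventually_elim) (auto simp: K_def indicator_def)
      then show "AE z in \<nu>. ((\<lambda>(n, y). k (V n) y) \<longlongrightarrow> k' z) (sequentially \<times>\<^sub>F near z)"
      proof eventually_elim
        case (elim z)
        \<comment> \<open>Convergence along real parameters is pulled back to the sequence
          \<open>V\<close>, the point variable staying free.\<close>
        have "filterlim (\<lambda>p. (V (fst p), snd p)) (at_top \<times>\<^sub>F near z) (sequentially \<times>\<^sub>F near z)"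
          by (intro filterlim_Pair filterlim_compose[OF V] filterlim_fst filterlim_snd)
        from filterlim_compose[OF summary_converges[OF g(1), of z] this] elim
        show ?case by (simp add: split_beta' k_def k'_def)
      qed
    qed (use k_meas[OF Vpos] k'_meas in auto)
    then show "(\<lambda>n. \<integral>z. k (max 1 (Y n)) z \<partial>\<mu> (max 1 (Y n))) \<longlonglongrightarrow> (\<integral>z. k' z \<partial>\<nu>)"
      by (simp add: V_def)
  qed
  moreover have "(\<integral>z. k' z \<partial>\<nu>) = (\<integral>z. k' z \<partial>density lborel tail_density)"
  proof -
    have "(\<integral>z. k' z \<partial>\<nu>) = (\<integral>z. indicator K z *\<^sub>R k' z \<partial>density lborel tail_density)"
      unfolding \<nu>_def by (rule integral_density) (use k'_meas in auto)
    also have "(\<lambda>z. indicator K z *\<^sub>R k' z) = k'"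
      using \<delta>(4) limit_set_subset by (auto simp: K_def k'_def indicator_def fun_eq_iff)
    finally show ?thesis .
  qed
  moreover have "\<forall>\<^sub>F u in at_top. (\<integral>z. k (max 1 u) z \<partial>\<mu> (max 1 u)) = u powr s * (\<integral>z. k u z \<partial>P u)"
    using eventually_ge_at_top[of "max 1 U"]
  proof eventually_elim
    case (elim u)
    then have u: "u > 0" "u \<ge> U" "max 1 u = u" by auto
    have "(\<integral>z. k u z \<partial>\<mu> u) = (\<integral>z. (u powr s * indicator K z) *\<^sub>R k u z \<partial>P u)"
      unfolding \<mu>_def by (rule integral_density) (use k_meas[OF u(1)] in auto)
    also have "(\<lambda>z. (u powr s * indicator K z) *\<^sub>R k u z) = (\<lambda>z. u powr s * k u z)"
      using \<delta>(3)[OF u(2)] mem_scaled_set[OF u(1)]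
      by (auto simp: K_def k_def indicator_def fun_eq_iff)
    finally show ?case using u(3) by simp
  qed
  ultimately show ?thesis
    unfolding P_def k_def k'_def by (simp add: tendsto_cong)
qed

text \<open>The conditional expectation of \<open>g\<close> is the quotient of the scaled integrals
  for \<open>g\<close> and for the constant 1. Both converge, and the limit of the second is
  positive.\<close>

lemma summary_converges_in_law:
  fixes N :: "real \<Rightarrow> 'w measure"
  assumes tp: "tail_preserving E s \<phi> N X"
  shows "converges_in_law
     (\<lambda>u. distr (conditional_scaled_law E (N u) (X u) (stress_set E L u J) u) borel
        (\<lambda>z. W (scaled_loss L u z)))
     (distr (limit_stress_law E s \<phi> Ls J) borel (\<lambda>z. W (limit_loss Ls z))) at_top"
proof -
  define P where "P u = distr (N u) borel (\<lambda>\<omega>. X u \<omega> /\<^sub>R u)" for u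
  define T where "T = density lborel tail_density"
  define I where "I u h = (\<integral>z. indicator (scaled_set u) z * h (W (scaled_loss L u z)) \<partial>P u)" for u and h :: "'y \<Rightarrow> real"
  define I' where "I' h = (\<integral>z. indicator limit_set z * h (W (limit_loss Ls z)) \<partial>T)" for h :: "'y \<Rightarrow> real"
  have X: "cone_random_vector E (N u) (X u)" if "u > 0" for u
    using tp that by (simp add: tail_preserving_def)
  have lim: "((\<lambda>u. u powr s * I u h) \<longlongrightarrow> I' h) at_top"
    if "continuous_on UNIV h" "bounded (range h)" for h
    using scaled_integral_tendsto[OF tp that] by (simp add: I_def I'_def P_def T_def)
  have mass: "emeasure T limit_set = emeasure (tail_measure E s \<phi>) limit_set"
    unfolding tail_measure_eq_density T_def using limit_set_subset by (subst emeasure_restrict_space) auto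
  have I'1: "I' (\<lambda>_. 1) = measure (tail_measure E s \<phi>) limit_set"
    using mass by (simp add: I'_def T_def measure_def)
  have mpos: "measure (tail_measure E s \<phi>) limit_set > 0"
    using emeasure_limit_set by (simp add: measure_def enn2real_positive_iff zero_less_iff_neq_zero)
  have I1: "I u (\<lambda>_. 1) = measure (P u) (scaled_set u)" for u
    unfolding I_def by (simp add: P_def)
  have hW: "(\<lambda>x. h (W x)) \<in> borel_measurable borel" if "continuous_on UNIV h" for h :: "'y \<Rightarrow> real"
    using W borel_measurable_continuous_onI[OF that] by (rule measurable_compose)
  have bounded_one: "bounded (range (\<lambda>_::'y. 1::real))" by (auto simp: bounded_iff)
  \<comment> \<open>The test function 1 also shows that the conditioning event is eventually not
    null, so that the conditional laws are probability measures.\<close>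
  have "\<forall>\<^sub>F u in at_top. 0 < u powr s * I u (\<lambda>_. 1)"
    using lim[of "\<lambda>_. 1"] bounded_one mpos by (intro order_tendstoD(1)) (auto simp: I'1)
  then have pos: "\<forall>\<^sub>F u in at_top. u > 0 \<and> measure (N u) {\<omega> \<in> space (N u). X u \<omega> \<in> stress_set E L u J} > 0"
    using eventually_gt_at_top[of 0]
  proof eventually_elim
    case (elim u)
    have [measurable]: "X u \<in> borel_measurable (N u)" using X[OF elim(2)] by (simp add: cone_random_vector_def)
    have "measure (P u) (scaled_set u) = measure (N u) ((\<lambda>\<omega>. X u \<omega> /\<^sub>R u) -` scaled_set u \<inter> space (N u))"
      unfolding P_def by (rule measure_distr) auto
    also have "(\<lambda>\<omega>. X u \<omega> /\<^sub>R u) -` scaled_set u \<inter> space (N u) =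
        {\<omega> \<in> space (N u). X u \<omega> \<in> stress_set E L u J}"
      using elim(2) by (auto simp: scaled_set_def)
    finally show ?case using elim by (auto simp: I1 zero_less_mult_iff)
  qed
  define law where "law u = conditional_scaled_law E (N u) (X u) (stress_set E L u J) u" for u
  have sets_law: "sets (law u) = sets (restrict_space borel E)" for u
    unfolding law_def conditional_scaled_law_def by (rule sets_restrict_space_cong) simp
  have law: "prob_space (law u)"
    "continuous_on UNIV h \<Longrightarrow> (\<integral>z. h (W (scaled_loss L u z)) \<partial>law u) = I u h / I u (\<lambda>_. 1)"
    if u: "u > 0" "measure (N u) {\<omega> \<in> space (N u). X u \<omega> \<in> stress_set E L u J} > 0"
    for u and h :: "'y \<Rightarrow> real"
  proof -
    have Xu: "prob_space (N u)" "X u \<in> borel_measurable (N u)"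
      using X[OF u(1)] by (auto simp: cone_random_vector_def)
    have S: "stress_set E L u J \<subseteq> E" by (auto simp: stress_set_def)
    note law = conditional_scaled_law[OF Xu stress_set_borel E_borel S cone u, folded law_def scaled_set_def P_def]
    \<comment> \<open>The fact is stated together with an integrand, so a trivial one is
      supplied.\<close>
    show "prob_space (law u)" by (rule law(1)[of "\<lambda>_. 0"]) simp
    assume "continuous_on UNIV h"
    then have "(\<lambda>z. h (W (scaled_loss L u z))) \<in> borel_measurable (restrict_space borel E)"
      by (intro measurable_compose[OF measurable_scaled_loss[OF u(1)] hW])
    from law(2)[OF this] show "(\<integral>z. h (W (scaled_loss L u z)) \<partial>law u) = I u h / I u (\<lambda>_. 1)"
      unfolding I1 by (simp add: I_def)
  qed
  have distr_u: "(\<lambda>z. W (scaled_loss L u z)) \<in> borel_measurable (law u)" if "u > 0" for u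
    using measurable_compose[OF measurable_scaled_loss[OF that] W]
    by (simp add: measurable_cong_sets[OF sets_law refl])
  have sets_lim: "sets (limit_stress_law E s \<phi> Ls J) = sets (restrict_space borel (E - {0}))"
    by (simp add: limit_stress_law_def)
  have meas_lim: "limit_loss Ls \<in> borel_measurable (restrict_space borel (E - {0}))"
    by (rule measurable_restrict_mono[OF measurable_limit_loss]) auto
  have distr_lim: "(\<lambda>z. W (limit_loss Ls z)) \<in> borel_measurable (limit_stress_law E s \<phi> Ls J)"
    using measurable_compose[OF meas_lim W]
    by (simp add: measurable_cong_sets[OF sets_lim refl])
  have lim_prob: "prob_space (limit_stress_law E s \<phi> Ls J)"
    unfolding limit_stress_law_def
    by (rule prob_space_uniform_measure) (use emeasure_limit_set in auto)
  have lim_int: "(\<integral>z. h (W (limit_loss Ls z)) \<partial>limit_stress_law E s \<phi> Ls J) = I' h / I' (\<lambda>_. 1)"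
    if h: "continuous_on UNIV h" for h :: "'y \<Rightarrow> real"
  proof -
    have "(\<integral>z. h (W (limit_loss Ls z)) \<partial>limit_stress_law E s \<phi> Ls J) =
      (\<integral>z. indicator limit_set z * h (W (limit_loss Ls z)) \<partial>tail_measure E s \<phi>) / I' (\<lambda>_. 1)"
      unfolding limit_stress_law_def I'1
    proof (rule integral_uniform_measure)
      show "limit_set \<in> sets (tail_measure E s \<phi>)"
        using limit_set_subset by (simp add: sets_restrict_space_iff)
      show "(\<lambda>z. h (W (limit_loss Ls z))) \<in> borel_measurable (tail_measure E s \<phi>)"
        using measurable_compose[OF meas_lim hW[OF h]]
        by (simp add: measurable_cong_sets[OF sets_tail_measure refl])
    qed (use emeasure_limit_set in auto)
    also have "(\<integral>z. indicator limit_set z * h (W (limit_loss Ls z)) \<partial>tail_measure E s \<phi>) =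
       (\<integral>z. indicator (E - {0}) z *\<^sub>R (indicator limit_set z * h (W (limit_loss Ls z))) \<partial>T)"
      unfolding tail_measure_eq_density T_def by (rule integral_restrict_space) simp
    also have "\<dots> = I' h"
      unfolding I'_def using limit_set_subset
      by (intro Bochner_Integration.integral_cong) (auto simp: indicator_def)
    finally show ?thesis .
  qed
  show ?thesis
    unfolding converges_in_law_def law_def[symmetric]
  proof (intro conjI allI impI)
    show "\<forall>\<^sub>F u in at_top. prob_space (distr (law u) borel (\<lambda>z. W (scaled_loss L u z))) \<and>
        sets (distr (law u) borel (\<lambda>z. W (scaled_loss L u z))) = sets borel"
      using pos by eventually_elim (auto intro!: prob_space.prob_space_distr law distr_u)
    show "prob_space (distr (limit_stress_law E s \<phi> Ls J) borel (\<lambda>z. W (limit_loss Ls z)))"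
      by (rule prob_space.prob_space_distr[OF lim_prob distr_lim])
    show "sets (distr (limit_stress_law E s \<phi> Ls J) borel (\<lambda>z. W (limit_loss Ls z))) = sets borel"
      by simp
    fix g :: "'y \<Rightarrow> real" assume g: "continuous_on UNIV g \<and> bounded (range g)"
    then have gm: "g \<in> borel_measurable borel" by (auto intro: borel_measurable_continuous_onI)
    have "((\<lambda>u. (u powr s * I u g) / (u powr s * I u (\<lambda>_. 1))) \<longlongrightarrow> I' g / I' (\<lambda>_. 1)) at_top"
      using g bounded_one mpos by (intro tendsto_divide lim) (auto simp: I'1)
    moreover have "\<forall>\<^sub>F u in at_top. (u powr s * I u g) / (u powr s * I u (\<lambda>_. 1)) =
        (\<integral>x. g x \<partial>distr (law u) borel (\<lambda>z. W (scaled_loss L u z)))"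
      using pos
    proof eventually_elim
      case (elim u)
      then show ?case
        using law(2)[of u g] g by (subst integral_distr[OF distr_u gm]) auto
    qed
    ultimately have "((\<lambda>u. \<integral>x. g x \<partial>distr (law u) borel (\<lambda>z. W (scaled_loss L u z))) \<longlongrightarrow> I' g / I' (\<lambda>_. 1)) at_top"
      by (rule Lim_transform_eventually)
    also have "I' g / I' (\<lambda>_. 1) = (\<integral>x. g x \<partial>distr (limit_stress_law E s \<phi> Ls J) borel (\<lambda>z. W (limit_loss Ls z)))"
      using lim_int g by (subst integral_distr[OF distr_lim gm]) auto
    finally show "((\<lambda>u. \<integral>x. g x \<partial>distr (law u) borel (\<lambda>z. W (scaled_loss L u z))) \<longlongrightarrow>
       (\<integral>x. g x \<partial>distr (limit_stress_law E s \<phi> Ls J) borel (\<lambda>z. W (limit_loss Ls z)))) at_top" .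
  qed
qed

end

theorem proposition3:
  fixes E :: "'a::euclidean_space set"
    and M :: "'v measure" and \<xi> :: "'v \<Rightarrow> 'a" and f :: "'a \<Rightarrow> real"
    and s :: real and \<phi> :: "'a \<Rightarrow> real"
    and L Ls :: "'k::finite \<Rightarrow> 'a \<Rightarrow> real"
    and JJ :: "'k set set" and J :: "'k set"
    and W :: "real ^ 'k \<Rightarrow> 'y::metric_space"
    and D\<^sub>0 :: "'a set"
  assumes cone: "closed E" "cone E"
    and law: "prob_space M" "\<And>z. f z \<ge> 0" "\<And>z. z \<notin> E \<Longrightarrow> f z = 0"
      "distributed M lborel \<xi> (\<lambda>z. ennreal (f z))"
    and regvar: "density_regular_variation E f s \<phi>"
    and loss: "asymptotically_homogeneous E L Ls"
    and JJ: "\<And>I. I \<in> JJ \<Longrightarrow> I \<noteq> {}" and reg: "regular_system E Ls JJ" and J: "J \<in> JJ"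
    and W: "W \<in> borel_measurable borel"
    and D0: "D\<^sub>0 \<in> sets borel" "D\<^sub>0 \<subseteq> E" "AE z in limit_stress_law E s \<phi> Ls J. z \<in> D\<^sub>0"
    and cont: "\<And>z. z \<in> D\<^sub>0 \<Longrightarrow> isCont W (limit_loss Ls z)"
  defines "limit_law \<equiv>
      distr (limit_stress_law E s \<phi> Ls J) borel (\<lambda>z. W (limit_loss Ls z))"
  shows
    "converges_in_law
       (\<lambda>u. distr (conditional_scaled_law E M \<xi> (stress_set E L u J) u) borel
              (\<lambda>z. W (scaled_loss L u z)))
       limit_law at_top \<and>
     (\<forall>(N :: real \<Rightarrow> 'w measure) X. tail_preserving E s \<phi> N X \<longrightarrow>
       converges_in_law
         (\<lambda>u. distr (conditional_scaled_law E (N u) (X u) (stress_set E L u J) u) borel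
                (\<lambda>z. W (scaled_loss L u z)))
         limit_law at_top) \<and>
     (\<forall>t (N :: real \<Rightarrow> 'w measure) X. gen_family E M \<xi> f s t N X \<longrightarrow>
       converges_in_law
         (\<lambda>u. distr (conditional_scaled_law E (N u) (X u) (stress_set E L u J) u) borel
                (\<lambda>z. W (scaled_loss L u z)))
         limit_law at_top)"
proof -
  \<comment> \<open>The name \<open>cont\<close> is about to be taken over by the continuity of
    \<open>\<phi>\<close> from the interpreted locale.\<close>
  note isCont_W = cont
  interpret regular_tail E s \<phi> f
    by (rule regular_tailI[OF cone law(2,3) regvar])
  interpret summary_system E s \<phi> L Ls J W D\<^sub>0
  proof
    show "J \<noteq> {}" by (rule JJ[OF J])
    show "emeasure lebesgue (limit_stress_set E Ls J) \<noteq> 0"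
      using reg J by (simp add: regular_system_def)
    show "isCont W (limit_loss Ls z)" if "z \<in> D\<^sub>0" for z by (rule isCont_W[OF that])
  qed (fact loss W D0)+
  show ?thesis
    unfolding limit_law_def
    using summary_converges_in_law[OF tail_preserving_density[OF law(1,4)]]
      summary_converges_in_law
      summary_converges_in_law[OF tail_preserving_gen_family[OF law(1,4) tail_measure_nonzero]]
    by blast
qed

end
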